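(* Let $v,w\in S_n$ with $v\le w$ in Bruhat order. The complexity of the Kazhdan--Lusztig variety $\mathcal{N}_{v,w}$ with respect to the usual torus action is the same as the complexity of the Richardson variety $X_w^v$ with respect to the $T$-action.
   Context: Let $G=GL_n(\mathbb{C})$, $B$ the upper triangular Borel subgroup, $B_-$ the lower triangular one, $T$ the diagonal torus; permutations are identified with permutation matrices with $1$ in position $(w(j),j)$ for each $j$. $T$ acts on $G/B$ by left multiplication. The Schubert variety $X_w\subset G/B$ is the closure of $BwB/B$; the opposite Schubert cell is $\Omega_v^\circ=B_-vB/B$ and the opposite Schubert variety is $X^v=\overline{\Omega_v^\circ}$. The Kazhdan--Lusztig variety is $\mathcal{N}_{v,w}=X_w\cap\Omega_v^\circ$ and the Richardson variety is $X_w^v=X_w\cap X^v$; both are $T$-invariant, and the usual torus action on $\mathcal{N}_{v,w}$ is the restricted $T$-action. The complexity of a torus action on a variety $X$ is $\dim X$ minus the dimension of a general torus orbit (the action need not be effective; one passes to the quotient of the torus by the subgroup acting trivially). *)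

theory Defs
  imports
    "Jordan_Normal_Form.Matrix"
    "HOL-Algebra.Left_Coset"
    "HOL-Algebra.Group_Action"
    "HOL-Analysis.Abstract_Topology"
    "HOL-Combinatorics.Permutations"
    "HOL-Library.Extended_Nat"
begin

section \<open>Dimension and complexity\<close>

definition irreducible_in :: "'a topology \<Rightarrow> 'a set \<Rightarrow> bool" where
  "irreducible_in X Z \<longleftrightarrow> Z \<subseteq> topspace X \<and> Z \<noteq> {} \<and>
     (\<forall>C D. closedin X C \<and> closedin X D \<and> Z \<subseteq> C \<union> D \<longrightarrow> Z \<subseteq> C \<or> Z \<subseteq> D)"

text \<open>
  Krull dimension: the supremum of the lengths \<open>k\<close> of chains
  \<open>Z 0 \<subset> \<dots> \<subset> Z k\<close> of irreducible closed subsets.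
\<close>

definition krull_dim :: "'a topology \<Rightarrow> enat" where
  "krull_dim X = Sup {enat k | k. \<exists>Z :: nat \<Rightarrow> 'a set.
     (\<forall>i\<le>k. closedin X (Z i) \<and> irreducible_in X (Z i)) \<and> (\<forall>i<k. Z i \<subset> Z (Suc i))}"

text \<open>
  A group \<open>T\<close> acts on the space \<open>X\<close> through \<open>\<phi>\<close>. A general orbit has dimension \<open>d\<close> if
  the orbits of all points in some dense open subset of \<open>X\<close> have dimension \<open>d\<close>.
\<close>

definition is_general_orbit_dim ::
  "('t, 'b) monoid_scheme \<Rightarrow> ('t \<Rightarrow> 'a \<Rightarrow> 'a) \<Rightarrow> 'a topology \<Rightarrow> enat \<Rightarrow> bool" where
  "is_general_orbit_dim T \<phi> X d \<longleftrightarrow>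
     (\<exists>U. openin X U \<and> X closure_of U = topspace X \<and>
          (\<forall>x\<in>U. krull_dim (subtopology X (orbit T \<phi> x)) = d))"

lemma is_general_orbit_dim_unique:
  assumes "is_general_orbit_dim T \<phi> X d" "is_general_orbit_dim T \<phi> X d'" "topspace X \<noteq> {}"
  shows "d = d'"
proof -
  obtain U where U: "openin X U" "X closure_of U = topspace X"
    "\<forall>x\<in>U. krull_dim (subtopology X (orbit T \<phi> x)) = d"
    using assms(1) unfolding is_general_orbit_dim_def by blast
  obtain V where V: "openin X V" "X closure_of V = topspace X"
    "\<forall>x\<in>V. krull_dim (subtopology X (orbit T \<phi> x)) = d'"
    using assms(2) unfolding is_general_orbit_dim_def by blast
  have "V \<noteq> {}"
    using V(2) assms(3) by (metis closure_of_empty)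
  then have "U \<inter> V \<noteq> {}"
    using U(2) V(1) dense_intersects_open by blast
  then obtain x where "x \<in> U" "x \<in> V"
    by auto
  then show ?thesis
    using U(3) V(3) by metis
qed

text \<open>
  Subtraction on \<^typ>\<open>enat\<close> is truncated, which is harmless here: the dimension of an orbit
  never exceeds the dimension of the invariant space containing it.
\<close>

definition complexity ::
  "('t, 'b) monoid_scheme \<Rightarrow> ('t \<Rightarrow> 'a \<Rightarrow> 'a) \<Rightarrow> 'a topology \<Rightarrow> enat" where
  "complexity T \<phi> X = krull_dim X - (THE d. is_general_orbit_dim T \<phi> X d)"


section \<open>The general linear group and its subgroups\<close>

abbreviation GL :: "nat \<Rightarrow> complex mat monoid" where
  "GL n \<equiv> units_of (ring_mat TYPE(complex) n ())"

definition borel_upper :: "nat \<Rightarrow> complex mat set" where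
  "borel_upper n = {g \<in> carrier (GL n). upper_triangular g}"

definition borel_lower :: "nat \<Rightarrow> complex mat set" where
  "borel_lower n = {g \<in> carrier (GL n). upper_triangular (transpose_mat g)}"

definition torus :: "nat \<Rightarrow> complex mat monoid" where
  "torus n = (GL n)\<lparr>carrier := {g \<in> carrier (GL n). diagonal_mat g}\<rparr>"


section \<open>The Zariski topology on the flag variety\<close>

inductive_set polynomial_functions :: "nat \<Rightarrow> (complex mat \<Rightarrow> complex) set" for n where
  const: "(\<lambda>_. c) \<in> polynomial_functions n"
| entry: "i < n \<Longrightarrow> j < n \<Longrightarrow> (\<lambda>g. g $$ (i, j)) \<in> polynomial_functions n"
| add: "p \<in> polynomial_functions n \<Longrightarrow> q \<in> polynomial_functions n \<Longrightarrow>
        (\<lambda>g. p g + q g) \<in> polynomial_functions n"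
| mult: "p \<in> polynomial_functions n \<Longrightarrow> q \<in> polynomial_functions n \<Longrightarrow>
        (\<lambda>g. p g * q g) \<in> polynomial_functions n"

text \<open>
  A regular function on the general linear group is a polynomial in the entries divided by a
  power of the determinant; the determinant has no zeros there, so the nonvanishing loci of
  polynomials already form a basis of the Zariski topology.
\<close>

definition zariski_GL :: "nat \<Rightarrow> complex mat topology" where
  "zariski_GL n = topology_generated_by
     {{g \<in> carrier (GL n). p g \<noteq> 0} | p. p \<in> polynomial_functions n}"

definition flag_points :: "nat \<Rightarrow> complex mat set set" where
  "flag_points n = lcosets\<^bsub>GL n\<^esub> borel_upper n"

text \<open>The quotient \<open>G/B\<close> carries the quotient topology along \<open>g \<mapsto> gB\<close>.\<close>

definition flag_variety :: "nat \<Rightarrow> complex mat set topology" where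
  "flag_variety n = topology (\<lambda>U. U \<subseteq> flag_points n \<and>
     openin (zariski_GL n) {g \<in> carrier (GL n). g <#\<^bsub>GL n\<^esub> borel_upper n \<in> U})"

lemma topspace_zariski_GL: "topspace (zariski_GL n) = carrier (GL n)"
proof -
  have "carrier (GL n) = {g \<in> carrier (GL n). (\<lambda>_. 1) g \<noteq> (0 :: complex)}"
    by simp
  then have "carrier (GL n) \<in> {{g \<in> carrier (GL n). p g \<noteq> 0} | p. p \<in> polynomial_functions n}"
    using polynomial_functions.const[of 1 n] by (intro CollectI exI[of _ "\<lambda>_. 1"] conjI)
  then show ?thesis
    unfolding zariski_GL_def topology_generated_by_topspace by blast
qed

lemma openin_flag_variety:
  "openin (flag_variety n) U \<longleftrightarrow> U \<subseteq> flag_points n \<and>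
     openin (zariski_GL n) {g \<in> carrier (GL n). g <#\<^bsub>GL n\<^esub> borel_upper n \<in> U}"
proof -
  define pre where "pre U = {g \<in> carrier (GL n). g <#\<^bsub>GL n\<^esub> borel_upper n \<in> U}" for U
  have Int: "pre (U \<inter> V) = pre U \<inter> pre V" for U V
    by (auto simp: pre_def)
  have Un: "pre (\<Union>\<K>) = (\<Union>U\<in>\<K>. pre U)" for \<K>
    by (auto simp: pre_def)
  have "istopology (\<lambda>U. U \<subseteq> flag_points n \<and> openin (zariski_GL n) (pre U))"
    unfolding istopology_def Int Un by blast
  then show ?thesis
    unfolding flag_variety_def pre_def by simp
qed

lemma topspace_flag_variety: "topspace (flag_variety n) = flag_points n"
proof -
  have "{g \<in> carrier (GL n). g <#\<^bsub>GL n\<^esub> borel_upper n \<in> flag_points n} = topspace (zariski_GL n)"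
    by (auto simp: flag_points_def LCOSETS_def topspace_zariski_GL)
  then have "openin (flag_variety n) (flag_points n)"
    unfolding openin_flag_variety using openin_topspace by simp
  then show ?thesis
    by (meson openin_flag_variety openin_subset openin_topspace subset_antisym)
qed

definition left_translation :: "nat \<Rightarrow> complex mat \<Rightarrow> complex mat set \<Rightarrow> complex mat set" where
  "left_translation n g C = g <#\<^bsub>GL n\<^esub> C"


section \<open>Permutations and Bruhat order\<close>

text \<open>
  Elements of \<open>S\<^sub>n\<close> are permutations of \<open>{..<n}\<close>, so rows and columns are numbered from 0.
\<close>

definition perm_matrix :: "nat \<Rightarrow> (nat \<Rightarrow> nat) \<Rightarrow> complex mat" where
  "perm_matrix n w = mat n n (\<lambda>(i, j). if i = w j then 1 else 0)"

text \<open>The Coxeter length of a permutation is its number of inversions.\<close>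

definition perm_length :: "nat \<Rightarrow> (nat \<Rightarrow> nat) \<Rightarrow> nat" where
  "perm_length n w = card {(i, j). i < j \<and> j < n \<and> w j < w i}"

definition bruhat_step :: "nat \<Rightarrow> (nat \<Rightarrow> nat) \<Rightarrow> (nat \<Rightarrow> nat) \<Rightarrow> bool" where
  "bruhat_step n u w \<longleftrightarrow>
     (\<exists>a b. a < b \<and> b < n \<and> w = u \<circ> transpose a b \<and> perm_length n u < perm_length n w)"

definition bruhat_le :: "nat \<Rightarrow> (nat \<Rightarrow> nat) \<Rightarrow> (nat \<Rightarrow> nat) \<Rightarrow> bool" where
  "bruhat_le n = (bruhat_step n)\<^sup>*\<^sup>*"


section \<open>Schubert, Kazhdan--Lusztig and Richardson varieties\<close>

definition schubert_cell :: "nat \<Rightarrow> (nat \<Rightarrow> nat) \<Rightarrow> complex mat set set" where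
  "schubert_cell n w =
     {(b \<otimes>\<^bsub>GL n\<^esub> perm_matrix n w) <#\<^bsub>GL n\<^esub> borel_upper n | b. b \<in> borel_upper n}"

definition opposite_schubert_cell :: "nat \<Rightarrow> (nat \<Rightarrow> nat) \<Rightarrow> complex mat set set" where
  "opposite_schubert_cell n v =
     {(b \<otimes>\<^bsub>GL n\<^esub> perm_matrix n v) <#\<^bsub>GL n\<^esub> borel_upper n | b. b \<in> borel_lower n}"

definition schubert_variety :: "nat \<Rightarrow> (nat \<Rightarrow> nat) \<Rightarrow> complex mat set set" where
  "schubert_variety n w = flag_variety n closure_of schubert_cell n w"

definition opposite_schubert_variety :: "nat \<Rightarrow> (nat \<Rightarrow> nat) \<Rightarrow> complex mat set set" where
  "opposite_schubert_variety n v = flag_variety n closure_of opposite_schubert_cell n v"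

definition kazhdan_lusztig_variety ::
  "nat \<Rightarrow> (nat \<Rightarrow> nat) \<Rightarrow> (nat \<Rightarrow> nat) \<Rightarrow> complex mat set set" where
  "kazhdan_lusztig_variety n v w = schubert_variety n w \<inter> opposite_schubert_cell n v"

definition richardson_variety ::
  "nat \<Rightarrow> (nat \<Rightarrow> nat) \<Rightarrow> (nat \<Rightarrow> nat) \<Rightarrow> complex mat set set" where
  "richardson_variety n v w = schubert_variety n w \<inter> opposite_schubert_variety n v"

text \<open>
  The complexity of a \<open>T\<close>-invariant subset of \<open>G/B\<close>, with its induced Zariski topology,
  under the restricted action of the diagonal torus by left multiplication.
\<close>

definition torus_complexity :: "nat \<Rightarrow> complex mat set set \<Rightarrow> enat" where
  "torus_complexity n Y =
     complexity (torus n) (left_translation n) (subtopology (flag_variety n) Y)"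

end

theory Submission
  imports Defs "Jordan_Normal_Form.Determinant" "HOL-Computational_Algebra.Polynomial"
begin

text \<open>
  Write \<open>N\<close> for the Kazhdan--Lusztig variety, \<open>R\<close> for the Richardson variety and \<open>\<ell>\<close> for the
  Coxeter length. The statement holds because \<open>N\<close> is a dense open torus-invariant subset
  of \<open>R\<close>. Orbits of points of \<open>N\<close> stay in \<open>N\<close>, and dense open subsets of \<open>N\<close> and of \<open>R\<close> can be
  turned into each other, so the dimension of a general orbit is the same for both
  (\<open>is_general_orbit_dim_open_dense\<close>). It remains to compare the Krull dimensions; for a dense
  open subset of an arbitrary space they may differ, so both are computed: they are
  \<open>\<ell> w - \<ell> v\<close>.

  \<^emph>\<open>Bruhat order.\<close> On the set of \<open>b v c\<close> with \<open>b\<close> triangular and \<open>c\<close> upper triangular, the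
  vanishing of the minors in the first \<open>q\<close> columns is controlled by the first \<open>q\<close> values of \<open>v\<close>.
  This gives the closure relations in terms of the rank order \<open>rank_le\<close>, and shows that
  the opposite cell of \<open>v\<close> is the intersection of its closure with the open chart \<open>v B\<^sub>- B\<close>.
  An interval of the rank order contains a chain of transpositions along which the length
  grows by at most one (\<open>rank_chain_exists\<close>).

  \<^emph>\<open>Density.\<close> Let \<open>u\<close> arise from a smaller \<open>u'\<close> by a transposition and let \<open>x\<close> lie in the Schubert
  variety of \<open>w\<close> and in the opposite cell of \<open>u\<close>. Eliminating with an upper triangular matrix
  turns a transvection into a curve of upper triangular matrices \<open>A t\<close> with \<open>A 0 = 1\<close>
  such that \<open>A t x\<close> lies in the opposite cell of \<open>u'\<close> for almost all \<open>t\<close>. The Schubert variety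
  is invariant under \<open>B\<close>, so \<open>x\<close> is a limit of points of the Schubert variety in the
  opposite cell of \<open>u'\<close> (\<open>density_step\<close>). Iterating down to \<open>v\<close> gives the density of \<open>N\<close> in \<open>R\<close>.

  \<^emph>\<open>Irreducibility.\<close> The chart retracts onto the opposite cell by a polynomial map that
  moves each point within its \<open>B\<close>-orbit. So \<open>N\<close> is the image of an open subset
  of the irreducible Schubert variety, and \<open>N\<close> and its closure \<open>R\<close> are irreducible.

  \<^emph>\<open>Dimension.\<close> Along a saturated chain from \<open>v\<close> to \<open>w\<close> the Kazhdan--Lusztig varieties in the
  opposite cell of \<open>v\<close> form a chain in \<open>N\<close> of length at least \<open>\<ell> w - \<ell> v\<close> (\<open>has_chain_kl\<close>).
  Conversely, a chain of length \<open>k\<close> in \<open>R\<close> is prolonged upwards by Richardson varieties,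
  first by lowering \<open>v\<close> to the identity and then by raising \<open>w\<close> to the longest permutation \<open>w\<^sub>0\<close>
  (\<open>has_chain_richardson_le\<close>). As \<open>G/B\<close> has no chains longer than \<open>\<ell> w\<^sub>0\<close>, this
  gives \<open>k + \<ell> v + (\<ell> w\<^sub>0 - \<ell> w) \<le> \<ell> w\<^sub>0\<close>. The bound for \<open>G/B\<close> follows from the bound \<open>n\<^sup>2\<close> for \<open>GL\<^sub>n\<close>
  by pulling chains back and inserting a chain inside a coset of \<open>B\<close> below them
  (\<open>has_chain_flag_variety_le\<close>); the bound for \<open>GL\<^sub>n\<close> is a count of monomials
  (\<open>has_chain_zariski_GL_le\<close>).
\<close>

section \<open>Irreducible sets and chains\<close>

lemma irreducible_inD:
  assumes "irreducible_in X Z" "closedin X C" "closedin X D" "Z \<subseteq> C \<union> D"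
  shows "Z \<subseteq> C \<or> Z \<subseteq> D"
  using assms unfolding irreducible_in_def by simp

lemma irreducible_in_subtopology:
  assumes "Y \<subseteq> topspace X"
  shows "irreducible_in (subtopology X Y) Z \<longleftrightarrow> irreducible_in X Z \<and> Z \<subseteq> Y"
proof
  assume L: "irreducible_in (subtopology X Y) Z"
  then have ZY: "Z \<subseteq> Y" "Z \<noteq> {}" using assms by (auto simp: irreducible_in_def)
  have "Z \<subseteq> C \<or> Z \<subseteq> D" if "closedin X C" "closedin X D" "Z \<subseteq> C \<union> D" for C D
  proof -
    have "closedin (subtopology X Y) (Y \<inter> C)" "closedin (subtopology X Y) (Y \<inter> D)"
      using that by (auto simp: closedin_subtopology)
    moreover have "Z \<subseteq> (Y \<inter> C) \<union> (Y \<inter> D)" using that ZY by auto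
    ultimately show ?thesis using irreducible_inD[OF L] by blast
  qed
  then show "irreducible_in X Z \<and> Z \<subseteq> Y" using ZY assms by (auto simp: irreducible_in_def)
next
  assume R: "irreducible_in X Z \<and> Z \<subseteq> Y"
  have "Z \<subseteq> C \<or> Z \<subseteq> D"
    if "closedin (subtopology X Y) C" "closedin (subtopology X Y) D" "Z \<subseteq> C \<union> D" for C D
  proof -
    obtain C' D' where "closedin X C'" "closedin X D'" "C = C' \<inter> Y" "D = D' \<inter> Y"
      using \<open>closedin (subtopology X Y) C\<close> \<open>closedin (subtopology X Y) D\<close>
      by (auto simp: closedin_subtopology)
    then show ?thesis using irreducible_inD[of X Z C' D'] R that(3) by blast
  qed
  then show "irreducible_in (subtopology X Y) Z"
    using R assms by (auto simp: irreducible_in_def)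
qed

lemma irreducible_in_continuous_image:
  assumes "irreducible_in X Z" "continuous_map X Y f"
  shows "irreducible_in Y (f ` Z)"
  unfolding irreducible_in_def
proof (intro conjI allI impI)
  show "f ` Z \<subseteq> topspace Y"
    using assms(1) continuous_map_image_subset_topspace[OF assms(2)] by (auto simp: irreducible_in_def)
  show "f ` Z \<noteq> {}" using assms(1) by (auto simp: irreducible_in_def)
  fix C D assume CD: "closedin Y C \<and> closedin Y D \<and> f ` Z \<subseteq> C \<union> D"
  let ?P = "\<lambda>S. {x \<in> topspace X. f x \<in> S}"
  have "closedin X (?P C)" "closedin X (?P D)"
    using CD assms(2) by (auto simp: closedin_continuous_map_preimage)
  moreover have "Z \<subseteq> ?P C \<union> ?P D" using CD assms(1) by (auto simp: irreducible_in_def)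
  ultimately have "Z \<subseteq> ?P C \<or> Z \<subseteq> ?P D" by (rule irreducible_inD[OF assms(1)])
  then show "f ` Z \<subseteq> C \<or> f ` Z \<subseteq> D" by auto
qed

lemma irreducible_in_between_closure:
  assumes "irreducible_in X Z" "Z \<subseteq> Z'" "Z' \<subseteq> X closure_of Z"
  shows "irreducible_in X Z'"
  unfolding irreducible_in_def
proof (intro conjI allI impI)
  show "Z' \<subseteq> topspace X" by (rule subset_trans[OF assms(3) closure_of_subset_topspace])
  show "Z' \<noteq> {}" using assms(1) subset_empty[of Z] assms(2) by (auto simp: irreducible_in_def simp del: subset_empty)
  fix C D assume CD: "closedin X C \<and> closedin X D \<and> Z' \<subseteq> C \<union> D"
  then have "Z \<subseteq> C \<or> Z \<subseteq> D" using irreducible_inD[OF assms(1), of C D] assms(2) by blast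
  then show "Z' \<subseteq> C \<or> Z' \<subseteq> D" using CD subset_trans[OF assms(3) closure_of_minimal] by blast
qed

lemma irreducible_in_dense_open:
  assumes "irreducible_in X Z" "openin X U" "Z \<inter> U \<noteq> {}"
  shows "Z \<subseteq> X closure_of (Z \<inter> U)"
proof -
  have "closedin X (topspace X - U)" "closedin X (X closure_of (Z \<inter> U))"
    using assms(2) by auto
  moreover have "Z \<subseteq> (topspace X - U) \<union> X closure_of (Z \<inter> U)"
    using assms(1) closure_of_subset[of "Z \<inter> U" X] by (auto simp: irreducible_in_def)
  ultimately have "Z \<subseteq> topspace X - U \<or> Z \<subseteq> X closure_of (Z \<inter> U)"
    by (rule irreducible_inD[OF assms(1)])
  then show ?thesis using assms(3) by blast
qed

lemma irreducible_in_Int_open: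
  assumes "irreducible_in X Z" "openin X U" "Z \<inter> U \<noteq> {}"
  shows "irreducible_in X (Z \<inter> U)"
  unfolding irreducible_in_def
proof (intro conjI allI impI)
  show "Z \<inter> U \<subseteq> topspace X" using assms(1) by (auto simp: irreducible_in_def)
  show "Z \<inter> U \<noteq> {}" by fact
  fix C D assume CD: "closedin X C \<and> closedin X D \<and> Z \<inter> U \<subseteq> C \<union> D"
  then have "X closure_of (Z \<inter> U) \<subseteq> C \<union> D" by (intro closure_of_minimal closedin_Un) auto
  then have "Z \<subseteq> C \<union> D" using irreducible_in_dense_open[OF assms] by blast
  then have "Z \<subseteq> C \<or> Z \<subseteq> D" using CD irreducible_inD[OF assms(1), of C D] by blast
  then show "Z \<inter> U \<subseteq> C \<or> Z \<inter> U \<subseteq> D" by blast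
qed

text \<open>
  If the preimage is covered by two closed sets, then so is every fibre, and each fibre lies in one of
  the two. Openness of the map makes the two resulting sets of base points closed.
\<close>

lemma irreducible_in_open_map_preimage:
  assumes f: "continuous_map X Y f" "open_map X Y f"
    and fib: "\<And>y. y \<in> Z \<Longrightarrow> irreducible_in X {x \<in> topspace X. f x = y}"
    and Z: "irreducible_in Y Z"
  shows "irreducible_in X {x \<in> topspace X. f x \<in> Z}"
  unfolding irreducible_in_def
proof (intro conjI allI impI)
  obtain y where "y \<in> Z" using Z by (auto simp: irreducible_in_def)
  then show "{x \<in> topspace X. f x \<in> Z} \<noteq> {}" using fib[of y] by (auto simp: irreducible_in_def)
  fix C D assume CD: "closedin X C \<and> closedin X D \<and> {x \<in> topspace X. f x \<in> Z} \<subseteq> C \<union> D"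
  \<comment> \<open>the points whose whole fibre lies in a given closed set form a closed set, as \<open>f\<close> is open\<close>
  define K where "K S = topspace Y - f ` (topspace X - S)" for S
  have cl: "closedin Y (K S)" if "closedin X S" for S
    using that f(2) unfolding K_def open_map_def by (meson closedin_diff closedin_topspace openin_diff openin_topspace)
  have "Z \<subseteq> K C \<union> K D"
  proof
    fix y assume y: "y \<in> Z"
    have "{x \<in> topspace X. f x = y} \<subseteq> C \<union> D" using CD y by auto
    then have "{x \<in> topspace X. f x = y} \<subseteq> C \<or> {x \<in> topspace X. f x = y} \<subseteq> D"
      using irreducible_inD[OF fib[OF y]] CD by blast
    moreover have "y \<in> topspace Y" using y Z by (auto simp: irreducible_in_def)
    ultimately show "y \<in> K C \<union> K D" unfolding K_def by auto
  qed
  then have "Z \<subseteq> K C \<or> Z \<subseteq> K D" using irreducible_inD[OF Z] cl CD by blast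
  then show "{x \<in> topspace X. f x \<in> Z} \<subseteq> C \<or> {x \<in> topspace X. f x \<in> Z} \<subseteq> D"
    unfolding K_def by blast
qed auto

text \<open>
  The length \<open>k\<close> counts strict inclusions. The set \<open>Y\<close> bounds the top of the chain only from above,
  which allows a chain to be continued by any larger irreducible closed set.
\<close>

definition has_chain :: "'a topology \<Rightarrow> nat \<Rightarrow> 'a set \<Rightarrow> bool" where
  "has_chain X k Y \<longleftrightarrow> (\<exists>Z :: nat \<Rightarrow> 'a set.
     (\<forall>i\<le>k. closedin X (Z i) \<and> irreducible_in X (Z i)) \<and> (\<forall>i<k. Z i \<subset> Z (Suc i)) \<and> Z k \<subseteq> Y)"

lemma has_chainI:
  assumes "\<And>i. i \<le> k \<Longrightarrow> closedin X (Z i)" "\<And>i. i \<le> k \<Longrightarrow> irreducible_in X (Z i)"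
    and "\<And>i. i < k \<Longrightarrow> Z i \<subset> Z (Suc i)" "Z k \<subseteq> Y"
  shows "has_chain X k Y"
  unfolding has_chain_def using assms by (intro exI[of _ Z]) simp

lemma has_chainE:
  assumes "has_chain X k Y"
  obtains Z where "\<forall>i\<le>k. closedin X (Z i)" "\<forall>i\<le>k. irreducible_in X (Z i)"
    "\<forall>i<k. Z i \<subset> Z (Suc i)" "Z k \<subseteq> Y"
proof -
  obtain Z where "(\<forall>i\<le>k. closedin X (Z i) \<and> irreducible_in X (Z i)) \<and> (\<forall>i<k. Z i \<subset> Z (Suc i)) \<and> Z k \<subseteq> Y"
    using assms unfolding has_chain_def by (rule exE)
  then show ?thesis by (intro that[of Z]) simp_all
qed

lemma krull_dim_has_chain: "krull_dim X = Sup {enat k | k. has_chain X k (topspace X)}"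
proof -
  have "(\<exists>Z. (\<forall>i\<le>k. closedin X (Z i) \<and> irreducible_in X (Z i)) \<and> (\<forall>i<k. Z i \<subset> Z (Suc i)))
     \<longleftrightarrow> has_chain X k (topspace X)" for k
    unfolding has_chain_def by (metis closedin_subset order_refl)
  then show ?thesis unfolding krull_dim_def by simp
qed

lemma has_chain_mono: "has_chain X k Y \<Longrightarrow> Y \<subseteq> Y' \<Longrightarrow> has_chain X k Y'"
  unfolding has_chain_def by (elim ex_forward) auto

lemma has_chain_0: "closedin X Y \<Longrightarrow> irreducible_in X Y \<Longrightarrow> has_chain X 0 Y"
  unfolding has_chain_def by (intro exI[of _ "\<lambda>_. Y"]) auto

lemma has_chain_Suc:
  assumes "has_chain X k Y" "closedin X Y'" "irreducible_in X Y'" "Y \<subset> Y'"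
  shows "has_chain X (Suc k) Y'"
proof -
  obtain Z where Z: "\<forall>i\<le>k. closedin X (Z i)" "\<forall>i\<le>k. irreducible_in X (Z i)"
    "\<forall>i<k. Z i \<subset> Z (Suc i)" "Z k \<subseteq> Y"
    using assms(1) by (rule has_chainE)
  show ?thesis
  proof (rule has_chainI[where Z = "Z(Suc k := Y')"])
    show "(Z(Suc k := Y')) i \<subset> (Z(Suc k := Y')) (Suc i)" if "i < Suc k" for i
      using that Z(3) Z(4) assms(4) by (cases "i = k") auto
  qed (use Z assms in \<open>auto simp: le_Suc_eq\<close>)
qed

lemma has_chain_extend:
  assumes "has_chain X k (Y 0)"
    and "\<And>i. i \<le> m \<Longrightarrow> closedin X (Y i) \<and> irreducible_in X (Y i)"
    and "\<And>i. i < m \<Longrightarrow> Y i \<subset> Y (Suc i)"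
  shows "has_chain X (k + m) (Y m)"
  using assms(2,3)
proof (induction m)
  case 0 then show ?case using assms(1) by simp
next
  case (Suc m)
  then have "has_chain X (k + m) (Y m)" by simp
  then show ?case using has_chain_Suc[of X "k + m" "Y m" "Y (Suc m)"] Suc.prems by simp
qed

lemma has_chain_closed_subtopology:
  assumes "closedin X Y" "has_chain (subtopology X Y) k Y"
  shows "has_chain X k Y"
proof -
  have "Y \<subseteq> topspace X" using assms(1) closedin_subset by blast
  with assms show ?thesis
    unfolding has_chain_def closedin_closed_subtopology[OF assms(1)]
      irreducible_in_subtopology[OF \<open>Y \<subseteq> topspace X\<close>] by (elim ex_forward) simp
qed

text \<open>
  Closures taken in the larger space keep a chain strict, since a closed subset of the subspace is
  recovered from its closure by intersecting with the subspace.
\<close>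

lemma krull_dim_subspace_mono:
  assumes "N \<subseteq> R" "R \<subseteq> topspace X"
  shows "krull_dim (subtopology X N) \<le> krull_dim (subtopology X R)"
proof -
  have "has_chain (subtopology X R) k R" if chain: "has_chain (subtopology X N) k N" for k
  proof -
    obtain Z where Z: "\<forall>i\<le>k. closedin (subtopology X N) (Z i)"
      "\<forall>i\<le>k. irreducible_in (subtopology X N) (Z i)"
      "\<forall>i<k. Z i \<subset> Z (Suc i)" "Z k \<subseteq> N"
      using chain by (rule has_chainE)
    have NX: "N \<subseteq> topspace X" using assms by auto
    define W where "W i = R \<inter> X closure_of (Z i)" for i
    have WN: "W i \<inter> N = Z i" if "i \<le> k" for i
    proof -
      have cl: "closedin (subtopology X N) (Z i)" using Z(1) that by simp
      then have "Z i \<subseteq> N" using closedin_subset by fastforce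
      have "Z i = subtopology X N closure_of Z i" using cl by (simp add: closure_of_closedin)
      also have "\<dots> = N \<inter> X closure_of (Z i)"
        using \<open>Z i \<subseteq> N\<close> by (simp add: closure_of_subtopology Int_absorb1)
      finally show ?thesis using assms(1) unfolding W_def by blast
    qed
    show ?thesis
    proof (rule has_chainI[where Z = W])
      fix i assume i: "i \<le> k"
      show "closedin (subtopology X R) (W i)" unfolding W_def
        by (rule closedin_subtopology_Int_closed) simp
      have "irreducible_in X (Z i)" using Z(2) i irreducible_in_subtopology[OF NX] by simp
      moreover have "Z i \<subseteq> W i" using WN[OF i] by auto
      ultimately show "irreducible_in (subtopology X R) (W i)"
        unfolding irreducible_in_subtopology[OF assms(2)]
        by (metis W_def inf_le1 inf_le2 irreducible_in_between_closure)
    next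
      fix i assume i: "i < k"
      have "W i \<subseteq> W (Suc i)"
        using Z(3) i closure_of_mono[of "Z i" "Z (Suc i)" X] unfolding W_def by auto
      then show "W i \<subset> W (Suc i)" using WN[of i] WN[of "Suc i"] i Z(3) by (auto simp: psubset_eq)
    qed (simp add: W_def)
  qed
  then have "{enat k |k. has_chain (subtopology X N) k N} \<subseteq> {enat k |k. has_chain (subtopology X R) k R}"
    by blast
  moreover have "topspace (subtopology X N) = N" "topspace (subtopology X R) = R" using assms by auto
  ultimately show ?thesis unfolding krull_dim_has_chain by (simp add: Sup_subset_mono)
qed

section \<open>General orbits in a dense open subset\<close>

text \<open>
  A dense open subset of \<open>N\<close> is dense and open in \<open>R\<close>, and a dense open subset of \<open>R\<close> meets \<open>N\<close>
  in one of \<open>N\<close>. Invariance ensures that an orbit carries the same topology in both spaces.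
\<close>

lemma is_general_orbit_dim_open_dense:
  assumes NR: "N \<subseteq> R" "R \<subseteq> topspace X"
    and op: "openin (subtopology X R) N" and dense: "R \<subseteq> X closure_of N"
    and inv: "\<And>x. x \<in> N \<Longrightarrow> orbit T \<phi> x \<subseteq> N"
  shows "is_general_orbit_dim T \<phi> (subtopology X N) d \<longleftrightarrow>
         is_general_orbit_dim T \<phi> (subtopology X R) d"
proof -
  have top: "topspace (subtopology X N) = N" "topspace (subtopology X R) = R" using NR by auto
  have sub: "subtopology (subtopology X N) (orbit T \<phi> x) = subtopology (subtopology X R) (orbit T \<phi> x)"
    if "x \<in> N" for x
    using inv[OF that] subset_trans[OF inv[OF that] NR(1)]
    by (simp add: subtopology_subtopology Int_absorb1)
  have subN: "subtopology (subtopology X R) N = subtopology X N"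
    using NR by (simp add: subtopology_subtopology Int_absorb1)
  show ?thesis
  proof
    assume "is_general_orbit_dim T \<phi> (subtopology X N) d"
    then obtain U where U: "openin (subtopology X N) U" "subtopology X N closure_of U = N"
      "\<forall>x\<in>U. krull_dim (subtopology (subtopology X N) (orbit T \<phi> x)) = d"
      unfolding is_general_orbit_dim_def top by (elim exE conjE)
    have UN: "U \<subseteq> N" using U(1) openin_subset top by blast
    have "openin (subtopology X R) U"
      using U(1) op subN openin_trans_full by metis
    moreover have "subtopology X R closure_of U = R"
    proof -
      have "N \<subseteq> X closure_of U" using U(2) closure_of_subtopology_subset[of X N U] by simp
      then have "X closure_of N \<subseteq> X closure_of U" by (rule closure_of_minimal) simp
      then have "R \<subseteq> X closure_of U" using dense by (rule subset_trans[rotated])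
      then show ?thesis
        using subset_trans[OF UN NR(1)] by (simp add: closure_of_subtopology Int_absorb1 Int_absorb2)
    qed
    moreover have "krull_dim (subtopology (subtopology X R) (orbit T \<phi> x)) = d" if "x \<in> U" for x
      using U(3) that sub[of x] UN by (metis subsetD)
    ultimately show "is_general_orbit_dim T \<phi> (subtopology X R) d"
      unfolding is_general_orbit_dim_def top by (intro exI[of _ U]) simp
  next
    assume "is_general_orbit_dim T \<phi> (subtopology X R) d"
    then obtain U where U: "openin (subtopology X R) U" "subtopology X R closure_of U = R"
      "\<forall>x\<in>U. krull_dim (subtopology (subtopology X R) (orbit T \<phi> x)) = d"
      unfolding is_general_orbit_dim_def top by (elim exE conjE)
    have "openin (subtopology X N) (U \<inter> N)"
      using U(1) subN by (metis openin_subtopology_Int)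
    moreover have "subtopology X N closure_of (U \<inter> N) = N"
    proof -
      have "subtopology X R closure_of (N \<inter> U) = subtopology X R closure_of (N \<inter> subtopology X R closure_of U)"
        using closure_of_openin_Int_closure_of[OF op] by simp
      also have "\<dots> = subtopology X R closure_of N" using U(2) NR(1) by (simp add: Int_absorb2)
      finally have "N \<subseteq> subtopology X R closure_of (N \<inter> U)"
        using closure_of_subset[of N "subtopology X R"] subset_trans[OF NR] NR(1) by simp
      then have "N \<subseteq> X closure_of (N \<inter> U)"
        using closure_of_subtopology_subset[of X R "N \<inter> U"] by (rule subset_trans)
      then show ?thesis
        by (simp add: closure_of_subtopology Int_absorb1 Int_absorb2 Int_commute)
    qed
    ultimately show "is_general_orbit_dim T \<phi> (subtopology X N) d"
      unfolding is_general_orbit_dim_def top using U(3) sub by (intro exI[of _ "U \<inter> N"]) auto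
  qed
qed

section \<open>Invertible matrices\<close>

lemma carrier_GL_iff: "g \<in> carrier (GL n) \<longleftrightarrow> g \<in> carrier_mat n n \<and> det g \<noteq> 0"
proof
  assume g: "g \<in> carrier (GL n)"
  then have "g \<in> Units (ring_mat TYPE(complex) n ())" by (simp add: units_of_carrier)
  then show "g \<in> carrier_mat n n \<and> det g \<noteq> 0"
    using unit_imp_det_non_zero[of g n "()"] by (simp add: Units_def ring_mat_simps)
qed (simp add: det_non_zero_imp_unit units_of_carrier)

lemma mult_GL: "x \<otimes>\<^bsub>GL n\<^esub> y = x * y"
  by (simp add: units_of_mult ring_mat_simps)

lemma one_GL: "\<one>\<^bsub>GL n\<^esub> = 1\<^sub>m n"
  by (simp add: units_of_one ring_mat_simps)

lemma group_GL: "group (GL n)"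
  by (rule monoid.units_group) (rule ring.is_monoid[OF ring_mat])

lemma GL_carrier_mat: "g \<in> carrier (GL n) \<Longrightarrow> g \<in> carrier_mat n n"
  by (simp add: carrier_GL_iff)

lemma GL_mult_closed: "g \<in> carrier (GL n) \<Longrightarrow> h \<in> carrier (GL n) \<Longrightarrow> g * h \<in> carrier (GL n)"
  by (auto simp: carrier_GL_iff det_mult)

lemma GL_mult_cancel:
  assumes "g \<in> carrier_mat n n" "h \<in> carrier_mat n n" "g * h \<in> carrier (GL n)"
  shows "g \<in> carrier (GL n)" "h \<in> carrier (GL n)"
  using assms by (auto simp: carrier_GL_iff det_mult)

lemma one_in_GL: "1\<^sub>m n \<in> carrier (GL n)"
  by (simp add: carrier_GL_iff)

lemma GL_inverse:
  assumes "g \<in> carrier (GL n)"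
  obtains h where "h \<in> carrier (GL n)" "g * h = 1\<^sub>m n" "h * g = 1\<^sub>m n"
  using group.inv_closed[OF group_GL assms] group.r_inv[OF group_GL assms]
    group.l_inv[OF group_GL assms] by (auto simp: mult_GL one_GL)

section \<open>Matrices with entries in a ring of functions\<close>

text \<open>
  Polynomial functions on matrices and polynomial functions of one variable are handled alike: the
  former give continuous maps, the latter give curves.
\<close>

definition function_ring :: "('a \<Rightarrow> complex) set \<Rightarrow> bool" where
  "function_ring R \<longleftrightarrow> (\<forall>c. (\<lambda>_. c) \<in> R) \<and>
     (\<forall>p\<in>R. \<forall>q\<in>R. (\<lambda>x. p x + q x) \<in> R \<and> (\<lambda>x. p x * q x) \<in> R)"

lemma function_ring_polynomial_functions: "function_ring (polynomial_functions n)"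
  unfolding function_ring_def by (auto intro: polynomial_functions.intros)

lemma function_ring_poly: "function_ring (range (poly :: complex poly \<Rightarrow> _))"
  unfolding function_ring_def
proof (intro conjI allI ballI)
  fix c :: complex
  show "(\<lambda>_. c) \<in> range poly" by (rule range_eqI[of _ _ "[:c:]"]) auto
next
  fix p q :: "complex \<Rightarrow> complex" assume "p \<in> range poly" "q \<in> range poly"
  then obtain P Q where "p = poly P" "q = poly Q" by auto
  then show "(\<lambda>x. p x + q x) \<in> range poly" "(\<lambda>x. p x * q x) \<in> range poly"
    using range_eqI[of "poly (P + Q)" poly] range_eqI[of "poly (P * Q)" poly]
    by (simp_all flip: poly_add poly_mult)
qed

context
  fixes R :: "('a \<Rightarrow> complex) set"
  assumes R: "function_ring R"
begin

lemma function_ring_const: "(\<lambda>_. c) \<in> R"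
  and function_ring_add: "p \<in> R \<Longrightarrow> q \<in> R \<Longrightarrow> (\<lambda>x. p x + q x) \<in> R"
  and function_ring_mult: "p \<in> R \<Longrightarrow> q \<in> R \<Longrightarrow> (\<lambda>x. p x * q x) \<in> R"
  using R unfolding function_ring_def by auto

lemma function_ring_sum: "(\<And>i. i \<in> A \<Longrightarrow> f i \<in> R) \<Longrightarrow> (\<lambda>x. \<Sum>i\<in>A. f i x) \<in> R"
  by (induction A rule: infinite_finite_induct) (auto intro: function_ring_const function_ring_add)

lemma function_ring_prod: "(\<And>i. i \<in> A \<Longrightarrow> f i \<in> R) \<Longrightarrow> (\<lambda>x. \<Prod>i\<in>A. f i x) \<in> R"
  by (induction A rule: infinite_finite_induct) (auto intro: function_ring_const function_ring_mult)

lemma function_ring_det: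
  assumes "\<And>x. F x \<in> carrier_mat q q" "\<And>i j. i < q \<Longrightarrow> j < q \<Longrightarrow> (\<lambda>x. F x $$ (i, j)) \<in> R"
  shows "(\<lambda>x. det (F x)) \<in> R"
proof -
  have "(\<lambda>x. \<Sum>p\<in>{p. p permutes {0..<q}}. signof p * (\<Prod>i = 0..<q. F x $$ (i, p i))) \<in> R"
  proof (intro function_ring_sum function_ring_mult function_ring_prod function_ring_const)
    fix p i assume "p \<in> {p. p permutes {0..<q}}" "i \<in> {0..<q}"
    then have "i < q" "p i < q" using permutes_in_image[of p "{0..<q}" i] by auto
    then show "(\<lambda>x. F x $$ (i, p i)) \<in> R" by (rule assms(2))
  qed
  then show ?thesis using det_def'[OF assms(1)] by simp
qed

lemma function_ring_adj:
  assumes F: "\<And>x. F x \<in> carrier_mat q q" "\<And>i j. i < q \<Longrightarrow> j < q \<Longrightarrow> (\<lambda>x. F x $$ (i, j)) \<in> R"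
    and ij: "i < q" "j < q"
  shows "(\<lambda>x. adj_mat (F x) $$ (i, j)) \<in> R"
proof -
  have "(\<lambda>x. (-1) ^ (j + i) * det (mat_delete (F x) j i)) \<in> R"
  proof (intro function_ring_mult function_ring_const function_ring_det)
    show "mat_delete (F x) j i \<in> carrier_mat (q - 1) (q - 1)" for x
      using F(1)[of x] by (auto simp: mat_delete_def)
    fix a b assume ab: "a < q - 1" "b < q - 1"
    let ?a = "if a < j then a else Suc a" and ?b = "if b < i then b else Suc b"
    have "mat_delete (F x) j i $$ (a, b) = F x $$ (?a, ?b)" for x
      using F(1)[of x] ab by (auto simp: mat_delete_def)
    moreover have "?a < q" "?b < q" using ab by auto
    ultimately show "(\<lambda>x. mat_delete (F x) j i $$ (a, b)) \<in> R" using F(2) by simp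
  qed
  moreover have "adj_mat (F x) $$ (i, j) = (-1) ^ (j + i) * det (mat_delete (F x) j i)" for x
    using F(1)[of x] ij by (simp add: adj_mat_def cofactor_def)
  ultimately show ?thesis by simp
qed

end

definition matrix_over :: "('a \<Rightarrow> complex) set \<Rightarrow> nat \<Rightarrow> ('a \<Rightarrow> complex mat) \<Rightarrow> bool" where
  "matrix_over R n F \<longleftrightarrow> (\<forall>x. F x \<in> carrier_mat n n) \<and> (\<forall>i<n. \<forall>j<n. (\<lambda>x. F x $$ (i, j)) \<in> R)"

lemma matrix_over_carrier: "matrix_over R n F \<Longrightarrow> F x \<in> carrier_mat n n"
  by (simp add: matrix_over_def)

lemma matrix_over_const: "function_ring R \<Longrightarrow> A \<in> carrier_mat n n \<Longrightarrow> matrix_over R n (\<lambda>_. A)"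
  by (simp add: matrix_over_def function_ring_const)

lemma matrix_over_mult:
  assumes "function_ring R" "matrix_over R n F" "matrix_over R n H"
  shows "matrix_over R n (\<lambda>x. F x * H x)"
  unfolding matrix_over_def
proof (intro conjI allI impI)
  show "F x * H x \<in> carrier_mat n n" for x
    using assms by (intro mult_carrier_mat) (auto simp: matrix_over_def)
  fix i j assume "i < n" "j < n"
  have FH: "F x \<in> carrier_mat n n" "H x \<in> carrier_mat n n" for x
    using assms by (auto simp: matrix_over_def)
  have "(F x * H x) $$ (i, j) = (\<Sum>k<n. F x $$ (i, k) * H x $$ (k, j))" for x
    using FH[of x] \<open>i < n\<close> \<open>j < n\<close> by (simp add: times_mat_def scalar_prod_def atLeast0LessThan)
  moreover have "(\<lambda>x. \<Sum>k<n. F x $$ (i, k) * H x $$ (k, j)) \<in> R"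
    using assms \<open>i < n\<close> \<open>j < n\<close>
    by (intro function_ring_sum[OF assms(1)] function_ring_mult[OF assms(1)]) (auto simp: matrix_over_def)
  ultimately show "(\<lambda>x. (F x * H x) $$ (i, j)) \<in> R" by simp
qed

lemma matrix_over_mat:
  assumes "\<And>i j. i < n \<Longrightarrow> j < n \<Longrightarrow> (\<lambda>x. f x i j) \<in> R"
  shows "matrix_over R n (\<lambda>x. mat n n (\<lambda>(i, j). f x i j))"
  using assms by (simp add: matrix_over_def)

lemma polynomial_functions_matrix_over:
  assumes "p \<in> polynomial_functions n" "function_ring R" "matrix_over R n F"
  shows "(\<lambda>x. p (F x)) \<in> R"
  using assms(1) by induction (use assms(2,3) in \<open>auto simp: matrix_over_def intro: function_ring_const function_ring_add function_ring_mult\<close>)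

lemma matrix_over_id: "matrix_over (polynomial_functions n) n (\<lambda>g. mat n n (\<lambda>(i, j). g $$ (i, j)))"
  by (intro matrix_over_mat polynomial_functions.entry)

lemma mat_entries_id: "g \<in> carrier_mat n n \<Longrightarrow> mat n n (($$) g) = g"
  by (intro eq_matI) auto

section \<open>The Zariski topology and polynomial curves\<close>

text \<open>
  The nonvanishing loci are a basis, not just a subbasis, because products of polynomials are
  polynomials.
\<close>

lemma openin_zariski_GL_iff:
  "openin (zariski_GL n) W \<longleftrightarrow> W \<subseteq> carrier (GL n) \<and>
     (\<forall>g\<in>W. \<exists>p\<in>polynomial_functions n. p g \<noteq> 0 \<and> {h \<in> carrier (GL n). p h \<noteq> 0} \<subseteq> W)"
  (is "_ \<longleftrightarrow> _ \<and> ?Q W")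
proof
  assume op: "openin (zariski_GL n) W"
  have "generate_topology_on {{g \<in> carrier (GL n). p g \<noteq> 0} | p. p \<in> polynomial_functions n} W"
    using op unfolding zariski_GL_def openin_topology_generated_by_iff .
  then have "?Q W"
  proof induction
    case (Int a b)
    show ?case
    proof
      fix g assume "g \<in> a \<inter> b"
      then have "g \<in> a" "g \<in> b" by auto
      obtain p where "p \<in> polynomial_functions n" "p g \<noteq> 0" "{h \<in> carrier (GL n). p h \<noteq> 0} \<subseteq> a"
        using bspec[OF Int.IH(1) \<open>g \<in> a\<close>] by auto
      moreover obtain q where "q \<in> polynomial_functions n" "q g \<noteq> 0" "{h \<in> carrier (GL n). q h \<noteq> 0} \<subseteq> b"
        using bspec[OF Int.IH(2) \<open>g \<in> b\<close>] by auto
      ultimately show "\<exists>p\<in>polynomial_functions n. p g \<noteq> 0 \<and> {h \<in> carrier (GL n). p h \<noteq> 0} \<subseteq> a \<inter> b"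
        by (intro bexI[of _ "\<lambda>x. p x * q x"]) (auto intro: polynomial_functions.mult)
    qed
  next
    case (UN K)
    show ?case
    proof
      fix g assume "g \<in> \<Union>K"
      then obtain k where k: "k \<in> K" "g \<in> k" by blast
      then obtain p where "p \<in> polynomial_functions n" "p g \<noteq> 0" "{h \<in> carrier (GL n). p h \<noteq> 0} \<subseteq> k"
        using UN.IH[OF k(1)] by auto
      then show "\<exists>p\<in>polynomial_functions n. p g \<noteq> 0 \<and> {h \<in> carrier (GL n). p h \<noteq> 0} \<subseteq> \<Union>K"
        using k(1) by (intro bexI[of _ p]) auto
    qed
  qed auto
  then show "W \<subseteq> carrier (GL n) \<and> ?Q W"
    using openin_subset[OF op] topspace_zariski_GL by simp
next
  assume W: "W \<subseteq> carrier (GL n) \<and> ?Q W"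
  have basic: "openin (zariski_GL n) {h \<in> carrier (GL n). p h \<noteq> 0}" if "p \<in> polynomial_functions n" for p
    unfolding zariski_GL_def by (rule topology_generated_by_Basis) (use that in blast)
  then show "openin (zariski_GL n) W"
  proof (subst openin_subopen, intro ballI)
    fix g assume "g \<in> W"
    then obtain p where "p \<in> polynomial_functions n" "p g \<noteq> 0" "{h \<in> carrier (GL n). p h \<noteq> 0} \<subseteq> W"
      using W by auto
    then show "\<exists>T. openin (zariski_GL n) T \<and> g \<in> T \<and> T \<subseteq> W"
      using basic \<open>g \<in> W\<close> W by (intro exI[of _ "{h \<in> carrier (GL n). p h \<noteq> 0}"]) auto
  qed
qed

lemma openin_zariski_GL_nonzero:
  "p \<in> polynomial_functions n \<Longrightarrow> openin (zariski_GL n) {g \<in> carrier (GL n). p g \<noteq> 0}"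
  by (subst openin_zariski_GL_iff) auto

lemma closedin_zariski_GL_zero:
  assumes "p \<in> polynomial_functions n"
  shows "closedin (zariski_GL n) {g \<in> carrier (GL n). p g = 0}"
proof -
  have "topspace (zariski_GL n) - {g \<in> carrier (GL n). p g = 0} = {g \<in> carrier (GL n). p g \<noteq> 0}"
    by (auto simp: topspace_zariski_GL)
  then show ?thesis
    using openin_zariski_GL_nonzero[OF assms] by (simp add: closedin_def topspace_zariski_GL)
qed

lemma zariski_GL_separation:
  assumes "closedin (zariski_GL n) C" "g \<in> carrier (GL n)" "g \<notin> C"
  obtains p where "p \<in> polynomial_functions n" "p g \<noteq> 0" "\<And>h. h \<in> C \<Longrightarrow> p h = 0"
proof -
  have "openin (zariski_GL n) (carrier (GL n) - C)"
    using assms(1) topspace_zariski_GL by (metis closedin_def)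
  then obtain p where p: "p \<in> polynomial_functions n" "p g \<noteq> 0"
      "{h \<in> carrier (GL n). p h \<noteq> 0} \<subseteq> carrier (GL n) - C"
    using assms(2,3) unfolding openin_zariski_GL_iff by blast
  moreover have "C \<subseteq> carrier (GL n)" using closedin_subset[OF assms(1)] topspace_zariski_GL by simp
  ultimately show thesis by (intro that[of p]) auto
qed

lemma zero_on_closure:
  assumes "p \<in> polynomial_functions n" "S \<subseteq> carrier (GL n)" "\<And>h. h \<in> S \<Longrightarrow> p h = 0"
    and "g \<in> zariski_GL n closure_of S"
  shows "p g = 0"
proof -
  have "zariski_GL n closure_of S \<subseteq> {g \<in> carrier (GL n). p g = 0}"
    using assms(2,3) by (intro closure_of_minimal closedin_zariski_GL_zero[OF assms(1)]) auto
  then show ?thesis using assms(4) by auto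
qed

lemma continuous_map_matrix_over:
  assumes F: "matrix_over (polynomial_functions n) n F"
    and S: "S \<subseteq> carrier (GL n)" "\<And>g. g \<in> S \<Longrightarrow> F g \<in> carrier (GL n)"
  shows "continuous_map (subtopology (zariski_GL n) S) (zariski_GL n) F"
proof -
  have top: "topspace (subtopology (zariski_GL n) S) = S" using S(1) by (auto simp: topspace_zariski_GL)
  have "openin (subtopology (zariski_GL n) S) {x \<in> S. F x \<in> W}" if W: "openin (zariski_GL n) W" for W
  proof (subst openin_subopen, rule ballI)
    fix x assume x: "x \<in> {x \<in> S. F x \<in> W}"
    then obtain p where p: "p \<in> polynomial_functions n" "p (F x) \<noteq> 0"
      "{h \<in> carrier (GL n). p h \<noteq> 0} \<subseteq> W"
      using W unfolding openin_zariski_GL_iff by blast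
    have "(\<lambda>g. p (F g)) \<in> polynomial_functions n"
      by (rule polynomial_functions_matrix_over[OF p(1) function_ring_polynomial_functions F])
    then have "openin (subtopology (zariski_GL n) S) (S \<inter> {g \<in> carrier (GL n). p (F g) \<noteq> 0})"
      by (intro openin_subtopology_Int2 openin_zariski_GL_nonzero)
    then show "\<exists>T. openin (subtopology (zariski_GL n) S) T \<and> x \<in> T \<and> T \<subseteq> {x \<in> S. F x \<in> W}"
      using x p S by (intro exI[of _ "S \<inter> {g \<in> carrier (GL n). p (F g) \<noteq> 0}"]) auto
  qed
  then show ?thesis using S(2) unfolding continuous_map_def top topspace_zariski_GL by simp
qed

lemma continuous_map_translations:
  assumes "a \<in> carrier (GL n)" "b \<in> carrier (GL n)"
  shows "continuous_map (zariski_GL n) (zariski_GL n) (\<lambda>g. a * g * b)"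
proof -
  let ?F = "\<lambda>g. a * mat n n (\<lambda>(i, j). g $$ (i, j)) * b"
  have "matrix_over (polynomial_functions n) n ?F"
    using assms by (intro matrix_over_mult function_ring_polynomial_functions matrix_over_const matrix_over_id)
      (auto simp: carrier_GL_iff)
  moreover have eq: "?F g = a * g * b" if "g \<in> carrier (GL n)" for g
    using that by (simp add: mat_entries_id carrier_GL_iff)
  ultimately have "continuous_map (subtopology (zariski_GL n) (carrier (GL n))) (zariski_GL n) ?F"
    using assms by (intro continuous_map_matrix_over) (auto intro!: GL_mult_closed)
  then have "continuous_map (zariski_GL n) (zariski_GL n) ?F"
    by (metis subtopology_topspace topspace_zariski_GL)
  then show ?thesis by (rule continuous_map_eq) (simp add: topspace_zariski_GL mat_entries_id GL_carrier_mat)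
qed

text \<open>
  Restricted to the curve, a defining polynomial and the determinant become polynomials in one
  variable, with finitely many zeros unless they vanish identically.
\<close>

lemma cofinite_curve:
  assumes \<gamma>: "matrix_over (range poly) n \<gamma>" and "openin (zariski_GL n) W" "\<gamma> t0 \<in> W"
  shows "finite {t. \<gamma> t \<notin> W}"
proof -
  obtain p where p: "p \<in> polynomial_functions n" "p (\<gamma> t0) \<noteq> 0" "{h \<in> carrier (GL n). p h \<noteq> 0} \<subseteq> W"
    and W: "W \<subseteq> carrier (GL n)"
    using assms(2,3) unfolding openin_zariski_GL_iff by blast
  obtain P where P: "(\<lambda>t. p (\<gamma> t)) = poly P"
    using polynomial_functions_matrix_over[OF p(1) function_ring_poly \<gamma>] by blast
  have "(\<lambda>t. det (\<gamma> t)) \<in> range poly"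
    using \<gamma> by (intro function_ring_det[OF function_ring_poly]) (auto simp: matrix_over_def)
  then obtain D where D: "(\<lambda>t. det (\<gamma> t)) = poly D" by blast
  have "poly (P * D) t0 \<noteq> 0"
    using p(2) W assms(3) P[THEN fun_cong] D[THEN fun_cong] by (auto simp: carrier_GL_iff)
  then have "finite {t. poly (P * D) t = 0}" by (intro poly_roots_finite) auto
  moreover have "{t. \<gamma> t \<notin> W} \<subseteq> {t. poly (P * D) t = 0}"
  proof
    fix t assume t: "t \<in> {t. \<gamma> t \<notin> W}"
    show "t \<in> {t. poly (P * D) t = 0}"
    proof (rule ccontr)
      assume "t \<notin> {t. poly (P * D) t = 0}"
      then have "p (\<gamma> t) \<noteq> 0" "det (\<gamma> t) \<noteq> 0" using P[THEN fun_cong, of t] D[THEN fun_cong, of t] by auto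
      then have "\<gamma> t \<in> W" using p(3) matrix_over_carrier[OF \<gamma>] by (auto simp: carrier_GL_iff)
      then show False using t by simp
    qed
  qed
  ultimately show ?thesis by (rule finite_subset[rotated])
qed

lemma curve_in_closure:
  assumes \<gamma>: "matrix_over (range poly) n \<gamma>" "\<gamma> t0 \<in> carrier (GL n)" and fin: "finite {t. \<gamma> t \<notin> S}"
  shows "\<gamma> t0 \<in> zariski_GL n closure_of S"
  unfolding in_closure_of
proof (intro conjI allI impI)
  show "\<gamma> t0 \<in> topspace (zariski_GL n)" using \<gamma>(2) by (simp add: topspace_zariski_GL)
  fix W assume "\<gamma> t0 \<in> W \<and> openin (zariski_GL n) W"
  then have "finite {t. \<gamma> t \<notin> W}" using cofinite_curve[OF \<gamma>(1)] by blast
  then have "finite ({t. \<gamma> t \<notin> W} \<union> {t. \<gamma> t \<notin> S})" using fin by simp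
  then obtain t where "t \<notin> {t. \<gamma> t \<notin> W} \<union> {t. \<gamma> t \<notin> S}"
    using ex_new_if_finite infinite_UNIV_char_0 by metis
  then show "\<exists>y. y \<in> S \<and> y \<in> W" by auto
qed

text \<open>
  Two nonempty open subsets of \<open>S\<close> each contain almost all points of a curve that joins them, so they
  meet.
\<close>

lemma irreducible_in_zariski_GL_curves:
  assumes "S \<subseteq> carrier (GL n)" "S \<noteq> {}"
    and "\<And>g h. g \<in> S \<Longrightarrow> h \<in> S \<Longrightarrow>
      \<exists>\<gamma>. matrix_over (range poly) n \<gamma> \<and> \<gamma> 0 = g \<and> \<gamma> 1 = h \<and> finite {t. \<gamma> t \<notin> S}"
  shows "irreducible_in (zariski_GL n) S"
  unfolding irreducible_in_def
proof (intro conjI allI impI)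
  show "S \<subseteq> topspace (zariski_GL n)" using assms(1) by (simp add: topspace_zariski_GL)
  show "S \<noteq> {}" by fact
  fix C D assume CD: "closedin (zariski_GL n) C \<and> closedin (zariski_GL n) D \<and> S \<subseteq> C \<union> D"
  show "S \<subseteq> C \<or> S \<subseteq> D"
  proof (rule ccontr)
    assume "\<not> (S \<subseteq> C \<or> S \<subseteq> D)"
    then obtain g h where gh: "g \<in> S" "g \<notin> C" "h \<in> S" "h \<notin> D" by blast
    then obtain \<gamma> where \<gamma>: "matrix_over (range poly) n \<gamma>" "\<gamma> 0 = g" "\<gamma> 1 = h" "finite {t. \<gamma> t \<notin> S}"
      using assms(3) by blast
    have op: "openin (zariski_GL n) (carrier (GL n) - C)" "openin (zariski_GL n) (carrier (GL n) - D)"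
      using CD topspace_zariski_GL by (metis closedin_def)+
    have ends: "\<gamma> 0 \<in> carrier (GL n) - C" "\<gamma> 1 \<in> carrier (GL n) - D" using \<gamma>(2,3) gh assms(1) by auto
    have "finite ({t. \<gamma> t \<notin> carrier (GL n) - C} \<union> {t. \<gamma> t \<notin> carrier (GL n) - D} \<union> {t. \<gamma> t \<notin> S})"
      using \<gamma>(4) cofinite_curve[OF \<gamma>(1) op(1) ends(1)] cofinite_curve[OF \<gamma>(1) op(2) ends(2)] by simp
    then obtain t where "t \<notin> {t. \<gamma> t \<notin> carrier (GL n) - C} \<union> {t. \<gamma> t \<notin> carrier (GL n) - D} \<union> {t. \<gamma> t \<notin> S}"
      using ex_new_if_finite infinite_UNIV_char_0 by metis
    then show False using CD by blast
  qed
qed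

definition segment :: "nat \<Rightarrow> complex mat \<Rightarrow> complex mat \<Rightarrow> complex \<Rightarrow> complex mat" where
  "segment n a b t = mat n n (\<lambda>(i, j). a $$ (i, j) + t * (b $$ (i, j) - a $$ (i, j)))"

lemma segment_carrier: "segment n a b t \<in> carrier_mat n n"
  by (simp add: segment_def)

lemma matrix_over_segment: "matrix_over (range poly) n (segment n a b)"
  unfolding segment_def
proof (rule matrix_over_mat)
  fix i j
  have "(\<lambda>x. a $$ (i, j) + x * (b $$ (i, j) - a $$ (i, j))) = poly [:a $$ (i, j), b $$ (i, j) - a $$ (i, j):]"
    by auto
  then show "(\<lambda>x. a $$ (i, j) + x * (b $$ (i, j) - a $$ (i, j))) \<in> range poly" by (rule range_eqI)
qed

lemma segment_endpoints:
  "a \<in> carrier_mat n n \<Longrightarrow> segment n a b 0 = a" "b \<in> carrier_mat n n \<Longrightarrow> segment n a b 1 = b"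
  by (auto simp: segment_def intro!: eq_matI)

section \<open>Matrices triangular for an ordering of the indices\<close>

text \<open>
  The order of the indices is given by \<open>\<tau>\<close>: lower triangular matrices are those for \<open>\<tau> = int\<close>, upper
  triangular ones those for \<open>\<tau> i = - int i\<close>, and conjugating a lower triangular matrix by
  the permutation matrix of \<open>v\<close> gives the order by the values of the inverse of \<open>v\<close>.
\<close>

definition triangular_wrt :: "(nat \<Rightarrow> int) \<Rightarrow> nat \<Rightarrow> complex mat \<Rightarrow> bool" where
  "triangular_wrt \<tau> n m \<longleftrightarrow> (\<forall>i<n. \<forall>j<n. m $$ (i, j) \<noteq> 0 \<longrightarrow> \<tau> j \<le> \<tau> i)"

lemma triangular_wrtD: "triangular_wrt \<tau> n m \<Longrightarrow> i < n \<Longrightarrow> j < n \<Longrightarrow> \<tau> i < \<tau> j \<Longrightarrow> m $$ (i, j) = 0"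
  unfolding triangular_wrt_def by force

lemma mat_mult_entry:
  "A \<in> carrier_mat n n \<Longrightarrow> B \<in> carrier_mat n n \<Longrightarrow> i < n \<Longrightarrow> j < n \<Longrightarrow>
   (A * B) $$ (i, j) = (\<Sum>k<n. A $$ (i, k) * B $$ (k, j))"
  by (simp add: times_mat_def scalar_prod_def atLeast0LessThan)

lemma triangular_wrt_mult:
  assumes "triangular_wrt \<tau> n a" "triangular_wrt \<tau> n b" "a \<in> carrier_mat n n" "b \<in> carrier_mat n n"
  shows "triangular_wrt \<tau> n (a * b)"
  unfolding triangular_wrt_def
proof (intro allI impI)
  fix i j assume ij: "i < n" "j < n" "(a * b) $$ (i, j) \<noteq> 0"
  then have "(\<Sum>k<n. a $$ (i, k) * b $$ (k, j)) \<noteq> 0"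
    using mat_mult_entry[OF assms(3,4) ij(1,2)] by simp
  then obtain k where "k < n" "a $$ (i, k) * b $$ (k, j) \<noteq> 0" by (meson lessThan_iff sum.not_neutral_contains_not_neutral)
  then have "a $$ (i, k) \<noteq> 0" "b $$ (k, j) \<noteq> 0" by auto
  then have "\<tau> k \<le> \<tau> i" "\<tau> j \<le> \<tau> k"
    using assms(1,2) ij(1,2) \<open>k < n\<close> unfolding triangular_wrt_def by simp_all
  then show "\<tau> j \<le> \<tau> i" by (rule order_trans[rotated])
qed

text \<open>
  Some term of the Leibniz formula is nonzero.
\<close>

lemma det_nonzero_permutation:
  assumes "A \<in> carrier_mat q q" "det A \<noteq> (0 :: complex)"
  obtains \<sigma> where "\<sigma> permutes {..<q}" "\<And>s. s < q \<Longrightarrow> A $$ (s, \<sigma> s) \<noteq> 0"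
proof -
  have "(\<Sum>p\<in>{p. p permutes {..<q}}. signof p * (\<Prod>i<q. A $$ (i, p i))) \<noteq> 0"
    using assms det_def'[OF assms(1)] by (simp add: atLeast0LessThan)
  then obtain p where "p permutes {..<q}" "(\<Prod>i<q. A $$ (i, p i)) \<noteq> 0"
    by (metis (no_types, lifting) mem_Collect_eq mult_zero_right sum.not_neutral_contains_not_neutral)
  then show thesis by (intro that[of p]) auto
qed

text \<open>
  A permutation \<open>p\<close> contributing to the Leibniz formula satisfies \<open>\<kappa> (p i) \<le> \<kappa> i\<close> for all \<open>i\<close>. As the
  two sides have the same sum, equality holds everywhere, so \<open>p\<close> is the identity.
\<close>

lemma det_triangular_order:
  assumes A: "A \<in> carrier_mat q q" and \<kappa>: "inj_on \<kappa> {..<q}"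
    and tri: "\<And>s t. s < q \<Longrightarrow> t < q \<Longrightarrow> A $$ (s, t) \<noteq> (0 :: complex) \<Longrightarrow> \<kappa> t \<le> (\<kappa> s :: int)"
  shows "det A = (\<Prod>s<q. A $$ (s, s))"
proof -
  have zero: "(\<Prod>i<q. A $$ (i, p i)) = 0" if p: "p permutes {..<q}" "p \<noteq> id" for p
  proof (rule ccontr)
    assume "(\<Prod>i<q. A $$ (i, p i)) \<noteq> 0"
    then have nz: "A $$ (i, p i) \<noteq> 0" if "i < q" for i using that by auto
    have pl: "p i < q" if "i < q" for i using permutes_in_image[OF p(1), of i] that by simp
    have le: "\<kappa> (p i) \<le> \<kappa> i" if "i < q" for i using tri[OF that pl[OF that] nz[OF that]] .
    have "(\<Sum>i<q. \<kappa> (p i)) = (\<Sum>i<q. \<kappa> i)"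
      using sum.permute[OF p(1), of \<kappa>] by (simp add: o_def)
    then have "\<kappa> (p i) = \<kappa> i" if "i < q" for i
      using sum_mono_inv[of "\<lambda>i. \<kappa> (p i)" "{..<q}" \<kappa> i] le that by auto
    then have "p i = i" if "i < q" for i using \<kappa> pl that by (simp add: inj_on_def)
    then have "p = id" using p(1) by (metis eq_id_iff lessThan_iff permutes_not_in)
    then show False using p(2) by simp
  qed
  have "det A = (\<Sum>p\<in>{p. p permutes {..<q}}. signof p * (\<Prod>i<q. A $$ (i, p i)))"
    using det_def'[OF A] by (simp add: atLeast0LessThan)
  also have "\<dots> = (\<Sum>p\<in>{id}. signof p * (\<Prod>i<q. A $$ (i, p i)))"
    by (rule sum.mono_neutral_right) (auto simp: permutes_id zero finite_permutations)
  finally show ?thesis by simp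
qed

lemma triangular_wrt_diag_nonzero:
  assumes "triangular_wrt \<tau> n a" "inj_on \<tau> {..<n}" "a \<in> carrier (GL n)" "i < n"
  shows "a $$ (i, i) \<noteq> 0"
proof -
  have "det a = (\<Prod>s<n. a $$ (s, s))"
    using assms by (intro det_triangular_order[of _ _ \<tau>]) (auto simp: carrier_GL_iff triangular_wrt_def)
  then show ?thesis using assms(3,4) by (auto simp: carrier_GL_iff)
qed

text \<open>
  Take a wrong nonzero entry of \<open>d\<close> in a given column \<open>j\<close> whose row \<open>i\<close> has minimal \<open>\<tau>\<close>. All other terms
  of the entry \<open>(i, j)\<close> of \<open>a * d\<close> vanish, so that entry is nonzero although \<open>i \<noteq> j\<close>.
\<close>

lemma triangular_wrt_inverse:
  assumes tri: "triangular_wrt \<tau> n a" "inj_on \<tau> {..<n}" "a \<in> carrier (GL n)"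
    and d: "d \<in> carrier_mat n n" "a * d = 1\<^sub>m n"
  shows "triangular_wrt \<tau> n d"
proof (rule ccontr)
  assume "\<not> triangular_wrt \<tau> n d"
  then obtain i0 j where j: "i0 < n" "j < n" "d $$ (i0, j) \<noteq> 0" "\<tau> i0 < \<tau> j"
    unfolding triangular_wrt_def by (auto simp: not_le)
  define S where "S = {i. i < n \<and> d $$ (i, j) \<noteq> 0 \<and> \<tau> i < \<tau> j}"
  have "finite S" "S \<noteq> {}" using j unfolding S_def by auto
  then obtain i where i: "i \<in> S" "\<And>k. k \<in> S \<Longrightarrow> \<tau> i \<le> \<tau> k"
    using ex_is_arg_min_if_finite[of S \<tau>] by (auto simp: is_arg_min_linorder)
  have iS: "i < n" "d $$ (i, j) \<noteq> 0" "\<tau> i < \<tau> j" using i(1) unfolding S_def by auto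
  have "a $$ (i, k) * d $$ (k, j) = 0" if k: "k < n" "k \<noteq> i" for k
  proof (rule ccontr)
    assume "a $$ (i, k) * d $$ (k, j) \<noteq> 0"
    then have nz: "a $$ (i, k) \<noteq> 0" "d $$ (k, j) \<noteq> 0" by auto
    have "\<tau> k \<le> \<tau> i" using nz(1) tri(1) iS(1) k by (simp add: triangular_wrt_def)
    moreover have "\<tau> k \<noteq> \<tau> i" using tri(2) k iS(1) by (auto simp: inj_on_def)
    ultimately have "\<tau> k < \<tau> i" by simp
    moreover from this have "k \<in> S" unfolding S_def using k nz(2) iS(3) by auto
    ultimately show False using i(2) by fastforce
  qed
  then have "(\<Sum>k<n. a $$ (i, k) * d $$ (k, j)) = (\<Sum>k\<in>{i}. a $$ (i, k) * d $$ (k, j))"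
    using iS(1) by (intro sum.mono_neutral_right) auto
  then have "(a * d) $$ (i, j) = a $$ (i, i) * d $$ (i, j)"
    using mat_mult_entry[OF GL_carrier_mat[OF tri(3)] d(1) iS(1) j(2)] by simp
  moreover have "i \<noteq> j" using iS(3) by auto
  ultimately show False
    using d(2) iS(1,2) j(2) triangular_wrt_diag_nonzero[OF tri iS(1)] by simp
qed

lemma borel_upper_iff: "b \<in> borel_upper n \<longleftrightarrow> b \<in> carrier (GL n) \<and> triangular_wrt (\<lambda>i. - int i) n b"
proof -
  have "upper_triangular b \<longleftrightarrow> triangular_wrt (\<lambda>i. - int i) n b" if "b \<in> carrier_mat n n"
  proof -
    have "upper_triangular b \<longleftrightarrow> (\<forall>i<n. \<forall>j<i. b $$ (i, j) = 0)"
      using that unfolding upper_triangular_def by simp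
    then show ?thesis unfolding triangular_wrt_def neg_le_iff_le
      by (metis not_le of_nat_le_iff order_less_trans)
  qed
  then show ?thesis unfolding borel_upper_def using GL_carrier_mat by auto
qed

lemma borel_lower_iff: "b \<in> borel_lower n \<longleftrightarrow> b \<in> carrier (GL n) \<and> triangular_wrt int n b"
proof -
  have "upper_triangular (transpose_mat b) \<longleftrightarrow> triangular_wrt int n b" if "b \<in> carrier_mat n n"
  proof -
    have "upper_triangular (transpose_mat b) \<longleftrightarrow> (\<forall>i<n. \<forall>j<i. b $$ (j, i) = 0)"
      using that unfolding upper_triangular_def by simp
    then show ?thesis unfolding triangular_wrt_def
      by (metis not_le of_nat_le_iff order_less_trans)
  qed
  then show ?thesis unfolding borel_lower_def using GL_carrier_mat by auto
qed

lemma borel_upper_GL: "b \<in> borel_upper n \<Longrightarrow> b \<in> carrier (GL n)"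
  by (simp add: borel_upper_def)

lemma borel_lower_GL: "b \<in> borel_lower n \<Longrightarrow> b \<in> carrier (GL n)"
  by (simp add: borel_lower_def)

lemma inj_neg_int: "inj_on (\<lambda>i. - int i) S"
  by (auto simp: inj_on_def)

lemma inj_int: "inj_on int S"
  by (auto simp: inj_on_def)

lemma borel_upper_mult: "a \<in> borel_upper n \<Longrightarrow> b \<in> borel_upper n \<Longrightarrow> a * b \<in> borel_upper n"
  by (auto simp: borel_upper_iff GL_mult_closed GL_carrier_mat intro: triangular_wrt_mult)

lemma borel_lower_mult: "a \<in> borel_lower n \<Longrightarrow> b \<in> borel_lower n \<Longrightarrow> a * b \<in> borel_lower n"
  by (auto simp: borel_lower_iff GL_mult_closed GL_carrier_mat intro: triangular_wrt_mult)

lemma borel_upper_inverse: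
  assumes "a \<in> borel_upper n"
  obtains d where "d \<in> borel_upper n" "a * d = 1\<^sub>m n" "d * a = 1\<^sub>m n"
proof -
  obtain d where "d \<in> carrier (GL n)" "a * d = 1\<^sub>m n" "d * a = 1\<^sub>m n"
    using GL_inverse[OF borel_upper_GL[OF assms]] by blast
  then show thesis
    using assms triangular_wrt_inverse[OF _ inj_neg_int, of n a d]
    by (intro that[of d]) (auto simp: borel_upper_iff GL_carrier_mat)
qed

lemma borel_lower_inverse:
  assumes "a \<in> borel_lower n"
  obtains d where "d \<in> borel_lower n" "a * d = 1\<^sub>m n" "d * a = 1\<^sub>m n"
proof -
  obtain d where "d \<in> carrier (GL n)" "a * d = 1\<^sub>m n" "d * a = 1\<^sub>m n"
    using GL_inverse[OF borel_lower_GL[OF assms]] by blast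
  then show thesis
    using assms triangular_wrt_inverse[OF _ inj_int, of n a d]
    by (intro that[of d]) (auto simp: borel_lower_iff GL_carrier_mat)
qed

lemma one_in_borel_upper: "1\<^sub>m n \<in> borel_upper n"
  and one_in_borel_lower: "1\<^sub>m n \<in> borel_lower n"
  by (auto simp: borel_upper_iff borel_lower_iff one_in_GL triangular_wrt_def)

section \<open>The rank order on permutations\<close>

text \<open>
  This is the rank-matrix criterion for the Bruhat order. It is what the vanishing of minors gives.
\<close>

definition rank_le :: "nat \<Rightarrow> (nat \<Rightarrow> nat) \<Rightarrow> (nat \<Rightarrow> nat) \<Rightarrow> bool" where
  "rank_le n v u \<longleftrightarrow> (\<forall>i\<le>n. \<forall>j. card {c. c < i \<and> j \<le> v c} \<le> card {c. c < i \<and> j \<le> u c})"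

lemma rank_le_refl: "rank_le n v v"
  by (simp add: rank_le_def)

lemma rank_le_trans: "rank_le n u v \<Longrightarrow> rank_le n v w \<Longrightarrow> rank_le n u w"
  unfolding rank_le_def by (meson order_trans)

lemma card_swap_above:
  assumes "a < b" "b < (i :: nat)"
  shows "card {c. c < i \<and> j \<le> v (transpose a b c)} = card {c. c < i \<and> j \<le> (v c :: nat)}"
proof -
  let ?t = "transpose a b"
  have lt: "?t c < i \<longleftrightarrow> c < i" for c using assms by (auto simp: transpose_def)
  have "{c. c < i \<and> j \<le> v (?t c)} = ?t ` {c. c < i \<and> j \<le> v c}"
  proof (intro equalityI subsetI)
    fix c assume "c \<in> {c. c < i \<and> j \<le> v (?t c)}"
    then have "?t c \<in> {c. c < i \<and> j \<le> v c}" by (simp add: lt)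
    then show "c \<in> ?t ` {c. c < i \<and> j \<le> v c}" by (metis imageI transpose_involutory)
  qed (auto simp: lt)
  moreover have "inj_on ?t {c. c < i \<and> j \<le> v c}" by (rule inj_on_inverseI[where g = ?t]) simp
  ultimately show ?thesis by (simp add: card_image)
qed

lemma rank_le_swap:
  assumes ab: "a < b" "b < n" and v: "v a < v b"
  shows "rank_le n v (v \<circ> transpose a b)" "\<not> rank_le n (v \<circ> transpose a b) v"
proof -
  let ?t = "transpose a b"
  have "card {c. c < i \<and> j \<le> v c} \<le> card {c. c < i \<and> j \<le> v (?t c)}" for i j
  proof (cases "i \<le> b")
    case True
    have "j \<le> v (?t c)" if "c < i" "j \<le> v c" for c
      using that True v by (cases "c = a"; cases "c = b") auto
    then have "{c. c < i \<and> j \<le> v c} \<subseteq> {c. c < i \<and> j \<le> v (?t c)}" by auto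
    then show ?thesis by (intro card_mono) auto
  qed (use card_swap_above[OF ab(1)] in auto)
  then show "rank_le n v (v \<circ> ?t)" by (simp add: rank_le_def)
  have "{c. c < Suc a \<and> v b \<le> v c} \<subset> {c. c < Suc a \<and> v b \<le> v (?t c)}"
  proof
    have "v b \<le> v (?t c)" if "c < Suc a" "v b \<le> v c" for c
      using that ab v by (cases "c = a") auto
    then show "{c. c < Suc a \<and> v b \<le> v c} \<subseteq> {c. c < Suc a \<and> v b \<le> v (?t c)}" by auto
    have "a \<in> {c. c < Suc a \<and> v b \<le> v (?t c)}" "a \<notin> {c. c < Suc a \<and> v b \<le> v c}" using v by auto
    then show "{c. c < Suc a \<and> v b \<le> v c} \<noteq> {c. c < Suc a \<and> v b \<le> v (?t c)}" by metis
  qed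
  then have "card {c. c < Suc a \<and> v b \<le> v c} < card {c. c < Suc a \<and> v b \<le> v (?t c)}"
    by (intro psubset_card_mono) auto
  then have "\<not> card {c. c < Suc a \<and> v b \<le> (v \<circ> ?t) c} \<le> card {c. c < Suc a \<and> v b \<le> v c}"
    by simp
  moreover have "Suc a \<le> n" using ab by simp
  ultimately show "\<not> rank_le n (v \<circ> ?t) v" unfolding rank_le_def by blast
qed

text \<open>
  Take \<open>a\<close> to be the first position where \<open>v\<close> and \<open>u\<close> differ; there \<open>v a < u a\<close>. Take \<open>b\<close> to be the first
  later position with \<open>v a < v b \<le> u a\<close>, which exists since the value \<open>u a\<close> occurs in \<open>v\<close> after \<open>a\<close>. The
  swap raises by one the counts with \<open>a < i \<le> b\<close> and \<open>v a < j \<le> v b\<close>. There the inequality between \<open>v\<close> and \<open>u\<close>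
  is strict: between \<open>a\<close> and \<open>b\<close> a value of \<open>v\<close> that is at least \<open>j\<close> exceeds \<open>u a\<close>, so the comparison at the
  level \<open>u a + 1\<close> bounds the number of these, and \<open>u\<close> has the additional position \<open>a\<close>.
\<close>

lemma rank_le_cover:
  assumes v: "v permutes {..<n}" and u: "u permutes {..<n}" and le: "rank_le n v u" and ne: "v \<noteq> u"
  obtains a b where "a < b" "b < n" "v a < v b"
    "\<And>c. a < c \<Longrightarrow> c < b \<Longrightarrow> \<not> (v a < v c \<and> v c < v b)" "rank_le n (v \<circ> transpose a b) u"
proof -
  have "\<exists>c. v c \<noteq> u c" using ne by auto
  define a where "a = (LEAST c. v c \<noteq> u c)"
  have a: "v a \<noteq> u a" unfolding a_def by (rule LeastI_ex) fact
  have below: "v c = u c" if "c < a" for c using that not_less_Least unfolding a_def by blast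
  have an: "a < n"
  proof (rule ccontr)
    assume "\<not> a < n"
    then have "v a = a" "u a = a" using permutes_not_in[OF v, of a] permutes_not_in[OF u, of a] by auto
    then show False using a by simp
  qed
  have va: "v a < u a"
  proof (rule ccontr)
    assume "\<not> v a < u a"
    then have ua: "u a < v a" using a by simp
    have "{c. c < Suc a \<and> v a \<le> u c} \<subset> {c. c < Suc a \<and> v a \<le> v c}"
    proof
      show "{c. c < Suc a \<and> v a \<le> u c} \<subseteq> {c. c < Suc a \<and> v a \<le> v c}"
        using ua below by (auto simp: less_Suc_eq)
      have "a \<in> {c. c < Suc a \<and> v a \<le> v c}" "a \<notin> {c. c < Suc a \<and> v a \<le> u c}" using ua by auto
      then show "{c. c < Suc a \<and> v a \<le> u c} \<noteq> {c. c < Suc a \<and> v a \<le> v c}" by metis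
    qed
    then have "card {c. c < Suc a \<and> v a \<le> u c} < card {c. c < Suc a \<and> v a \<le> v c}"
      by (intro psubset_card_mono) auto
    moreover have "Suc a \<le> n" using an by simp
    ultimately show False using le unfolding rank_le_def by (metis not_le)
  qed
  have "\<exists>c. a < c \<and> v a < v c \<and> v c \<le> u a"
  proof -
    obtain p where p: "v p = u a" using permutes_surj[OF v] by (metis surjD)
    have "p \<noteq> a" using p a by auto
    moreover have "\<not> p < a"
    proof
      assume "p < a"
      then have "u p = u a" using below p by simp
      then show False using permutes_inj[OF u] \<open>p \<noteq> a\<close> by (simp add: inj_eq)
    qed
    ultimately show ?thesis using p va by (intro exI[of _ p]) auto
  qed
  define b where "b = (LEAST c. a < c \<and> v a < v c \<and> v c \<le> u a)"
  have b: "a < b" "v a < v b" "v b \<le> u a"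
    using LeastI_ex[OF \<open>\<exists>c. a < c \<and> v a < v c \<and> v c \<le> u a\<close>] unfolding b_def by auto
  have between: "\<not> (v a < v c \<and> v c \<le> u a)" if "a < c" "c < b" for c
    using that not_less_Least[of c "\<lambda>c. a < c \<and> v a < v c \<and> v c \<le> u a"] unfolding b_def by auto
  have ua: "u a < n" using permutes_in_image[OF u, of a] an by simp
  have bn: "b < n"
  proof (rule ccontr)
    assume "\<not> b < n"
    then have "v b = b" using permutes_not_in[OF v, of b] by auto
    then show False using b(3) ua \<open>\<not> b < n\<close> by simp
  qed
  let ?t = "transpose a b"
  have "card {c. c < i \<and> j \<le> v (?t c)} \<le> card {c. c < i \<and> j \<le> u c}" if i: "i \<le> n" for i j
  proof -
    have vu: "card {c. c < i \<and> j \<le> v c} \<le> card {c. c < i \<and> j \<le> u c}" for j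
      using le i unfolding rank_le_def by blast
    consider "b < i" | "i \<le> a" | "a < i" "i \<le> b" "\<not> (v a < j \<and> j \<le> v b)" | "a < i" "i \<le> b" "v a < j" "j \<le> v b"
      by linarith
    then show ?thesis
    proof cases
      case 1
      then show ?thesis using card_swap_above[OF b(1), of i j v] vu by simp
    next
      case 2
      then have "{c. c < i \<and> j \<le> v (?t c)} = {c. c < i \<and> j \<le> v c}" using b(1) by (auto simp: transpose_def)
      then show ?thesis using vu by simp
    next
      case 3
      then have "{c. c < i \<and> j \<le> v (?t c)} = {c. c < i \<and> j \<le> v c}"
        using b by (auto simp: transpose_def)
      then show ?thesis using vu by simp
    next
      case 4
      \<comment> \<open>\<open>A\<close> and \<open>A'\<close> are common to \<open>v\<close> and \<open>u\<close>; \<open>V\<close> and \<open>U\<close> compare the positions after \<open>a\<close>\<close>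
      define A where "A = {c. c < a \<and> j \<le> u c}"
      define A' where "A' = {c. c < a \<and> u a < u c}"
      define V where "V = {c. a < c \<and> c < i \<and> u a < v c}"
      define U where "U = {c. a < c \<and> c < i \<and> u a < u c}"
      have fin: "finite A" "finite A'" "finite V" "finite U" unfolding A_def A'_def V_def U_def by auto
      have "{c. c < i \<and> Suc (u a) \<le> v c} = A' \<union> V"
      proof (rule Set.set_eqI)
        fix c
        show "c \<in> {c. c < i \<and> Suc (u a) \<le> v c} \<longleftrightarrow> c \<in> A' \<union> V"
          using 4 va below by (cases c a rule: linorder_cases) (auto simp: A'_def V_def)
      qed
      moreover have "{c. c < i \<and> Suc (u a) \<le> u c} = A' \<union> U"
      proof (rule Set.set_eqI)
        fix c
        show "c \<in> {c. c < i \<and> Suc (u a) \<le> u c} \<longleftrightarrow> c \<in> A' \<union> U"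
          using 4 by (cases c a rule: linorder_cases) (auto simp: A'_def U_def)
      qed
      moreover have "A' \<inter> V = {}" "A' \<inter> U = {}" unfolding A'_def V_def U_def by auto
      ultimately have VU: "card V \<le> card U" using vu[of "Suc (u a)"] fin by (simp add: card_Un_disjoint)
      have "{c. c < i \<and> j \<le> v (?t c)} \<subseteq> insert a (A \<union> V)"
      proof
        fix c assume c: "c \<in> {c. c < i \<and> j \<le> v (?t c)}"
        consider "c < a" | "c = a" | "a < c" by linarith
        then show "c \<in> insert a (A \<union> V)"
        proof cases
          case 1
          then show ?thesis using c b(1) below by (auto simp: A_def transpose_def)
        next
          case 3
          then have "?t c = c" using c 4 by (auto simp: transpose_def)
          then show ?thesis using c between[of c] 3 4 by (auto simp: V_def)
        qed simp
      qed
      then have "card {c. c < i \<and> j \<le> v (?t c)} \<le> card (insert a (A \<union> V))"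
        using fin by (intro card_mono) auto
      also have "\<dots> \<le> Suc (card A + card V)"
        using card_Un_le[of A V] fin by (simp add: card_insert_if)
      also have "\<dots> \<le> Suc (card A + card U)" using VU by simp
      also have "\<dots> = card (insert a (A \<union> U))"
      proof -
        have "a \<notin> A \<union> U" "A \<inter> U = {}" unfolding A_def U_def by auto
        then show ?thesis using fin by (simp add: card_Un_disjoint)
      qed
      also have "\<dots> \<le> card {c. c < i \<and> j \<le> u c}"
        using 4 b(3) by (intro card_mono) (auto simp: A_def U_def)
      finally show ?thesis .
    qed
  qed
  then have "rank_le n (v \<circ> ?t) u" by (simp add: rank_le_def)
  moreover have "\<not> (v a < v c \<and> v c < v b)" if "a < c" "c < b" for c using between[OF that] b(3) by auto
  ultimately show thesis using that b(1,2) bn by blast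
qed

definition inversions :: "nat \<Rightarrow> (nat \<Rightarrow> nat) \<Rightarrow> (nat \<times> nat) set" where
  "inversions n v = {(i, j). i < j \<and> j < n \<and> v j < v i}"

lemma finite_inversions: "finite (inversions n v)"
  by (rule finite_subset[of _ "{..<n} \<times> {..<n}"]) (auto simp: inversions_def)

text \<open>
  A pair of positions is moved by the transposition unless this would destroy its order; on
  ordered pairs this is an involution. Pairs inside \<open>[a, b]\<close> stay fixed. It matches the inversions
  before and after a swap, up to the pair \<open>(a, b)\<close> itself.
\<close>

definition swap_pair :: "nat \<Rightarrow> nat \<Rightarrow> nat \<times> nat \<Rightarrow> nat \<times> nat" where
  "swap_pair a b p = (if fst p < a then (fst p, transpose a b (snd p))
     else if b < snd p then (transpose a b (fst p), snd p) else p)"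

lemma inj_on_swap_pair:
  assumes "a < b"
  shows "inj_on (swap_pair a b) S"
proof (rule inj_on_inverseI)
  fix p :: "nat \<times> nat"
  have "\<not> fst p < a \<Longrightarrow> \<not> transpose a b (fst p) < a" using assms by (auto simp: transpose_def)
  then show "swap_pair a b (swap_pair a b p) = p" by (auto simp: swap_pair_def)
qed

lemma perm_length_swap_le:
  assumes ab: "a < b" "b < n" and v: "v a < v b"
  shows "perm_length n v \<le> perm_length n (v \<circ> transpose a b)"
proof -
  let ?t = "transpose a b"
  have "swap_pair a b ` inversions n v \<subseteq> inversions n (v \<circ> ?t)"
  proof
    fix p assume "p \<in> swap_pair a b ` inversions n v"
    then obtain i j where ij: "i < j" "j < n" "v j < v i" "p = swap_pair a b (i, j)"
      by (auto simp: inversions_def)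
    consider "i < a" | "\<not> i < a" "b < j" | "\<not> i < a" "\<not> b < j" by blast
    then show "p \<in> inversions n (v \<circ> ?t)"
      by cases (use ij ab v in \<open>auto simp: swap_pair_def inversions_def transpose_def\<close>)
  qed
  then have "card (inversions n v) \<le> card (inversions n (v \<circ> ?t))"
    using card_inj_on_le[OF inj_on_swap_pair[OF ab(1)] _ finite_inversions] by blast
  then show ?thesis by (simp add: perm_length_def inversions_def)
qed

lemma perm_length_cover:
  assumes inj: "inj v" and ab: "a < b" "b < n" and v: "v a < v b"
    and between: "\<And>c. a < c \<Longrightarrow> c < b \<Longrightarrow> \<not> (v a < v c \<and> v c < v b)"
  shows "perm_length n (v \<circ> transpose a b) \<le> Suc (perm_length n v)"
proof -
  let ?t = "transpose a b"
  have out: "v c < v a \<or> v b < v c" if "a < c" "c < b" for c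
    using between[OF that] that inj by (metis injD nat_neq_iff order_less_irrefl)
  have "swap_pair a b ` (inversions n (v \<circ> ?t) - {(a, b)}) \<subseteq> inversions n v"
  proof
    fix p assume "p \<in> swap_pair a b ` (inversions n (v \<circ> ?t) - {(a, b)})"
    then obtain i j where ij: "i < j" "j < n" "v (?t j) < v (?t i)" "(i, j) \<noteq> (a, b)"
      "p = swap_pair a b (i, j)"
      by (auto simp: inversions_def)
    consider "i < a" | "\<not> i < a" "b < j" | "\<not> i < a" "\<not> b < j" by blast
    then show "p \<in> inversions n v"
    proof cases
      case 3
      then have p: "p = (i, j)" using ij(5) by (simp add: swap_pair_def)
      consider "i = a" "a < j" "j < b" | "a < i" "i < b" "j = b" | "a < i" "j < b"
        using 3 ij(1,4) by fastforce
      then have "v j < v i"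
        using ij(1,3) out[of i] out[of j] v by cases (auto simp: transpose_def)
      then show ?thesis using ij p by (simp add: inversions_def)
    qed (use ij ab v in \<open>auto simp: swap_pair_def inversions_def transpose_def\<close>)
  qed
  then have "card (inversions n (v \<circ> ?t) - {(a, b)}) \<le> card (inversions n v)"
    using card_inj_on_le[OF inj_on_swap_pair[OF ab(1)] _ finite_inversions] by blast
  moreover have "card (inversions n (v \<circ> ?t)) \<le> Suc (card (inversions n (v \<circ> ?t) - {(a, b)}))"
    by (metis Diff_empty Diff_insert0 card.insert_remove card_insert_le_m1 card_Suc_Diff1 finite_inversions insert_absorb le_SucI order_refl)
  ultimately show ?thesis by (simp add: perm_length_def inversions_def)
qed

lemma permutes_swap: "v permutes {..<n} \<Longrightarrow> a < n \<Longrightarrow> b < n \<Longrightarrow> v \<circ> transpose a b permutes {..<n :: nat}"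
  by (intro permutes_compose permutes_swap_id) auto

text \<open>
  The permutations \<open>x 0, \<dots>, x m\<close> lead upwards from \<open>v\<close> to \<open>u\<close>, each step exchanging two values that
  are in increasing order.
\<close>

definition rank_chain :: "nat \<Rightarrow> (nat \<Rightarrow> nat) \<Rightarrow> (nat \<Rightarrow> nat) \<Rightarrow> nat \<Rightarrow> (nat \<Rightarrow> nat \<Rightarrow> nat) \<Rightarrow> bool" where
  "rank_chain n v u m x \<longleftrightarrow> x 0 = v \<and> x m = u \<and> (\<forall>i<m. \<exists>a b. a < b \<and> b < n \<and> x i a < x i b \<and>
     x (Suc i) = x i \<circ> transpose a b)"

text \<open>
  Each step of \<open>rank_le_cover\<close> adds at most one to the length, because no value between the exchanged
  ones occurs between their positions. The interval from the current permutation to \<open>u\<close> shrinks.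
\<close>

lemma rank_chain_exists:
  assumes "v permutes {..<n}" "u permutes {..<n}" "rank_le n v u"
  shows "\<exists>m x. rank_chain n v u m x \<and> perm_length n u \<le> perm_length n v + m"
  using assms
proof (induction "card {y. y permutes {..<n} \<and> rank_le n v y \<and> rank_le n y u}" arbitrary: v rule: less_induct)
  case less
  show ?case
  proof (cases "v = u")
    case True
    then show ?thesis by (intro exI[of _ 0] exI[of _ "\<lambda>_. u"]) (simp add: rank_chain_def)
  next
    case False
    then obtain a b where ab: "a < b" "b < n" "v a < v b"
      "\<And>c. a < c \<Longrightarrow> c < b \<Longrightarrow> \<not> (v a < v c \<and> v c < v b)" "rank_le n (v \<circ> transpose a b) u"
      using rank_le_cover[OF less.prems(1,2,3)] by metis
    let ?v = "v \<circ> transpose a b"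
    have perm: "?v permutes {..<n}" using less.prems(1) ab by (intro permutes_swap) auto
    note sw = rank_le_swap[where v = v, OF ab(1,2,3)]
    have "{y. y permutes {..<n} \<and> rank_le n ?v y \<and> rank_le n y u}
      \<subset> {y. y permutes {..<n} \<and> rank_le n v y \<and> rank_le n y u}"
    proof
      show "{y. y permutes {..<n} \<and> rank_le n ?v y \<and> rank_le n y u}
        \<subseteq> {y. y permutes {..<n} \<and> rank_le n v y \<and> rank_le n y u}"
        using rank_le_trans[OF sw(1)] by auto
      have "v \<in> {y. y permutes {..<n} \<and> rank_le n v y \<and> rank_le n y u}"
        using less.prems rank_le_refl by auto
      moreover have "v \<notin> {y. y permutes {..<n} \<and> rank_le n ?v y \<and> rank_le n y u}" using sw(2) by auto
      ultimately show "{y. y permutes {..<n} \<and> rank_le n ?v y \<and> rank_le n y u}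
        \<noteq> {y. y permutes {..<n} \<and> rank_le n v y \<and> rank_le n y u}" by metis
    qed
    then have "card {y. y permutes {..<n} \<and> rank_le n ?v y \<and> rank_le n y u}
      < card {y. y permutes {..<n} \<and> rank_le n v y \<and> rank_le n y u}"
      by (intro psubset_card_mono) (auto intro: finite_subset[OF _ finite_permutations[of "{..<n}"]])
    then obtain m x where x: "rank_chain n ?v u m x" "perm_length n u \<le> perm_length n ?v + m"
      using less.hyps[OF _ perm less.prems(2) ab(5)] by auto
    have "rank_chain n v u (Suc m) (case_nat v x)"
      unfolding rank_chain_def
    proof (intro conjI allI impI)
      show "case_nat v x (Suc m) = u" using x(1) by (simp add: rank_chain_def)
      fix i assume "i < Suc m"
      then show "\<exists>a b. a < b \<and> b < n \<and> case_nat v x i a < case_nat v x i b \<and>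
          case_nat v x (Suc i) = case_nat v x i \<circ> transpose a b"
        using x(1) ab(1,2,3) unfolding rank_chain_def by (cases i) auto
    qed simp
    moreover have "perm_length n u \<le> perm_length n v + Suc m"
      using x(2) perm_length_cover[where v = v, OF permutes_inj[OF less.prems(1)] ab(1-4)] by simp
    ultimately show ?thesis by blast
  qed
qed

lemma rank_chain_permutes:
  assumes "rank_chain n v u m x" "v permutes {..<n}" "i \<le> m"
  shows "x i permutes {..<n}"
  using assms(3)
proof (induction i)
  case 0
  then show ?case using assms by (simp add: rank_chain_def)
next
  case (Suc i)
  then obtain a b where "a < b" "b < n" "x (Suc i) = x i \<circ> transpose a b"
    using assms(1) unfolding rank_chain_def by (meson Suc_le_lessD)
  moreover have "x i permutes {..<n}" using Suc by simp
  ultimately show ?case using permutes_swap[of "x i" n a b] by (metis less_trans)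
qed

lemma rank_chain_step:
  assumes "rank_chain n v u m x" "i < m"
  shows "rank_le n (x i) (x (Suc i))" "\<not> rank_le n (x (Suc i)) (x i)"
proof -
  obtain a b where "a < b" "b < n" "x i a < x i b" "x (Suc i) = x i \<circ> transpose a b"
    using assms unfolding rank_chain_def by blast
  then show "rank_le n (x i) (x (Suc i))" "\<not> rank_le n (x (Suc i)) (x i)"
    using rank_le_swap[of a b n "x i"] by auto
qed

lemma rank_chain_mono:
  assumes "rank_chain n v u m x" "i \<le> j" "j \<le> m"
  shows "rank_le n (x i) (x j)"
  using assms(2,3)
proof (induction j rule: dec_induct)
  case (step j)
  then have "rank_le n (x i) (x j)" "rank_le n (x j) (x (Suc j))"
    using rank_chain_step(1)[OF assms(1), of j] by simp_all
  then show ?case by (rule rank_le_trans)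
qed (rule rank_le_refl)

lemma rank_le_antisym:
  assumes "v permutes {..<n}" "u permutes {..<n}" "rank_le n v u" "rank_le n u v"
  shows "v = u"
proof (rule ccontr)
  assume "v \<noteq> u"
  from rank_le_cover[OF assms(1-3) this] obtain a b
    where ab: "a < b" "b < n" "v a < v b" "rank_le n (v \<circ> transpose a b) u"
    by metis
  then show False using rank_le_swap(2)[OF ab(1-3)] rank_le_trans[OF ab(4) assms(4)] by simp
qed

text \<open>
  If \<open>u a > u b\<close>, exchanging the two values could not increase the length, so
  each Bruhat step exchanges values in increasing order.
\<close>

lemma bruhat_le_imp_rank_le:
  assumes "bruhat_le n v w" "v permutes {..<n}"
  shows "rank_le n v w"
proof -
  have "rank_le n v w \<and> w permutes {..<n}"
    using assms(1) unfolding bruhat_le_def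
  proof (induction rule: rtranclp_induct)
    case base
    then show ?case using assms(2) rank_le_refl by blast
  next
    case (step u w)
    then obtain a b where ab: "a < b" "b < n" "w = u \<circ> transpose a b" "perm_length n u < perm_length n w"
      unfolding bruhat_step_def by blast
    have "u a \<noteq> u b" using permutes_inj[of u "{..<n}"] step.IH ab(1) by (simp add: inj_eq)
    moreover have "\<not> u b < u a"
    proof
      assume "u b < u a"
      then have "perm_length n w \<le> perm_length n (w \<circ> transpose a b)"
        using ab by (intro perm_length_swap_le) auto
      then show False using ab by (simp add: comp_assoc)
    qed
    ultimately have "u a < u b" by simp
    then have "rank_le n u w" using rank_le_swap(1)[of a b n u] ab by simp
    moreover have "w permutes {..<n}" using permutes_swap[of u n a b] step.IH ab by simp
    ultimately show ?case using step.IH rank_le_trans[of n v u w] by simp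
  qed
  then show ?thesis ..
qed

lemma perm_length_id: "perm_length n id = 0"
proof -
  have "{(i, j). i < j \<and> j < n \<and> id j < id i} = {}" by auto
  then show ?thesis unfolding perm_length_def by (simp only: card.empty)
qed

lemma rank_le_id:
  assumes "v permutes {..<n}"
  shows "rank_le n id v"
  unfolding rank_le_def
proof (intro allI impI)
  fix i j :: nat
  have "{c. c < i \<and> j \<le> id c} = {j..<i}" by auto
  then have 1: "card {c. c < i \<and> j \<le> id c} = i - j" by simp
  have "card {c. c < i \<and> v c < j} \<le> card {..<j}"
    using permutes_inj[OF assms] by (intro card_inj_on_le[of v]) (auto intro: inj_on_subset)
  moreover have "card {..<i} = card {c. c < i \<and> j \<le> v c} + card {c. c < i \<and> v c < j}"
  proof -
    have "{..<i} = {c. c < i \<and> j \<le> v c} \<union> {c. c < i \<and> v c < j}" by auto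
    then show ?thesis by (metis (no_types, lifting) card_Un_disjoint disjoint_iff finite_Un finite_lessThan mem_Collect_eq not_le)
  qed
  ultimately show "card {c. c < i \<and> j \<le> id c} \<le> card {c. c < i \<and> j \<le> v c}" using 1 by simp
qed

definition longest_perm :: "nat \<Rightarrow> nat \<Rightarrow> nat" where
  "longest_perm n i = (if i < n then n - 1 - i else i)"

lemma longest_perm_permutes: "longest_perm n permutes {..<n}"
proof (rule bij_imp_permutes)
  show "bij_betw (longest_perm n) {..<n} {..<n}"
    by (rule bij_betw_byWitness[where f' = "longest_perm n"]) (auto simp: longest_perm_def)
qed (simp add: longest_perm_def)

lemma perm_length_longest: "perm_length n (longest_perm n) = card {(i, j). i < j \<and> j < n}"
  unfolding perm_length_def by (rule arg_cong[where f = card]) (auto simp: longest_perm_def)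

lemma rank_le_longest:
  assumes "v permutes {..<n}"
  shows "rank_le n v (longest_perm n)"
  unfolding rank_le_def
proof (intro allI impI)
  fix i j assume i: "i \<le> n"
  have vn: "v c < n" if "c < i" for c using permutes_in_image[OF assms, of c] that i by simp
  have "card {c. c < i \<and> j \<le> v c} \<le> card {j..<n}"
    using permutes_inj[OF assms] vn by (intro card_inj_on_le[of v]) (auto intro: inj_on_subset)
  moreover have "card {c. c < i \<and> j \<le> v c} \<le> card {..<i}" by (intro card_mono) auto
  ultimately have "card {c. c < i \<and> j \<le> v c} \<le> card {..<min i (n - j)}" by simp
  also have "\<dots> \<le> card {c. c < i \<and> j \<le> longest_perm n c}"
    using i by (intro card_mono) (auto simp: longest_perm_def)
  finally show "card {c. c < i \<and> j \<le> v c} \<le> card {c. c < i \<and> j \<le> longest_perm n c}" .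
qed

text \<open>
  The matching sends positions of \<open>v\<close> with values at least \<open>j\<close> to positions of \<open>u\<close> with this property.
\<close>

lemma rank_leI_matching:
  assumes "\<And>q. q \<le> n \<Longrightarrow> \<exists>\<sigma>. \<sigma> permutes {..<q} \<and> (\<forall>s<q. v (\<sigma> s) \<le> u s)"
  shows "rank_le n v u"
  unfolding rank_le_def
proof (intro allI impI)
  fix q j assume "q \<le> n"
  then obtain \<sigma> where \<sigma>: "\<sigma> permutes {..<q}" "\<forall>s<q. v (\<sigma> s) \<le> u s" using assms by blast
  have lt: "\<sigma> s < q \<longleftrightarrow> s < q" for s using permutes_in_image[OF \<sigma>(1), of s] by simp
  have "{c. c < q \<and> j \<le> v c} \<subseteq> \<sigma> ` {s. s < q \<and> j \<le> v (\<sigma> s)}"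
  proof
    fix c assume c: "c \<in> {c. c < q \<and> j \<le> v c}"
    obtain s where "c = \<sigma> s" using permutes_surj[OF \<sigma>(1)] by (metis surjD)
    then show "c \<in> \<sigma> ` {s. s < q \<and> j \<le> v (\<sigma> s)}" using c lt by auto
  qed
  then have "card {c. c < q \<and> j \<le> v c} \<le> card {s. s < q \<and> j \<le> v (\<sigma> s)}"
    by (rule surj_card_le[rotated]) simp
  also have "\<dots> \<le> card {c. c < q \<and> j \<le> u c}"
    using \<sigma>(2) by (intro card_mono) (auto intro: order_trans)
  finally show "card {c. c < q \<and> j \<le> v c} \<le> card {c. c < q \<and> j \<le> u c}" .
qed

section \<open>Permutation matrices and minors\<close>

lemma mat_assoc:
  "A \<in> carrier_mat n n \<Longrightarrow> B \<in> carrier_mat n n \<Longrightarrow> C \<in> carrier_mat n n \<Longrightarrow> A * B * C = A * (B * C :: complex mat)"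
  by (rule assoc_mult_mat)

lemma mult_carrier_square:
  "A \<in> carrier_mat n n \<Longrightarrow> B \<in> carrier_mat n n \<Longrightarrow> A * B \<in> carrier_mat n n"
  by (rule mult_carrier_mat)

lemma one_mult_square:
  "A \<in> carrier_mat n n \<Longrightarrow> 1\<^sub>m n * A = A" "A \<in> carrier_mat n n \<Longrightarrow> A * 1\<^sub>m n = (A :: complex mat)"
  by simp_all

lemma perm_matrix_carrier: "perm_matrix n w \<in> carrier_mat n n"
  by (simp add: perm_matrix_def)

lemma mult_perm_matrix_entry:
  assumes "A \<in> carrier_mat n n" "w permutes {..<n}" "i < n" "j < n"
  shows "(A * perm_matrix n w) $$ (i, j) = A $$ (i, w j)"
proof -
  have w: "w j < n" using permutes_in_image[OF assms(2), of j] assms(4) by simp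
  have "(A * perm_matrix n w) $$ (i, j) = (\<Sum>k<n. A $$ (i, k) * perm_matrix n w $$ (k, j))"
    by (rule mat_mult_entry[OF assms(1) perm_matrix_carrier assms(3,4)])
  also have "\<dots> = (\<Sum>k<n. if k = w j then A $$ (i, k) else 0)"
    using assms(4) by (intro sum.cong) (auto simp: perm_matrix_def)
  finally show ?thesis using w by simp
qed

lemma perm_matrix_inv_mult_entry:
  assumes "A \<in> carrier_mat n n" "w permutes {..<n}" "i < n" "j < n"
  shows "(perm_matrix n (Hilbert_Choice.inv w) * A) $$ (i, j) = A $$ (w i, j)"
proof -
  have w: "w i < n" using permutes_in_image[OF assms(2), of i] assms(3) by simp
  have inv: "i = Hilbert_Choice.inv w k \<longleftrightarrow> k = w i" for k using permutes_inverses[OF assms(2)] by metis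
  have "(perm_matrix n (Hilbert_Choice.inv w) * A) $$ (i, j) = (\<Sum>k<n. perm_matrix n (Hilbert_Choice.inv w) $$ (i, k) * A $$ (k, j))"
    by (rule mat_mult_entry[OF perm_matrix_carrier assms(1,3,4)])
  also have "\<dots> = (\<Sum>k<n. if k = w i then A $$ (k, j) else 0)"
    using assms(3) by (intro sum.cong) (auto simp: perm_matrix_def inv)
  finally show ?thesis using w by simp
qed

lemma perm_matrix_mult_inv:
  assumes "w permutes {..<n}"
  shows "perm_matrix n (Hilbert_Choice.inv w) * perm_matrix n w = 1\<^sub>m n" "perm_matrix n w * perm_matrix n (Hilbert_Choice.inv w) = 1\<^sub>m n"
proof -
  have *: "perm_matrix n (Hilbert_Choice.inv w) * perm_matrix n w = 1\<^sub>m n" if "w permutes {..<n}" for w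
  proof (rule eq_matI)
    fix i j assume "i < dim_row (1\<^sub>m n)" "j < dim_col (1\<^sub>m n :: complex mat)"
    then have ij: "i < n" "j < n" by auto
    then have "(perm_matrix n (Hilbert_Choice.inv w) * perm_matrix n w) $$ (i, j) = perm_matrix n w $$ (w i, j)"
      by (intro perm_matrix_inv_mult_entry perm_matrix_carrier that)
    also have "\<dots> = (1\<^sub>m n) $$ (i, j)"
      using ij permutes_in_image[OF that, of i] permutes_inj[OF that]
      by (auto simp: perm_matrix_def inj_eq)
    finally show "(perm_matrix n (Hilbert_Choice.inv w) * perm_matrix n w) $$ (i, j) = (1\<^sub>m n) $$ (i, j)" .
  qed (use perm_matrix_carrier in auto)
  show "perm_matrix n (Hilbert_Choice.inv w) * perm_matrix n w = 1\<^sub>m n" by (rule *[OF assms])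
  show "perm_matrix n w * perm_matrix n (Hilbert_Choice.inv w) = 1\<^sub>m n"
    using *[OF permutes_inv[OF assms]] permutes_inv_inv[OF assms] by simp
qed

lemma perm_matrix_GL:
  assumes "w permutes {..<n}"
  shows "perm_matrix n w \<in> carrier (GL n)"
  by (rule GL_mult_cancel(2)[OF perm_matrix_carrier[of n "Hilbert_Choice.inv w"] perm_matrix_carrier])
    (simp add: perm_matrix_mult_inv[OF assms] one_in_GL)

text \<open>
  The rows \<open>I 0, \<dots>, I (q - 1)\<close> and the first \<open>q\<close> columns: a Pluecker coordinate of the \<open>q\<close>-th step of the
  flag.
\<close>

definition minor :: "nat \<Rightarrow> (nat \<Rightarrow> nat) \<Rightarrow> complex mat \<Rightarrow> complex" where
  "minor q I g = det (mat q q (\<lambda>(s, t). g $$ (I s, t)))"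

lemma minor_polynomial: "q \<le> n \<Longrightarrow> (\<And>s. s < q \<Longrightarrow> I s < n) \<Longrightarrow> minor q I \<in> polynomial_functions n"
  unfolding minor_def
  by (rule function_ring_det[OF function_ring_polynomial_functions, of _ q]) (auto intro: polynomial_functions.entry)

text \<open>
  Multiplication by an upper triangular matrix on the right acts on the first \<open>q\<close> columns through its
  invertible leading block, so it multiplies the minor by a nonzero number.
\<close>

lemma minor_mult_upper:
  assumes c: "c \<in> borel_upper n" and g: "g \<in> carrier_mat n n" and q: "q \<le> n" "\<And>s. s < q \<Longrightarrow> I s < n"
  shows "minor q I (g * c) \<noteq> 0 \<longleftrightarrow> minor q I g \<noteq> 0"
proof -
  have cG: "c \<in> carrier (GL n)" "triangular_wrt (\<lambda>i. - int i) n c" using c by (auto simp: borel_upper_iff)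
  let ?A = "mat q q (\<lambda>(s, t). g $$ (I s, t))" and ?C = "mat q q (\<lambda>(s, t). c $$ (s, t))"
  have "mat q q (\<lambda>(s, t). (g * c) $$ (I s, t)) = ?A * ?C"
  proof (rule eq_matI)
    fix s t assume "s < dim_row (?A * ?C)" "t < dim_col (?A * ?C)"
    then have st: "s < q" "t < q" by auto
    have "(g * c) $$ (I s, t) = (\<Sum>k<n. g $$ (I s, k) * c $$ (k, t))"
      using st q by (intro mat_mult_entry g GL_carrier_mat[OF cG(1)]) auto
    also have "\<dots> = (\<Sum>k<q. g $$ (I s, k) * c $$ (k, t))"
      using q(1) st triangular_wrtD[OF cG(2)] by (intro sum.mono_neutral_right) auto
    also have "\<dots> = (?A * ?C) $$ (s, t)" using st by (subst mat_mult_entry[of _ q]) auto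
    finally show "mat q q (\<lambda>(s, t). (g * c) $$ (I s, t)) $$ (s, t) = (?A * ?C) $$ (s, t)" using st by simp
  qed auto
  then have "minor q I (g * c) = minor q I g * det ?C"
    unfolding minor_def by (simp add: det_mult[of _ q])
  moreover have "det ?C = (\<Prod>s<q. ?C $$ (s, s))"
    by (rule det_triangular_order[OF _ inj_neg_int]) (use cG(2) q(1) in \<open>auto simp: triangular_wrt_def\<close>)
  moreover have "(\<Prod>s<q. ?C $$ (s, s)) \<noteq> 0"
    using triangular_wrt_diag_nonzero[OF cG(2) inj_neg_int cG(1)] q(1) by auto
  ultimately show ?thesis by simp
qed

lemma minor_mult_perm_matrix:
  assumes "b \<in> carrier_mat n n" "v permutes {..<n}" "q \<le> n" "\<And>s. s < q \<Longrightarrow> I s < n"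
  shows "minor q I (b * perm_matrix n v) = det (mat q q (\<lambda>(s, t). b $$ (I s, v t)))"
proof -
  have "mat q q (\<lambda>(s, t). (b * perm_matrix n v) $$ (I s, t)) = mat q q (\<lambda>(s, t). b $$ (I s, v t))"
    using assms by (intro eq_matI) (auto simp: mult_perm_matrix_entry)
  then show ?thesis by (simp add: minor_def)
qed

lemma minor_nonzero_matching:
  assumes b: "b \<in> carrier_mat n n" "triangular_wrt \<tau> n b" and v: "v permutes {..<n}" and q: "q \<le> n" "\<And>s. s < q \<Longrightarrow> I s < n"
    and nz: "minor q I (b * perm_matrix n v) \<noteq> 0"
  obtains \<sigma> where "\<sigma> permutes {..<q}" "\<And>s. s < q \<Longrightarrow> \<tau> (v (\<sigma> s)) \<le> \<tau> (I s)"
proof -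
  have "det (mat q q (\<lambda>(s, t). b $$ (I s, v t))) \<noteq> 0"
    using nz minor_mult_perm_matrix[OF b(1) v q] by simp
  then obtain \<sigma> where \<sigma>: "\<sigma> permutes {..<q}" "\<And>s. s < q \<Longrightarrow> mat q q (\<lambda>(s, t). b $$ (I s, v t)) $$ (s, \<sigma> s) \<noteq> 0"
    using det_nonzero_permutation[of "mat q q (\<lambda>(s, t). b $$ (I s, v t))" q] by auto
  have "\<tau> (v (\<sigma> s)) \<le> \<tau> (I s)" if s: "s < q" for s
  proof -
    have "\<sigma> s < q" using permutes_in_image[OF \<sigma>(1), of s] s by simp
    moreover from this have "v (\<sigma> s) < n" using permutes_in_image[OF v, of "\<sigma> s"] q(1) by simp
    ultimately show ?thesis using \<sigma>(2)[OF s] s q(2)[OF s] b(2) by (simp add: triangular_wrt_def)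
  qed
  then show thesis using that \<sigma>(1) by blast
qed

text \<open>
  With rows \<open>v 0, \<dots>, v (q - 1)\<close> the submatrix is triangular for the order of the indices by the values
  of \<open>v\<close>.
\<close>

lemma minor_opposite_cell_nonzero:
  assumes "b \<in> borel_lower n" "v permutes {..<n}" "q \<le> n"
  shows "minor q v (b * perm_matrix n v) \<noteq> 0"
proof -
  have b: "b \<in> carrier (GL n)" "triangular_wrt int n b" using assms(1) by (auto simp: borel_lower_iff)
  have vn: "v s < n" if "s < q" for s using permutes_in_image[OF assms(2), of s] that assms(3) by simp
  let ?A = "mat q q (\<lambda>(s, t). b $$ (v s, v t))"
  have "inj_on (\<lambda>s. int (v s)) {..<q}" using permutes_inj[OF assms(2)] by (auto simp: inj_on_def dest: injD)
  then have "det ?A = (\<Prod>s<q. ?A $$ (s, s))"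
    by (intro det_triangular_order[where \<kappa> = "\<lambda>s. int (v s)"]) (use b(2) vn in \<open>auto simp: triangular_wrt_def\<close>)
  moreover have "(\<Prod>s<q. ?A $$ (s, s)) \<noteq> 0"
    using triangular_wrt_diag_nonzero[OF b(2) inj_int b(1)] vn by auto
  ultimately show ?thesis
    using minor_mult_perm_matrix[OF GL_carrier_mat[OF b(1)] assms(2,3) vn] by simp
qed

section \<open>Triangular elimination by cofactors\<close>

definition leading_block :: "nat \<Rightarrow> complex mat \<Rightarrow> complex mat" where
  "leading_block q h = mat q q (\<lambda>(s, t). h $$ (s, t))"

text \<open>
  The column \<open>j\<close> is the last column of the adjugate of the leading block of size \<open>j + 1\<close>. So \<open>h * column_elim n h\<close>
  is lower triangular. Normalising by the minors would give the LU decomposition; not dividing by them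
  keeps the entries polynomial in those of \<open>h\<close>.
\<close>

definition column_elim :: "nat \<Rightarrow> complex mat \<Rightarrow> complex mat" where
  "column_elim n h = mat n n (\<lambda>(k, j). if k \<le> j then adj_mat (leading_block (Suc j) h) $$ (k, j) else 0)"

lemma leading_block_carrier: "leading_block q h \<in> carrier_mat q q"
  by (simp add: leading_block_def)

lemma column_elim_carrier: "column_elim n h \<in> carrier_mat n n"
  by (simp add: column_elim_def)

lemma column_elim_upper: "triangular_wrt (\<lambda>i. - int i) n (column_elim n h)"
  by (auto simp: triangular_wrt_def column_elim_def split: if_splits)

lemma mult_column_elim:
  assumes h: "h \<in> carrier_mat n n" and ij: "i \<le> j" "j < n"
  shows "(h * column_elim n h) $$ (i, j) = (if i = j then det (leading_block (Suc j) h) else 0)"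
proof -
  let ?H = "leading_block (Suc j) h"
  have adj: "adj_mat ?H \<in> carrier_mat (Suc j) (Suc j)" "?H * adj_mat ?H = det ?H \<cdot>\<^sub>m 1\<^sub>m (Suc j)"
    using adj_mat[OF leading_block_carrier] by auto
  have "(h * column_elim n h) $$ (i, j) = (\<Sum>k<n. h $$ (i, k) * column_elim n h $$ (k, j))"
    using ij by (intro mat_mult_entry h column_elim_carrier) auto
  also have "\<dots> = (\<Sum>k<Suc j. h $$ (i, k) * column_elim n h $$ (k, j))"
    using ij by (intro sum.mono_neutral_right) (auto simp: column_elim_def)
  also have "\<dots> = (\<Sum>k<Suc j. ?H $$ (i, k) * adj_mat ?H $$ (k, j))"
    using ij by (intro sum.cong) (auto simp: column_elim_def leading_block_def)
  also have "\<dots> = (?H * adj_mat ?H) $$ (i, j)"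
    using ij by (intro mat_mult_entry[symmetric] leading_block_carrier adj) auto
  finally show ?thesis using adj(2) ij by simp
qed

lemma mult_column_elim_lower:
  assumes "h \<in> carrier_mat n n"
  shows "triangular_wrt int n (h * column_elim n h)"
  unfolding triangular_wrt_def
proof (intro allI impI)
  fix i j assume "i < n" "j < n" "(h * column_elim n h) $$ (i, j) \<noteq> 0"
  then show "int j \<le> int i" using mult_column_elim[OF assms, of i j] by (cases "i < j") auto
qed

lemma column_elim_GL:
  assumes h: "h \<in> carrier_mat n n" and nz: "\<And>j. j < n \<Longrightarrow> det (leading_block (Suc j) h) \<noteq> 0"
  shows "column_elim n h \<in> borel_upper n" "h * column_elim n h \<in> borel_lower n"
proof -
  have car: "h * column_elim n h \<in> carrier_mat n n"
    by (rule mult_carrier_square[OF h column_elim_carrier])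
  have "det (h * column_elim n h) = (\<Prod>s<n. (h * column_elim n h) $$ (s, s))"
    using mult_column_elim_lower[OF h] by (intro det_triangular_order[OF car inj_int]) (auto simp: triangular_wrt_def)
  also have "\<dots> \<noteq> 0" using nz mult_column_elim[OF h] by auto
  finally have G: "h * column_elim n h \<in> carrier (GL n)" using car by (simp add: carrier_GL_iff)
  then have "column_elim n h \<in> carrier (GL n)" using GL_mult_cancel(2)[OF h column_elim_carrier] by blast
  then show "column_elim n h \<in> borel_upper n" "h * column_elim n h \<in> borel_lower n"
    using G column_elim_upper mult_column_elim_lower[OF h] by (auto simp: borel_upper_iff borel_lower_iff)
qed

definition lower_unipotent :: "nat \<Rightarrow> complex mat \<Rightarrow> bool" where
  "lower_unipotent n h \<longleftrightarrow> h \<in> carrier_mat n n \<and> triangular_wrt int n h \<and> (\<forall>i<n. h $$ (i, i) = 1)"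

text \<open>
  Column \<open>j\<close> of the leading block \<open>H\<close> is a unit vector, so the last column of the adjugate of \<open>H\<close> is that of
  the product of the adjugate with \<open>H\<close>.
\<close>

lemma column_elim_unipotent:
  assumes h: "lower_unipotent n h"
  shows "column_elim n h = 1\<^sub>m n"
proof (rule eq_matI)
  fix k j assume "k < dim_row (1\<^sub>m n)" "j < dim_col (1\<^sub>m n :: complex mat)"
  then have kj: "k < n" "j < n" by auto
  have tri: "h $$ (s, t) = 0" if "s < t" "t < n" for s t
    using h triangular_wrtD[of int n h s t] that by (auto simp: lower_unipotent_def)
  have one: "h $$ (s, s) = 1" if "s < n" for s using h that by (auto simp: lower_unipotent_def)
  let ?H = "leading_block (Suc j) h"
  have adj: "adj_mat ?H \<in> carrier_mat (Suc j) (Suc j)" "adj_mat ?H * ?H = det ?H \<cdot>\<^sub>m 1\<^sub>m (Suc j)"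
    using adj_mat[OF leading_block_carrier] by auto
  have "det ?H = (\<Prod>s<Suc j. ?H $$ (s, s))"
    by (rule det_triangular_order[OF leading_block_carrier inj_int])
      (use tri kj in \<open>force simp: leading_block_def not_le[symmetric]\<close>)
  then have det: "det ?H = 1" using one kj by (simp add: leading_block_def)
  have "adj_mat ?H $$ (k, j) = (1\<^sub>m n) $$ (k, j)" if "k \<le> j"
  proof -
    have "(adj_mat ?H * ?H) $$ (k, j) = (\<Sum>s<Suc j. adj_mat ?H $$ (k, s) * ?H $$ (s, j))"
      using that by (intro mat_mult_entry adj leading_block_carrier) auto
    also have "\<dots> = (\<Sum>s\<in>{j}. adj_mat ?H $$ (k, s) * ?H $$ (s, j))"
      using tri kj by (intro sum.mono_neutral_right) (auto simp: leading_block_def)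
    also have "\<dots> = adj_mat ?H $$ (k, j)" using one kj by (simp add: leading_block_def)
    finally show ?thesis using adj(2) det that kj by simp
  qed
  then show "column_elim n h $$ (k, j) = (1\<^sub>m n) $$ (k, j)" using kj by (auto simp: column_elim_def)
qed (auto simp: column_elim_def)

lemma matrix_over_column_elim:
  assumes R: "function_ring R" and F: "matrix_over R n F"
  shows "matrix_over R n (\<lambda>x. column_elim n (F x))"
  unfolding column_elim_def
proof (rule matrix_over_mat)
  fix k j assume kj: "k < n" "j < n"
  have "(\<lambda>x. adj_mat (leading_block (Suc j) (F x)) $$ (k, j)) \<in> R" if "k \<le> j"
    using F kj that
    by (intro function_ring_adj[OF R, of _ "Suc j"] leading_block_carrier) (auto simp: leading_block_def matrix_over_def)
  then show "(\<lambda>x. if k \<le> j then adj_mat (leading_block (Suc j) (F x)) $$ (k, j) else 0) \<in> R"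
    by (cases "k \<le> j") (simp_all add: function_ring_const[OF R])
qed

text \<open>
  The reflection in the anti-diagonal reverses products and preserves both upper and lower triangular
  matrices. It turns column operations into row operations.
\<close>

definition anti_transpose :: "nat \<Rightarrow> complex mat \<Rightarrow> complex mat" where
  "anti_transpose n m = mat n n (\<lambda>(i, j). m $$ (n - 1 - j, n - 1 - i))"

lemma anti_transpose_carrier: "anti_transpose n m \<in> carrier_mat n n"
  by (simp add: anti_transpose_def)

lemma anti_transpose_mult:
  assumes "a \<in> carrier_mat n n" "b \<in> carrier_mat n n"
  shows "anti_transpose n (a * b) = anti_transpose n b * anti_transpose n a"
proof (rule eq_matI)
  fix i j assume "i < dim_row (anti_transpose n b * anti_transpose n a)" "j < dim_col (anti_transpose n b * anti_transpose n a)"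
  then have ij: "i < n" "j < n" by (auto simp: anti_transpose_def)
  have "anti_transpose n (a * b) $$ (i, j) = (\<Sum>k<n. a $$ (n - 1 - j, k) * b $$ (k, n - 1 - i))"
    using ij mat_mult_entry[OF assms, of "n - 1 - j" "n - 1 - i"] by (simp add: anti_transpose_def)
  also have "\<dots> = (\<Sum>k<n. a $$ (n - 1 - j, n - 1 - k) * b $$ (n - 1 - k, n - 1 - i))"
    by (rule sum.reindex_bij_witness[where i = "\<lambda>k. n - 1 - k" and j = "\<lambda>k. n - 1 - k"]) auto
  also have "\<dots> = (\<Sum>k<n. anti_transpose n b $$ (i, k) * anti_transpose n a $$ (k, j))"
    using ij by (intro sum.cong) (auto simp: anti_transpose_def)
  also have "\<dots> = (anti_transpose n b * anti_transpose n a) $$ (i, j)"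
    using ij by (intro mat_mult_entry[symmetric] anti_transpose_carrier)
  finally show "anti_transpose n (a * b) $$ (i, j) = (anti_transpose n b * anti_transpose n a) $$ (i, j)" .
qed (auto simp: anti_transpose_def)

lemma anti_transpose_anti_transpose: "m \<in> carrier_mat n n \<Longrightarrow> anti_transpose n (anti_transpose n m) = m"
  by (intro eq_matI) (auto simp: anti_transpose_def)

lemma anti_transpose_one: "anti_transpose n (1\<^sub>m n) = 1\<^sub>m n"
  by (intro eq_matI) (auto simp: anti_transpose_def)

lemma anti_transpose_triangular:
  assumes "triangular_wrt \<tau> n m"
  shows "triangular_wrt (\<lambda>i. - \<tau> (n - 1 - i)) n (anti_transpose n m)"
  using assms by (auto simp: triangular_wrt_def anti_transpose_def)

lemma anti_transpose_lower:
  assumes "triangular_wrt int n m"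
  shows "triangular_wrt int n (anti_transpose n m)"
  unfolding triangular_wrt_def
proof (intro allI impI)
  fix i j assume ij: "i < n" "j < n" "anti_transpose n m $$ (i, j) \<noteq> 0"
  then have "- int (n - 1 - j) \<le> - int (n - 1 - i)"
    using anti_transpose_triangular[OF assms] unfolding triangular_wrt_def by blast
  then show "int j \<le> int i" using ij by linarith
qed

lemma anti_transpose_upper:
  assumes "triangular_wrt (\<lambda>i. - int i) n m"
  shows "triangular_wrt (\<lambda>i. - int i) n (anti_transpose n m)"
  unfolding triangular_wrt_def
proof (intro allI impI)
  fix i j assume ij: "i < n" "j < n" "anti_transpose n m $$ (i, j) \<noteq> 0"
  then have "- (- int (n - 1 - j)) \<le> - (- int (n - 1 - i))"
    using anti_transpose_triangular[OF assms] unfolding triangular_wrt_def by blast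
  then show "- int j \<le> - int i" using ij by linarith
qed

definition row_elim :: "nat \<Rightarrow> complex mat \<Rightarrow> complex mat" where
  "row_elim n m = anti_transpose n (column_elim n (anti_transpose n m))"

lemma row_elim_carrier: "row_elim n m \<in> carrier_mat n n"
  by (simp add: row_elim_def anti_transpose_carrier)

lemma row_elim_upper: "triangular_wrt (\<lambda>i. - int i) n (row_elim n m)"
  unfolding row_elim_def by (intro anti_transpose_upper column_elim_upper)

lemma row_elim_mult_lower:
  assumes "m \<in> carrier_mat n n"
  shows "triangular_wrt int n (row_elim n m * m)"
proof -
  have "row_elim n m * m = anti_transpose n (anti_transpose n m * column_elim n (anti_transpose n m))"
    using anti_transpose_mult[OF anti_transpose_carrier column_elim_carrier] anti_transpose_anti_transpose[OF assms]
    by (simp add: row_elim_def)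
  then show ?thesis
    using anti_transpose_lower[OF mult_column_elim_lower[OF anti_transpose_carrier]] by simp
qed

lemma row_elim_GL:
  assumes m: "m \<in> carrier (GL n)" "triangular_wrt \<tau> n m" "inj_on \<tau> {..<n}"
  shows "row_elim n m \<in> borel_upper n" "row_elim n m * m \<in> borel_lower n"
proof -
  have mc: "m \<in> carrier_mat n n" using m(1) by (rule GL_carrier_mat)
  let ?f = "anti_transpose n m" and ?\<kappa> = "\<lambda>i. - \<tau> (n - 1 - i)"
  have tri: "triangular_wrt ?\<kappa> n ?f" by (rule anti_transpose_triangular[OF m(2)])
  have inj: "inj_on ?\<kappa> {..<n}"
  proof (rule inj_onI)
    fix x y assume xy: "x \<in> {..<n}" "y \<in> {..<n}" "- \<tau> (n - 1 - x) = - \<tau> (n - 1 - y)"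
    then have "n - 1 - x = n - 1 - y" using m(3) by (intro inj_onD[OF m(3)]) auto
    then show "x = y" using xy(1,2) by auto
  qed
  have "det (leading_block (Suc j) ?f) \<noteq> 0" if j: "j < n" for j
  proof -
    have "det (leading_block (Suc j) ?f) = (\<Prod>s<Suc j. leading_block (Suc j) ?f $$ (s, s))"
    proof (rule det_triangular_order[OF leading_block_carrier])
      show "inj_on ?\<kappa> {..<Suc j}" using inj j by (auto intro: inj_on_subset)
      show "?\<kappa> t \<le> ?\<kappa> s" if "s < Suc j" "t < Suc j" "leading_block (Suc j) ?f $$ (s, t) \<noteq> 0" for s t
        using tri that j by (simp add: triangular_wrt_def leading_block_def)
    qed
    also have "\<dots> \<noteq> 0"
      using j triangular_wrt_diag_nonzero[OF m(2,3,1)] by (auto simp: leading_block_def anti_transpose_def)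
    finally show ?thesis .
  qed
  then have c: "column_elim n ?f \<in> borel_upper n" "?f * column_elim n ?f \<in> borel_lower n"
    using column_elim_GL[OF anti_transpose_carrier] by auto
  obtain d where d: "d \<in> borel_upper n" "column_elim n ?f * d = 1\<^sub>m n" "d * column_elim n ?f = 1\<^sub>m n"
    using borel_upper_inverse[OF c(1)] by blast
  have "anti_transpose n d * row_elim n m = 1\<^sub>m n"
    using anti_transpose_mult[OF column_elim_carrier, of d n ?f] d GL_carrier_mat[OF borel_upper_GL[OF d(1)]] anti_transpose_one
    by (simp add: row_elim_def)
  then have "row_elim n m \<in> carrier (GL n)"
    using GL_mult_cancel(2)[OF anti_transpose_carrier row_elim_carrier] one_in_GL by metis
  then show "row_elim n m \<in> borel_upper n" "row_elim n m * m \<in> borel_lower n"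
    using row_elim_upper row_elim_mult_lower[OF mc] m(1) GL_mult_closed
    by (auto simp: borel_upper_iff borel_lower_iff)
qed

lemma row_elim_unipotent:
  assumes "lower_unipotent n m"
  shows "row_elim n m = 1\<^sub>m n"
proof -
  have "lower_unipotent n (anti_transpose n m)"
    using assms anti_transpose_lower
    by (auto simp: lower_unipotent_def anti_transpose_carrier) (auto simp: anti_transpose_def)
  then show ?thesis by (simp add: row_elim_def column_elim_unipotent anti_transpose_one)
qed

lemma matrix_over_anti_transpose:
  assumes "matrix_over R n F"
  shows "matrix_over R n (\<lambda>x. anti_transpose n (F x))"
  unfolding anti_transpose_def using assms by (intro matrix_over_mat) (auto simp: matrix_over_def)

lemma matrix_over_row_elim:
  assumes "function_ring R" "matrix_over R n F"
  shows "matrix_over R n (\<lambda>x. row_elim n (F x))"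
  unfolding row_elim_def by (intro matrix_over_anti_transpose matrix_over_column_elim assms)

section \<open>Cells\<close>

text \<open>
  The cells and their closures are studied upstairs in the general linear group, as double cosets that
  lie over the cells of the flag variety.
\<close>

definition opp_cell :: "nat \<Rightarrow> (nat \<Rightarrow> nat) \<Rightarrow> complex mat set" where
  "opp_cell n v = {b * perm_matrix n v * c | b c. b \<in> borel_lower n \<and> c \<in> borel_upper n}"

definition cell :: "nat \<Rightarrow> (nat \<Rightarrow> nat) \<Rightarrow> complex mat set" where
  "cell n w = {b * perm_matrix n w * c | b c. b \<in> borel_upper n \<and> c \<in> borel_upper n}"

text \<open>
  This is the open set \<open>v B\<^sub>- B\<close>, by the characterisation of matrices with an LU decomposition.
\<close>

definition chart :: "nat \<Rightarrow> (nat \<Rightarrow> nat) \<Rightarrow> complex mat set" where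
  "chart n v = {g \<in> carrier (GL n). \<forall>q\<le>n. minor q v g \<noteq> 0}"

lemma permutes_less: "v permutes {..<n} \<Longrightarrow> s < n \<Longrightarrow> v s < (n :: nat)"
  using permutes_in_image[of v "{..<n}" s] by simp

lemma borel_carrier: "b \<in> borel_upper n \<Longrightarrow> b \<in> carrier_mat n n" "b \<in> borel_lower n \<Longrightarrow> b \<in> carrier_mat n n"
  by (simp_all add: GL_carrier_mat borel_upper_GL borel_lower_GL)

lemma opp_cell_GL: "v permutes {..<n} \<Longrightarrow> opp_cell n v \<subseteq> carrier (GL n)"
  by (auto simp: opp_cell_def GL_mult_closed perm_matrix_GL borel_lower_GL borel_upper_GL)

lemma cell_GL: "v permutes {..<n} \<Longrightarrow> cell n v \<subseteq> carrier (GL n)"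
  by (auto simp: cell_def GL_mult_closed perm_matrix_GL borel_upper_GL)

lemma opp_cell_mult:
  assumes "g \<in> opp_cell n v" "b \<in> borel_lower n" "c \<in> borel_upper n"
  shows "b * g * c \<in> opp_cell n v"
proof -
  obtain b' c' where g: "g = b' * perm_matrix n v * c'" "b' \<in> borel_lower n" "c' \<in> borel_upper n"
    using assms(1) unfolding opp_cell_def by blast
  have "b * g * c = (b * b') * perm_matrix n v * (c' * c)"
    unfolding g(1) using assms(2,3) g(2,3)
    by (simp add: mat_assoc[of _ n] mult_carrier_square[of _ n] perm_matrix_carrier borel_carrier)
  then show ?thesis
    using borel_lower_mult[OF assms(2) g(2)] borel_upper_mult[OF g(3) assms(3)] unfolding opp_cell_def by blast
qed

lemma cell_mult:
  assumes "g \<in> cell n v" "b \<in> borel_upper n" "c \<in> borel_upper n"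
  shows "b * g * c \<in> cell n v"
proof -
  obtain b' c' where g: "g = b' * perm_matrix n v * c'" "b' \<in> borel_upper n" "c' \<in> borel_upper n"
    using assms(1) unfolding cell_def by blast
  have "b * g * c = (b * b') * perm_matrix n v * (c' * c)"
    unfolding g(1) using assms(2,3) g(2,3)
    by (simp add: mat_assoc[of _ n] mult_carrier_square[of _ n] perm_matrix_carrier borel_carrier)
  then show ?thesis
    using borel_upper_mult[OF assms(2) g(2)] borel_upper_mult[OF g(3) assms(3)] unfolding cell_def by blast
qed

lemma perm_matrix_in_opp_cell: "perm_matrix n v \<in> opp_cell n v"
  and perm_matrix_in_cell: "perm_matrix n v \<in> cell n v"
proof -
  have "perm_matrix n v = 1\<^sub>m n * perm_matrix n v * 1\<^sub>m n"
    using left_mult_one_mat[OF perm_matrix_carrier] right_mult_one_mat[OF perm_matrix_carrier] by metis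
  then show "perm_matrix n v \<in> opp_cell n v" "perm_matrix n v \<in> cell n v"
    unfolding opp_cell_def cell_def using one_in_borel_upper one_in_borel_lower by blast+
qed

lemma opp_cell_subset_chart:
  assumes "v permutes {..<n}"
  shows "opp_cell n v \<subseteq> chart n v"
proof
  fix g assume g: "g \<in> opp_cell n v"
  then obtain b c where bc: "g = b * perm_matrix n v * c" "b \<in> borel_lower n" "c \<in> borel_upper n"
    unfolding opp_cell_def by blast
  have "minor q v g \<noteq> 0" if "q \<le> n" for q
  proof -
    have "minor q v g \<noteq> 0 \<longleftrightarrow> minor q v (b * perm_matrix n v) \<noteq> 0"
      unfolding bc(1) using that permutes_less[OF assms]
      by (intro minor_mult_upper[OF bc(3)] mult_carrier_square borel_carrier(2)[OF bc(2)] perm_matrix_carrier) auto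
    then show ?thesis using minor_opposite_cell_nonzero[OF bc(2) assms that] by simp
  qed
  then show "g \<in> chart n v" using g opp_cell_GL[OF assms] unfolding chart_def by auto
qed

lemma openin_chart:
  assumes "v permutes {..<n}"
  shows "openin (zariski_GL n) (chart n v)"
proof -
  have "minor q v \<in> polynomial_functions n" if "q \<le> n" for q
    using that permutes_less[OF assms] by (intro minor_polynomial) auto
  then have "(\<lambda>g. \<Prod>q\<in>{..n}. minor q v g) \<in> polynomial_functions n"
    by (intro function_ring_prod[OF function_ring_polynomial_functions]) auto
  then have "openin (zariski_GL n) {g \<in> carrier (GL n). (\<Prod>q\<in>{..n}. minor q v g) \<noteq> 0}"
    by (rule openin_zariski_GL_nonzero)
  moreover have "chart n v = {g \<in> carrier (GL n). (\<Prod>q\<in>{..n}. minor q v g) \<noteq> 0}"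
    unfolding chart_def by auto
  ultimately show ?thesis by simp
qed

lemma chart_mult:
  assumes "v permutes {..<n}" "g \<in> chart n v" "c \<in> borel_upper n"
  shows "g * c \<in> chart n v"
proof -
  have g: "g \<in> carrier (GL n)" using assms(2) by (simp add: chart_def)
  have "minor q v (g * c) \<noteq> 0" if "q \<le> n" for q
    using minor_mult_upper[OF assms(3) GL_carrier_mat[OF g] that, of v] permutes_less[OF assms(1)] assms(2) that
    by (auto simp: chart_def)
  then show ?thesis using GL_mult_closed[OF g borel_upper_GL[OF assms(3)]] by (simp add: chart_def)
qed

lemma opp_cell_minor:
  assumes "g \<in> opp_cell n v" "v permutes {..<n}" "q \<le> n" "\<And>s. s < q \<Longrightarrow> I s < n" "minor q I g \<noteq> 0"
  shows "\<exists>\<sigma>. \<sigma> permutes {..<q} \<and> (\<forall>s<q. v (\<sigma> s) \<le> I s)"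
proof -
  obtain b c where bc: "g = b * perm_matrix n v * c" "b \<in> borel_lower n" "c \<in> borel_upper n"
    using assms(1) unfolding opp_cell_def by blast
  have b: "b \<in> carrier_mat n n" "triangular_wrt int n b" using bc(2) borel_carrier(2) by (auto simp: borel_lower_iff)
  have "minor q I (b * perm_matrix n v) \<noteq> 0"
    using assms(5) minor_mult_upper[OF bc(3) mult_carrier_square[OF b(1) perm_matrix_carrier] assms(3,4)]
    unfolding bc(1) by simp
  then obtain \<sigma> where "\<sigma> permutes {..<q}" "\<And>s. s < q \<Longrightarrow> int (v (\<sigma> s)) \<le> int (I s)"
    using minor_nonzero_matching[where I = I, OF b assms(2,3,4)] by blast
  then show ?thesis by auto
qed

lemma cell_minor:
  assumes "g \<in> cell n v" "v permutes {..<n}" "q \<le> n" "\<And>s. s < q \<Longrightarrow> I s < n" "minor q I g \<noteq> 0"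
  shows "\<exists>\<sigma>. \<sigma> permutes {..<q} \<and> (\<forall>s<q. I s \<le> v (\<sigma> s))"
proof -
  obtain b c where bc: "g = b * perm_matrix n v * c" "b \<in> borel_upper n" "c \<in> borel_upper n"
    using assms(1) unfolding cell_def by blast
  have b: "b \<in> carrier_mat n n" "triangular_wrt (\<lambda>i. - int i) n b" using bc(2) borel_carrier(1) by (auto simp: borel_upper_iff)
  have "minor q I (b * perm_matrix n v) \<noteq> 0"
    using assms(5) minor_mult_upper[OF bc(3) mult_carrier_square[OF b(1) perm_matrix_carrier] assms(3,4)]
    unfolding bc(1) by simp
  then obtain \<sigma> where "\<sigma> permutes {..<q}" "\<And>s. s < q \<Longrightarrow> - int (v (\<sigma> s)) \<le> - int (I s)"
    using minor_nonzero_matching[where I = I, OF b assms(2,3,4)] by blast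
  then show ?thesis by auto
qed

text \<open>
  The minor with rows \<open>u 0, \<dots>, u (q - 1)\<close> does not vanish at \<open>g\<close>, hence not identically on the opposite cell of
  \<open>v\<close>, which gives a matching of the first \<open>q\<close> values of \<open>v\<close> and \<open>u\<close>.
\<close>

lemma closure_opp_cell_rank_le:
  assumes "v permutes {..<n}" "u permutes {..<n}" "g \<in> zariski_GL n closure_of opp_cell n v" "g \<in> opp_cell n u"
  shows "rank_le n v u"
proof (rule rank_leI_matching)
  fix q assume q: "q \<le> n"
  have un: "\<And>s. s < q \<Longrightarrow> u s < n" using permutes_less[OF assms(2)] q by simp
  have "minor q u g \<noteq> 0" using opp_cell_subset_chart[OF assms(2)] assms(4) q by (auto simp: chart_def)
  then obtain h where "h \<in> opp_cell n v" "minor q u h \<noteq> 0"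
    using zero_on_closure[OF minor_polynomial[where I = u, OF q un] opp_cell_GL[OF assms(1)] _ assms(3)] by blast
  then show "\<exists>\<sigma>. \<sigma> permutes {..<q} \<and> (\<forall>s<q. v (\<sigma> s) \<le> u s)"
    using opp_cell_minor[OF _ assms(1) q un] by simp
qed

lemma chart_opp_cell_rank_le:
  assumes "v permutes {..<n}" "u permutes {..<n}" "g \<in> chart n v" "g \<in> opp_cell n u"
  shows "rank_le n u v"
proof (rule rank_leI_matching)
  fix q assume q: "q \<le> n"
  have vn: "\<And>s. s < q \<Longrightarrow> v s < n" using permutes_less[OF assms(1)] q by simp
  have "minor q v g \<noteq> 0" using assms(3) q by (auto simp: chart_def)
  then show "\<exists>\<sigma>. \<sigma> permutes {..<q} \<and> (\<forall>s<q. u (\<sigma> s) \<le> v s)"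
    using opp_cell_minor[OF assms(4,2) q vn] by simp
qed

lemma rank_leI_matching':
  assumes "\<And>q. q \<le> n \<Longrightarrow> \<exists>\<sigma>. \<sigma> permutes {..<q} \<and> (\<forall>s<q. v s \<le> u (\<sigma> s))"
  shows "rank_le n v u"
proof (rule rank_leI_matching)
  fix q assume "q \<le> n"
  then obtain \<sigma> where \<sigma>: "\<sigma> permutes {..<q}" "\<forall>s<q. v s \<le> u (\<sigma> s)" using assms by blast
  have "v (Hilbert_Choice.inv \<sigma> s) \<le> u s" if "s < q" for s
    using \<sigma>(2) permutes_less[OF permutes_inv[OF \<sigma>(1)] that] permutes_inverses(1)[OF \<sigma>(1)] by metis
  then show "\<exists>\<sigma>. \<sigma> permutes {..<q} \<and> (\<forall>s<q. v (\<sigma> s) \<le> u s)"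
    using permutes_inv[OF \<sigma>(1)] by blast
qed

lemma perm_matrix_closure_cell_rank_le:
  assumes "v permutes {..<n}" "w permutes {..<n}" "perm_matrix n v \<in> zariski_GL n closure_of cell n w"
  shows "rank_le n v w"
proof (rule rank_leI_matching')
  fix q assume q: "q \<le> n"
  have vn: "\<And>s. s < q \<Longrightarrow> v s < n" using permutes_less[OF assms(1)] q by simp
  have "perm_matrix n v \<in> chart n v" using opp_cell_subset_chart[OF assms(1)] perm_matrix_in_opp_cell by auto
  then have "minor q v (perm_matrix n v) \<noteq> 0" using q by (auto simp: chart_def)
  then obtain h where "h \<in> cell n w" "minor q v h \<noteq> 0"
    using zero_on_closure[OF minor_polynomial[where I = v, OF q vn] cell_GL[OF assms(2)] _ assms(3)] by blast
  then show "\<exists>\<sigma>. \<sigma> permutes {..<q} \<and> (\<forall>s<q. v s \<le> w (\<sigma> s))"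
    using cell_minor[OF _ assms(2) q vn] by simp
qed

section \<open>The decomposition into opposite cells\<close>

lemma GL_column_nonzero:
  assumes "h \<in> carrier (GL n)" "q < n"
  shows "\<exists>i<n. h $$ (i, q) \<noteq> 0"
proof (rule ccontr)
  assume "\<not> ?thesis"
  then have z: "h $$ (i, q) = 0" if "i < n" for i using that by blast
  obtain d where d: "d \<in> carrier (GL n)" "d * h = 1\<^sub>m n" using GL_inverse[OF assms(1)] by blast
  have "(d * h) $$ (q, q) = (\<Sum>k<n. d $$ (q, k) * h $$ (k, q))"
    by (rule mat_mult_entry[OF GL_carrier_mat[OF d(1)] GL_carrier_mat[OF assms(1)] assms(2,2)])
  also have "\<dots> = 0" using z by simp
  finally show False using d(2) assms(2) by simp
qed

lemma triangular_wrt_GL: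
  assumes "a \<in> carrier_mat n n" "triangular_wrt \<tau> n a" "inj_on \<tau> {..<n}" "\<And>i. i < n \<Longrightarrow> a $$ (i, i) \<noteq> 0"
  shows "a \<in> carrier (GL n)"
proof -
  have "det a = (\<Prod>s<n. a $$ (s, s))"
    using assms(2) by (intro det_triangular_order[OF assms(1,3)]) (auto simp: triangular_wrt_def)
  then show ?thesis using assms(1,4) by (auto simp: carrier_GL_iff)
qed

text \<open>
  One step of the elimination: if the first \<open>q\<close> columns are the unit vectors \<open>x 0, \<dots>, x (q - 1)\<close>, the
  next column can be made a unit vector too. First the rows \<open>x s\<close> are cleared by column operations.
  The pivot \<open>p\<close> is the topmost nonzero entry that remains; the entries below it are cleared by row
  operations downwards, which do not affect the earlier columns since their row \<open>p\<close> is zero.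
\<close>

lemma reduce_column:
  assumes h: "h \<in> carrier (GL n)" and q: "q < n"
    and x: "\<And>t i. t < q \<Longrightarrow> i < n \<Longrightarrow> h $$ (i, t) = (if i = x t then 1 else 0)"
    and xq: "\<And>t. t < q \<Longrightarrow> x t < n" "inj_on x {..<q}"
  obtains b c p where "b \<in> borel_lower n" "c \<in> borel_upper n" "p < n" "p \<notin> x ` {..<q}"
    "\<And>t i. t < q \<Longrightarrow> i < n \<Longrightarrow> (b * h * c) $$ (i, t) = (if i = x t then 1 else 0)"
    "\<And>i. i < n \<Longrightarrow> (b * h * c) $$ (i, q) = (if i = p then 1 else 0)"
proof -
  have hc: "h \<in> carrier_mat n n" using h by (rule GL_carrier_mat)
  define c where "c = mat n n (\<lambda>(s, t). if s = t then 1 else if t = q \<and> s < q then - h $$ (x s, q) else 0)"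
  have c: "c \<in> carrier_mat n n" "triangular_wrt (\<lambda>i. - int i) n c" "\<And>i. i < n \<Longrightarrow> c $$ (i, i) \<noteq> 0"
    unfolding c_def by (auto simp: triangular_wrt_def split: if_splits)
  have cB: "c \<in> borel_upper n"
    using triangular_wrt_GL[OF c(1,2) inj_neg_int c(3)] c(2) by (simp add: borel_upper_iff)
  let ?h = "h * c"
  have hcG: "?h \<in> carrier (GL n)" by (rule GL_mult_closed[OF h borel_upper_GL[OF cB]])
  have left: "?h $$ (i, t) = h $$ (i, t)" if "i < n" "t < q" for i t
  proof -
    have "?h $$ (i, t) = (\<Sum>k<n. h $$ (i, k) * c $$ (k, t))" using that q by (intro mat_mult_entry hc c) auto
    also have "\<dots> = (\<Sum>k\<in>{t}. h $$ (i, k) * c $$ (k, t))"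
      using that q by (intro sum.mono_neutral_right) (auto simp: c_def)
    finally show ?thesis using that q by (simp add: c_def)
  qed
  have zero: "?h $$ (x s, q) = 0" if s: "s < q" for s
  proof -
    have "?h $$ (x s, q) = (\<Sum>k<n. h $$ (x s, k) * c $$ (k, q))" using s q xq by (intro mat_mult_entry hc c) auto
    also have "\<dots> = (\<Sum>k\<in>{s, q}. h $$ (x s, k) * c $$ (k, q))"
    proof (rule sum.mono_neutral_right)
      show "\<forall>k\<in>{..<n} - {s, q}. h $$ (x s, k) * c $$ (k, q) = 0"
      proof
        fix k assume k: "k \<in> {..<n} - {s, q}"
        show "h $$ (x s, k) * c $$ (k, q) = 0"
        proof (cases "k < q")
          case True
          then have "x s \<noteq> x k" using xq(2) s k by (auto simp: inj_on_def)
          then show ?thesis using x[OF True xq(1)[OF s]] by simp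
        qed (use k q in \<open>auto simp: c_def\<close>)
      qed
    qed (use s q in auto)
    also have "\<dots> = 0" using s q x[OF s xq(1)[OF s]] by (simp add: c_def)
    finally show ?thesis .
  qed
  define p where "p = (LEAST i. i < n \<and> ?h $$ (i, q) \<noteq> 0)"
  have p: "p < n" "?h $$ (p, q) \<noteq> 0"
    using LeastI_ex[OF GL_column_nonzero[OF hcG q]] unfolding p_def by auto
  have pmin: "?h $$ (i, q) = 0" if "i < p" for i
    using not_less_Least[of i "\<lambda>i. i < n \<and> ?h $$ (i, q) \<noteq> 0"] that p(1) unfolding p_def by auto
  have px: "p \<notin> x ` {..<q}" using p(2) zero by auto
  define b where "b = mat n n (\<lambda>(i, k). if i = k then (if i = p then 1 / ?h $$ (p, q) else 1)
    else if k = p \<and> p < i then - ?h $$ (i, q) / ?h $$ (p, q) else 0)"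
  have b: "b \<in> carrier_mat n n" "triangular_wrt int n b" "\<And>i. i < n \<Longrightarrow> b $$ (i, i) \<noteq> 0"
    unfolding b_def using p(2) by (auto simp: triangular_wrt_def split: if_splits)
  have bB: "b \<in> borel_lower n"
    using triangular_wrt_GL[OF b(1,2) inj_int b(3)] b(2) by (simp add: borel_lower_iff)
  have assoc: "b * h * c = b * ?h" by (rule mat_assoc[OF b(1) hc c(1)])
  have entry: "(b * ?h) $$ (i, t) = (if i = p then ?h $$ (p, t) / ?h $$ (p, q)
      else if p < i then ?h $$ (i, t) - ?h $$ (i, q) / ?h $$ (p, q) * ?h $$ (p, t) else ?h $$ (i, t))"
    if "i < n" "t < n" for i t
  proof -
    have "(b * ?h) $$ (i, t) = (\<Sum>k<n. b $$ (i, k) * ?h $$ (k, t))"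
      using that by (intro mat_mult_entry b GL_carrier_mat[OF hcG])
    also have "\<dots> = (\<Sum>k\<in>{i, p}. b $$ (i, k) * ?h $$ (k, t))"
      using that p(1) by (intro sum.mono_neutral_right) (auto simp: b_def)
    finally show ?thesis using that p(1) by (cases "i = p") (simp_all add: b_def)
  qed
  show thesis
  proof (rule that[OF bB cB p(1) px])
    fix t i assume ti: "t < q" "i < n"
    have "p \<noteq> x t" using px ti(1) by auto
    then have "?h $$ (p, t) = 0" using left[OF p(1) ti(1)] x[OF ti(1) p(1)] by simp
    then show "(b * h * c) $$ (i, t) = (if i = x t then 1 else 0)"
      unfolding assoc using entry[OF ti(2), of t] left[OF ti(2,1)] x[OF ti] ti q \<open>p \<noteq> x t\<close> by auto
  next
    fix i assume i: "i < n"
    show "(b * h * c) $$ (i, q) = (if i = p then 1 else 0)"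
      unfolding assoc using entry[OF i q] p(2) pmin[of i] by (auto simp: not_less)
  qed
qed

lemma opposite_bruhat_decomposition:
  assumes g: "g \<in> carrier (GL n)"
  obtains u where "u permutes {..<n}" "g \<in> opp_cell n u"
proof -
  have step: "\<exists>b c x. b \<in> borel_lower n \<and> c \<in> borel_upper n \<and> (\<forall>t<q. x t < n) \<and> inj_on x {..<q} \<and>
    (\<forall>t<q. \<forall>i<n. (b * g * c) $$ (i, t) = (if i = x t then 1 else 0))" if "q \<le> n" for q
    using that
  proof (induction q)
    case 0
    then show ?case using one_in_borel_lower one_in_borel_upper by auto
  next
    case (Suc q)
    then obtain b c x where IH: "b \<in> borel_lower n" "c \<in> borel_upper n" "\<forall>t<q. x t < n" "inj_on x {..<q}"
      "\<forall>t<q. \<forall>i<n. (b * g * c) $$ (i, t) = (if i = x t then 1 else 0)"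
      by auto
    have G: "b * g * c \<in> carrier (GL n)"
      using IH(1,2) g by (simp add: GL_mult_closed borel_lower_GL borel_upper_GL)
    have cols: "(b * g * c) $$ (i, t) = (if i = x t then 1 else 0)" if "t < q" "i < n" for t i
      using IH(5) that by blast
    have bound: "x t < n" if "t < q" for t using IH(3) that by blast
    obtain b' c' p where new: "b' \<in> borel_lower n" "c' \<in> borel_upper n" "p < n" "p \<notin> x ` {..<q}"
      "\<And>t i. t < q \<Longrightarrow> i < n \<Longrightarrow> (b' * (b * g * c) * c') $$ (i, t) = (if i = x t then 1 else 0)"
      "\<And>i. i < n \<Longrightarrow> (b' * (b * g * c) * c') $$ (i, q) = (if i = p then 1 else 0)"
      using reduce_column[where x = x, OF G _ cols bound IH(4)] Suc.prems by (metis Suc_le_lessD)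
    have eq: "b' * (b * g * c) * c' = (b' * b) * g * (c * c')"
      using IH(1,2) new(1,2) GL_carrier_mat[OF g]
      by (simp add: mat_assoc[of _ n] mult_carrier_square[of _ n] borel_carrier)
    have "inj_on (x(q := p)) {..<Suc q}"
      using IH(4) new(4) by (auto simp: lessThan_Suc inj_on_def)
    moreover have "\<forall>t<Suc q. (x(q := p)) t < n" using IH(3) new(3) by (auto simp: less_Suc_eq)
    moreover have "\<forall>t<Suc q. \<forall>i<n. ((b' * b) * g * (c * c')) $$ (i, t) = (if i = (x(q := p)) t then 1 else 0)"
      using new(5,6) unfolding eq by (auto simp: less_Suc_eq)
    ultimately show ?case
      using borel_lower_mult[OF new(1) IH(1)] borel_upper_mult[OF IH(2) new(2)] by blast
  qed
  obtain b c x where bc: "b \<in> borel_lower n" "c \<in> borel_upper n" and x: "\<forall>t<n. x t < n" "inj_on x {..<n}"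
    "\<forall>t<n. \<forall>i<n. (b * g * c) $$ (i, t) = (if i = x t then 1 else 0)"
    using step[OF order_refl] by blast
  define u where "u i = (if i < n then x i else i)" for i
  have "bij_betw x {..<n} {..<n}"
    using x(1,2) by (intro bij_betw_imageI endo_inj_surj) auto
  then have "bij_betw u {..<n} {..<n}" by (rule bij_betw_cong[THEN iffD1, rotated]) (simp add: u_def)
  then have u: "u permutes {..<n}" by (rule bij_imp_permutes) (simp add: u_def)
  have carr: "b * g * c \<in> carrier_mat n n"
    using bc GL_carrier_mat[OF g] by (simp add: mult_carrier_square[of _ n] borel_carrier)
  have P: "b * g * c = perm_matrix n u"
    using x(3) carr by (intro eq_matI) (auto simp: perm_matrix_def u_def)
  obtain b' where b': "b' \<in> borel_lower n" "b' * b = 1\<^sub>m n" using borel_lower_inverse[OF bc(1)] by blast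
  obtain c' where c': "c' \<in> borel_upper n" "c * c' = 1\<^sub>m n" using borel_upper_inverse[OF bc(2)] by blast
  have "b' * (b * g * c) * c' = (b' * b) * g * (c * c')"
    using bc b'(1) c'(1) GL_carrier_mat[OF g]
    by (simp add: mat_assoc[of _ n] mult_carrier_square[of _ n] borel_carrier)
  also have "\<dots> = g" using b'(2) c'(2) GL_carrier_mat[OF g] by simp
  finally have "g = b' * perm_matrix n u * c'" unfolding P by simp
  then have "g \<in> opp_cell n u" using b'(1) c'(1) unfolding opp_cell_def by blast
  then show thesis using that u by blast
qed

text \<open>
  A point of the left hand side lies in some opposite cell, whose permutation is above \<open>v\<close> as the point
  is in the closure, and below \<open>v\<close> as the point is in the chart.
\<close>

lemma closure_opp_cell_Int_chart:
  assumes "v permutes {..<n}"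
  shows "zariski_GL n closure_of opp_cell n v \<inter> chart n v = opp_cell n v"
proof (intro equalityI subsetI)
  fix g assume g: "g \<in> zariski_GL n closure_of opp_cell n v \<inter> chart n v"
  then have "g \<in> carrier (GL n)" by (auto simp: chart_def)
  then obtain u where u: "u permutes {..<n}" "g \<in> opp_cell n u" by (rule opposite_bruhat_decomposition)
  have "v = u"
    using closure_opp_cell_rank_le[OF assms u(1) _ u(2)] chart_opp_cell_rank_le[OF assms u(1) _ u(2)] g
    by (intro rank_le_antisym[OF assms u(1)]) auto
  then show "g \<in> opp_cell n v" using u(2) by simp
next
  fix g assume "g \<in> opp_cell n v"
  then show "g \<in> zariski_GL n closure_of opp_cell n v \<inter> chart n v"
    using closure_of_subset[of "opp_cell n v" "zariski_GL n"] opp_cell_GL[OF assms] opp_cell_subset_chart[OF assms]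
    by (auto simp: topspace_zariski_GL)
qed

section \<open>Closures of cells and transvections\<close>

abbreviation cell_closure :: "nat \<Rightarrow> (nat \<Rightarrow> nat) \<Rightarrow> complex mat set" where
  "cell_closure n w \<equiv> zariski_GL n closure_of cell n w"

lemma cell_closure_GL: "cell_closure n w \<subseteq> carrier (GL n)"
  using closure_of_subset_topspace[of "zariski_GL n"] by (simp add: topspace_zariski_GL)

lemma cell_subset_closure: "w permutes {..<n} \<Longrightarrow> cell n w \<subseteq> cell_closure n w"
  using closure_of_subset[of "cell n w" "zariski_GL n"] cell_GL[of w n] by (simp add: topspace_zariski_GL)

lemma closure_translation:
  assumes "a \<in> carrier (GL n)" "c \<in> carrier (GL n)" "\<And>g. g \<in> S \<Longrightarrow> a * g * c \<in> S'"
    and "g \<in> zariski_GL n closure_of S"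
  shows "a * g * c \<in> zariski_GL n closure_of S'"
proof -
  have "(\<lambda>g. a * g * c) ` (zariski_GL n closure_of S) \<subseteq> zariski_GL n closure_of ((\<lambda>g. a * g * c) ` S)"
    using continuous_map_image_closure_subset[OF continuous_map_translations[OF assms(1,2)]] .
  also have "\<dots> \<subseteq> zariski_GL n closure_of S'" using assms(3) by (intro closure_of_mono) auto
  finally show ?thesis using assms(4) by auto
qed

lemma cell_closure_mult:
  assumes "g \<in> cell_closure n w" "b \<in> borel_upper n" "c \<in> borel_upper n"
  shows "b * g * c \<in> cell_closure n w"
  using assms(2,3) by (intro closure_translation[OF _ _ _ assms(1)] cell_mult borel_upper_GL)

definition transvection :: "nat \<Rightarrow> nat \<Rightarrow> nat \<Rightarrow> complex \<Rightarrow> complex mat" where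
  "transvection n i j t = mat n n (\<lambda>(k, l). if k = l then 1 else if k = i \<and> l = j then t else 0)"

lemma transvection_carrier: "transvection n i j t \<in> carrier_mat n n"
  by (simp add: transvection_def)

lemma transvection_zero: "transvection n i j 0 = 1\<^sub>m n"
  by (rule eq_matI) (auto simp: transvection_def)

lemma transvection_mult_entry:
  assumes "A \<in> carrier_mat n n" "i < n" "j < n" "i \<noteq> j" "k < n" "l < n"
  shows "(transvection n i j t * A) $$ (k, l) = A $$ (k, l) + (if k = i then t * A $$ (j, l) else 0)"
proof -
  have "(transvection n i j t * A) $$ (k, l) = (\<Sum>m<n. transvection n i j t $$ (k, m) * A $$ (m, l))"
    by (rule mat_mult_entry[OF transvection_carrier assms(1,5,6)])
  also have "\<dots> = (\<Sum>m\<in>{k, j}. transvection n i j t $$ (k, m) * A $$ (m, l))"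
    using assms by (intro sum.mono_neutral_right) (auto simp: transvection_def)
  also have "\<dots> = A $$ (k, l) + (if k = i then t * A $$ (j, l) else 0)"
    using assms by (cases "k = j") (simp_all add: transvection_def)
  finally show ?thesis .
qed

lemma transvection_inverse:
  assumes "i < n" "j < n" "i \<noteq> j"
  shows "transvection n i j t * transvection n i j (- t) = 1\<^sub>m n"
proof (rule eq_matI)
  fix k l assume "k < dim_row (1\<^sub>m n)" "l < dim_col (1\<^sub>m n :: complex mat)"
  then show "(transvection n i j t * transvection n i j (- t)) $$ (k, l) = 1\<^sub>m n $$ (k, l)"
    using transvection_mult_entry[OF transvection_carrier assms, of k l] assms by (auto simp: transvection_def)
qed (auto simp: transvection_def)

lemma transvection_GL:
  assumes "i < n" "j < n" "i \<noteq> j"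
  shows "transvection n i j t \<in> carrier (GL n)"
  by (rule GL_mult_cancel(1)[OF transvection_carrier transvection_carrier[of n i j "- t"]])
    (simp add: transvection_inverse[OF assms] one_in_GL)

lemma transvection_upper: "i < j \<Longrightarrow> j < n \<Longrightarrow> transvection n i j t \<in> borel_upper n"
  using transvection_GL[of i n j t] by (auto simp: borel_upper_iff triangular_wrt_def transvection_def split: if_splits)

lemma transvection_lower: "j < i \<Longrightarrow> i < n \<Longrightarrow> transvection n i j t \<in> borel_lower n"
  using transvection_GL[of i n j t] by (auto simp: borel_lower_iff triangular_wrt_def transvection_def split: if_splits)

text \<open>
  On the rows and columns involved this is the identity of matrices
  \<open>[[t, 1], [1, 0]] = [[1, 0], [1/t, 1]] * [[t, 1], [0, - 1/t]]\<close>.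
  The transvection on the left is upper and the one on the right is lower triangular, so the matrix
  lies both in the cell of the swap and in the opposite cell of \<open>u\<close>.
\<close>

lemma transvection_exchange:
  assumes u: "u permutes {..<n}" and ab: "a < b" "b < n" "u a < u b" and t: "t \<noteq> 0"
  obtains c where "c \<in> borel_upper n"
    "transvection n (u a) (u b) t * perm_matrix n (u \<circ> transpose a b) =
     transvection n (u b) (u a) (1 / t) * perm_matrix n u * c"
proof -
  define i j where "i = u a" and "j = u b"
  have ij: "i < n" "j < n" "i \<noteq> j" using permutes_less[OF u] ab by (auto simp: i_def j_def)
  let ?u = "u \<circ> transpose a b" and ?E = "transvection n i j t" and ?F = "transvection n j i (1 / t)"
  let ?F' = "transvection n j i (- (1 / t))"
  let ?P = "perm_matrix n u" and ?P' = "perm_matrix n (Hilbert_Choice.inv u)"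
  have u': "?u permutes {..<n}" using permutes_swap[OF u] ab by simp
  note carr = transvection_carrier perm_matrix_carrier mult_carrier_square[of _ n]
  define c where "c = ?P' * (?F' * (?E * perm_matrix n ?u))"
  have cG: "c \<in> carrier (GL n)"
    unfolding c_def using ij permutes_inv[OF u] u'
    by (intro GL_mult_closed transvection_GL perm_matrix_GL) auto
  have "?F * ?P * c = ?F * ((?P * ?P') * (?F' * (?E * perm_matrix n ?u)))"
    unfolding c_def by (simp add: mat_assoc[of _ n] carr)
  also have "\<dots> = (?F * ?F') * (?E * perm_matrix n ?u)"
    unfolding perm_matrix_mult_inv(2)[OF u] by (simp add: mat_assoc[of _ n] one_mult_square[of _ n] carr)
  also have "\<dots> = ?E * perm_matrix n ?u"
    using transvection_inverse[of j n i "1 / t"] ij by (simp add: one_mult_square[of _ n] carr)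
  finally have eq: "?E * perm_matrix n ?u = ?F * ?P * c" by simp
  \<comment> \<open>\<open>c\<close> is defined by the equation; only its triangularity needs the entries\<close>
  have entry: "c $$ (p, q) = ?E $$ (u p, ?u q) + (if u p = j then - (1 / t) * ?E $$ (i, ?u q) else 0)"
    if pq: "p < n" "q < n" for p q
  proof -
    have "u p < n" using permutes_less[OF u pq(1)] .
    have "c $$ (p, q) = (?F' * (?E * perm_matrix n ?u)) $$ (u p, q)"
      unfolding c_def by (intro perm_matrix_inv_mult_entry carr u pq)
    then show ?thesis
      using transvection_mult_entry[of "?E * perm_matrix n ?u" n j i "u p" q "- (1 / t)"]
        mult_perm_matrix_entry[of ?E n ?u _ q] ij \<open>u p < n\<close> pq u' by (simp add: carr)
  qed
  have "c $$ (p, q) = 0" if pq: "q < p" "p < n" for p q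
  proof -
    have less: "u p < n" "?u q < n" using permutes_less[OF u, of p] permutes_less[OF u', of q] pq by auto
    have inj: "u x = u y \<longleftrightarrow> x = y" for x y using permutes_inj[OF u] by (simp add: inj_eq)
    have E: "?E $$ (k, l) = (if k = l then 1 else if k = i \<and> l = j then t else 0)" if "k < n" "l < n" for k l
      using that by (simp add: transvection_def)
    have "c $$ (p, q) = ?E $$ (u p, ?u q) + (if u p = j then - (1 / t) * ?E $$ (i, ?u q) else 0)"
      using entry pq by simp
    also have "\<dots> = 0"
      using less ij(1) pq ab t unfolding E[OF less] E[OF ij(1) less(2)]
      by (auto simp: i_def j_def inj transpose_def)
    finally show ?thesis .
  qed
  then have "triangular_wrt (\<lambda>i. - int i) n c" unfolding triangular_wrt_def by (metis neg_le_iff_le not_le of_nat_le_iff)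
  then have "c \<in> borel_upper n" using cG by (simp add: borel_upper_iff)
  then show thesis using that eq unfolding i_def j_def by blast
qed

lemma matrix_over_transvection: "matrix_over (range poly) n (\<lambda>s. transvection n i j (a * s))"
  unfolding transvection_def
proof (rule matrix_over_mat)
  fix k l
  have "(\<lambda>s. a * s) = poly [:0, a:]" by (rule ext) simp
  then have "(\<lambda>s. a * s) \<in> range poly" by (rule range_eqI)
  then show "(\<lambda>s. if k = l then 1 else if k = i \<and> l = j then a * s else 0) \<in> range poly"
    using function_ring_const[OF function_ring_poly, of 1] function_ring_const[OF function_ring_poly, of 0]
    by (cases "k = l"; cases "k = i"; cases "l = j") (simp_all only: if_True if_False simp_thms)
qed

text \<open>
  The curve of lower transvections applied to the permutation matrix of \<open>u\<close> runs in the cell of the swap,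
  except at the parameter \<open>0\<close>.
\<close>

lemma perm_matrix_in_swap_closure:
  assumes u: "u permutes {..<n}" and ab: "a < b" "b < n" "u a < u b"
  shows "perm_matrix n u \<in> cell_closure n (u \<circ> transpose a b)"
proof -
  let ?u = "u \<circ> transpose a b"
  let ?\<gamma> = "\<lambda>s. transvection n (u b) (u a) (1 * s) * perm_matrix n u"
  have ij: "u a < n" "u b < n" "u a \<noteq> u b" using permutes_less[OF u] ab by auto
  have \<gamma>: "matrix_over (range poly) n ?\<gamma>"
    by (intro matrix_over_mult function_ring_poly matrix_over_transvection matrix_over_const perm_matrix_carrier)
  have "?\<gamma> s \<in> cell n ?u" if s: "s \<noteq> 0" for s
  proof -
    obtain c where c: "c \<in> borel_upper n" "transvection n (u a) (u b) (1 / s) * perm_matrix n ?u =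
      transvection n (u b) (u a) (1 / (1 / s)) * perm_matrix n u * c"
      using transvection_exchange[OF u ab, of "1 / s"] s by auto
    obtain d where d: "d \<in> borel_upper n" "c * d = 1\<^sub>m n" using borel_upper_inverse[OF c(1)] by blast
    have "transvection n (u a) (u b) (1 / s) * perm_matrix n ?u * d = (?\<gamma> s * c) * d"
      using c(2) s by simp
    also have "\<dots> = ?\<gamma> s * (c * d)"
      using c(1) d(1)
      by (simp add: mat_assoc[of _ n] mult_carrier_square[of _ n] transvection_carrier perm_matrix_carrier borel_carrier)
    also have "\<dots> = ?\<gamma> s"
      unfolding d(2) by (rule one_mult_square(2)[OF mult_carrier_square[OF transvection_carrier perm_matrix_carrier]])
    finally have "?\<gamma> s = transvection n (u a) (u b) (1 / s) * perm_matrix n ?u * d" ..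
    then show ?thesis
      using transvection_upper[OF ab(3) ij(2), of "1 / s"] d(1) unfolding cell_def by blast
  qed
  then have "{s. ?\<gamma> s \<notin> cell n ?u} \<subseteq> {0}" by auto
  then have "finite {s. ?\<gamma> s \<notin> cell n ?u}" by (rule finite_subset) simp
  moreover have "?\<gamma> 0 = perm_matrix n u" by (simp add: transvection_zero perm_matrix_carrier one_mult_square[of _ n])
  ultimately show ?thesis
    using curve_in_closure[OF \<gamma>, of 0] perm_matrix_GL[OF u] by simp
qed

lemma cell_closure_swap_mono:
  assumes u: "u permutes {..<n}" and ab: "a < b" "b < n" "u a < u b"
  shows "cell_closure n u \<subseteq> cell_closure n (u \<circ> transpose a b)"
proof (rule closure_of_minimal)
  show "cell n u \<subseteq> cell_closure n (u \<circ> transpose a b)"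
    using cell_closure_mult[OF perm_matrix_in_swap_closure[OF u ab]] by (auto simp: cell_def)
qed simp

lemma cell_closure_mono:
  assumes u: "u permutes {..<n}" "w permutes {..<n}" "rank_le n u w"
  shows "cell_closure n u \<subseteq> cell_closure n w"
proof -
  obtain m x where x: "rank_chain n u w m x" using rank_chain_exists[OF u] by (elim exE conjE)
  have "cell_closure n u \<subseteq> cell_closure n (x i)" if "i \<le> m" for i
    using that
  proof (induction i)
    case 0
    then show ?case using x by (simp add: rank_chain_def)
  next
    case (Suc i)
    obtain a b where ab: "a < b" "b < n" "x i a < x i b" "x (Suc i) = x i \<circ> transpose a b"
      using x Suc.prems unfolding rank_chain_def by (meson Suc_le_lessD)
    have "x i permutes {..<n}" using rank_chain_permutes[OF x u(1)] Suc.prems by simp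
    then have "cell_closure n (x i) \<subseteq> cell_closure n (x (Suc i))"
      using cell_closure_swap_mono[OF _ ab(1-3)] ab(4) by metis
    then show ?case using Suc by simp
  qed
  from this[OF order_refl] show ?thesis using x by (simp add: rank_chain_def)
qed

lemma unipotent_representative:
  assumes v: "v permutes {..<n}" and g: "g \<in> opp_cell n v"
  obtains b c where "lower_unipotent n b" "c \<in> borel_upper n" "g = b * perm_matrix n v * c"
proof -
  obtain b c where bc: "g = b * perm_matrix n v * c" "b \<in> borel_lower n" "c \<in> borel_upper n"
    using g unfolding opp_cell_def by blast
  have b: "b \<in> carrier (GL n)" "triangular_wrt int n b" using bc(2) by (auto simp: borel_lower_iff)
  have diag: "b $$ (i, i) \<noteq> 0" if "i < n" for i by (rule triangular_wrt_diag_nonzero[OF b(2) inj_int b(1) that])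
  define b' where "b' = mat n n (\<lambda>(i, j). b $$ (i, j) / b $$ (j, j))"
  define d where "d = mat n n (\<lambda>(i, j). if i = j then b $$ (v j, v j) else 0)"
  have d: "d \<in> carrier_mat n n" "triangular_wrt (\<lambda>i. - int i) n d" "\<And>i. i < n \<Longrightarrow> d $$ (i, i) \<noteq> 0"
    unfolding d_def using diag permutes_less[OF v] by (auto simp: triangular_wrt_def split: if_splits)
  then have dB: "d \<in> borel_upper n"
    using triangular_wrt_GL[OF d(1,2) inj_neg_int] by (simp add: borel_upper_iff)
  have b': "b' \<in> carrier_mat n n" "lower_unipotent n b'"
    using b(2) diag by (auto simp: b'_def lower_unipotent_def triangular_wrt_def)
  have "b' * perm_matrix n v * d = b * perm_matrix n v"
  proof (rule eq_matI)
    fix i j assume "i < dim_row (b * perm_matrix n v)" "j < dim_col (b * perm_matrix n v)"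
    then have ij: "i < n" "j < n" using GL_carrier_mat[OF b(1)] by (auto simp: perm_matrix_def)
    have vj: "v j < n" using permutes_less[OF v ij(2)] .
    have "(b' * perm_matrix n v * d) $$ (i, j) = (\<Sum>k<n. (b' * perm_matrix n v) $$ (i, k) * d $$ (k, j))"
      by (rule mat_mult_entry[OF mult_carrier_square[OF b'(1) perm_matrix_carrier] d(1) ij])
    also have "\<dots> = (\<Sum>k\<in>{j}. (b' * perm_matrix n v) $$ (i, k) * d $$ (k, j))"
      using ij by (intro sum.mono_neutral_right) (auto simp: d_def)
    also have "\<dots> = b $$ (i, v j)"
      using mult_perm_matrix_entry[OF b'(1) v ij] ij vj diag[OF vj] by (simp add: d_def b'_def)
    also have "\<dots> = (b * perm_matrix n v) $$ (i, j)"
      using mult_perm_matrix_entry[OF GL_carrier_mat[OF b(1)] v ij] by simp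
    finally show "(b' * perm_matrix n v * d) $$ (i, j) = (b * perm_matrix n v) $$ (i, j)" .
  qed (use b'(1) GL_carrier_mat[OF b(1)] d(1) in \<open>auto simp: perm_matrix_def\<close>)
  then have "g = b' * perm_matrix n v * (d * c)"
    unfolding bc(1) using b'(1) d(1) borel_carrier(1)[OF bc(3)]
    by (simp add: mat_assoc[of _ n, symmetric] mult_carrier_square[of _ n] perm_matrix_carrier)
  then show thesis using that[OF b'(2)] borel_upper_mult[OF dB bc(3)] by blast
qed

text \<open>
  Write \<open>g = h u' c\<close> with \<open>h\<close> lower unipotent and \<open>u'\<close> the swap of \<open>u\<close>, and let \<open>E s\<close> be the transvection that
  takes \<open>u'\<close> into the opposite cell of \<open>u\<close>. Elimination provides upper triangular matrices
  \<open>A s\<close> such that \<open>L s = A s h (E s)\<inverse>\<close> is lower triangular. Then \<open>A s g = L s (E s u') c\<close> lies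
  in the opposite cell of \<open>u\<close>, and in the closure of the cell of \<open>w\<close> because this is stable under upper
  triangular matrices. At \<open>s = 0\<close> no elimination takes place, so the curve starts at \<open>g\<close>.
\<close>

lemma density_step:
  assumes u: "u permutes {..<n}" and ab: "a < b" "b < n" "u a < u b"
    and g: "g \<in> cell_closure n w" "g \<in> opp_cell n (u \<circ> transpose a b)"
  shows "g \<in> zariski_GL n closure_of (cell_closure n w \<inter> opp_cell n u)"
proof -
  let ?u = "u \<circ> transpose a b" and ?E = "transvection n (u a) (u b)"
  have u': "?u permutes {..<n}" using permutes_swap[OF u] ab by simp
  have ij: "u a < n" "u b < n" "u a \<noteq> u b" using permutes_less[OF u] ab by auto
  obtain h c where h: "lower_unipotent n h" "c \<in> borel_upper n" "g = h * perm_matrix n ?u * c"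
    using unipotent_representative[OF u' g(2)] by blast
  have hc: "h \<in> carrier_mat n n" "triangular_wrt int n h" using h(1) by (auto simp: lower_unipotent_def)
  have gG: "g \<in> carrier (GL n)" using g(1) cell_closure_GL by blast
  have gc: "g \<in> carrier_mat n n" by (rule GL_carrier_mat[OF gG])
  have hG: "h \<in> carrier (GL n)"
    using triangular_wrt_GL[OF hc inj_int] h(1) by (auto simp: lower_unipotent_def)
  let ?A = "\<lambda>s. row_elim n (h * ?E (- 1 * s))"
  let ?\<gamma> = "\<lambda>s. ?A s * g"
  have \<gamma>: "matrix_over (range poly) n ?\<gamma>"
    by (intro matrix_over_mult matrix_over_row_elim function_ring_poly matrix_over_transvection matrix_over_const hc gc)
  have "?\<gamma> 0 = g"
    using row_elim_unipotent[OF h(1)] hc(1) gc by (simp add: transvection_zero)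
  have "?\<gamma> s \<in> cell_closure n w \<inter> opp_cell n u" if s: "s \<noteq> 0" "?\<gamma> s \<in> carrier (GL n)" for s
  proof
    have AG: "?A s \<in> carrier (GL n)" using GL_mult_cancel(1)[OF row_elim_carrier gc s(2)] .
    then have AB: "?A s \<in> borel_upper n" using row_elim_upper by (simp add: borel_upper_iff)
    have "?\<gamma> s * 1\<^sub>m n \<in> cell_closure n w"
      by (rule cell_closure_mult[OF g(1) AB one_in_borel_upper])
    then show "?\<gamma> s \<in> cell_closure n w" by (simp only: one_mult_square(2)[OF GL_carrier_mat[OF s(2)]])
    let ?l = "?A s * (h * ?E (- 1 * s))"
    have hE: "h * ?E (- 1 * s) \<in> carrier (GL n)" by (intro GL_mult_closed hG transvection_GL ij)
    have lB: "?l \<in> borel_lower n"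
      using row_elim_mult_lower[OF GL_carrier_mat[OF hE]] GL_mult_closed[OF AG hE] by (simp add: borel_lower_iff)
    obtain c' where c': "c' \<in> borel_upper n"
      "?E s * perm_matrix n ?u = transvection n (u b) (u a) (1 / s) * perm_matrix n u * c'"
      using transvection_exchange[OF u ab s(1)] by blast
    let ?F = "transvection n (u b) (u a) (1 / s)"
    have inv: "?E (- 1 * s) * ?E s = 1\<^sub>m n" using transvection_inverse[OF ij, of "- s"] by simp
    note carr = row_elim_carrier hc(1) transvection_carrier perm_matrix_carrier mult_carrier_square[of _ n]
      borel_carrier(1)[OF h(2)] borel_carrier(1)[OF c'(1)]
    have "?l * (?E s * perm_matrix n ?u) * c = ?A s * (h * ((?E (- 1 * s) * ?E s) * (perm_matrix n ?u * c)))"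
      by (simp add: mat_assoc[of _ n] carr)
    also have "\<dots> = ?\<gamma> s" unfolding inv h(3) by (simp add: mat_assoc[of _ n] one_mult_square[of _ n] carr)
    finally have "?\<gamma> s = ?l * (?F * perm_matrix n u * c') * c" unfolding c'(2) by simp
    also have "\<dots> = (?l * ?F) * perm_matrix n u * (c' * c)"
      by (simp add: mat_assoc[of _ n] carr)
    finally show "?\<gamma> s \<in> opp_cell n u"
      using borel_lower_mult[OF lB transvection_lower[OF ab(3) ij(2)]] borel_upper_mult[OF c'(1) h(2)]
      unfolding opp_cell_def by blast
  qed
  then have "{s. ?\<gamma> s \<notin> cell_closure n w \<inter> opp_cell n u} \<subseteq> {0} \<union> {s. ?\<gamma> s \<notin> carrier (GL n)}" by blast
  moreover have "finite {s. ?\<gamma> s \<notin> carrier (GL n)}"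
    using cofinite_curve[OF \<gamma>, of "carrier (GL n)" 0] \<open>?\<gamma> 0 = g\<close> gG openin_topspace[of "zariski_GL n"]
    by (simp add: topspace_zariski_GL)
  ultimately have "finite {s. ?\<gamma> s \<notin> cell_closure n w \<inter> opp_cell n u}" by (simp add: finite_subset)
  then show ?thesis using curve_in_closure[OF \<gamma>, of 0] \<open>?\<gamma> 0 = g\<close> gG by simp
qed

lemma density_rank_le:
  assumes v: "v permutes {..<n}" and u: "u permutes {..<n}" and vu: "rank_le n v u"
  shows "cell_closure n w \<inter> opp_cell n u \<subseteq> zariski_GL n closure_of (cell_closure n w \<inter> opp_cell n v)"
proof -
  obtain m x where x: "rank_chain n v u m x" using rank_chain_exists[OF v u vu] by (elim exE conjE)
  let ?C = "zariski_GL n closure_of (cell_closure n w \<inter> opp_cell n v)"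
  have "cell_closure n w \<inter> opp_cell n (x i) \<subseteq> ?C" if "i \<le> m" for i
    using that
  proof (induction i)
    case 0
    have "cell_closure n w \<inter> opp_cell n v \<subseteq> topspace (zariski_GL n)"
      using cell_closure_GL by (auto simp: topspace_zariski_GL)
    then show ?case using x closure_of_subset by (simp add: rank_chain_def)
  next
    case (Suc i)
    obtain a b where ab: "a < b" "b < n" "x i a < x i b" "x (Suc i) = x i \<circ> transpose a b"
      using x Suc.prems unfolding rank_chain_def by (meson Suc_le_lessD)
    have xi: "x i permutes {..<n}" using rank_chain_permutes[OF x v] Suc.prems by simp
    have "cell_closure n w \<inter> opp_cell n (x (Suc i)) \<subseteq> zariski_GL n closure_of (cell_closure n w \<inter> opp_cell n (x i))"
      using density_step[OF xi ab(1-3)] unfolding ab(4) by auto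
    also have "\<dots> \<subseteq> ?C" using Suc by (intro closure_of_minimal) auto
    finally show ?case .
  qed
  from this[OF order_refl] show ?thesis using x by (simp add: rank_chain_def)
qed

lemma richardson_density:
  assumes v: "v permutes {..<n}"
  shows "cell_closure n w \<inter> zariski_GL n closure_of opp_cell n v
    \<subseteq> zariski_GL n closure_of (cell_closure n w \<inter> opp_cell n v)"
proof
  fix g assume g: "g \<in> cell_closure n w \<inter> zariski_GL n closure_of opp_cell n v"
  then have "g \<in> carrier (GL n)" using cell_closure_GL by auto
  then obtain u where u: "u permutes {..<n}" "g \<in> opp_cell n u"
    by (rule opposite_bruhat_decomposition)
  have "rank_le n v u" using closure_opp_cell_rank_le[OF v u(1) _ u(2)] g by simp
  from density_rank_le[OF v u(1) this, of w] u(2) g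
  show "g \<in> zariski_GL n closure_of (cell_closure n w \<inter> opp_cell n v)" by auto
qed

section \<open>Retraction of a chart onto the opposite cell\<close>

text \<open>
  For \<open>g\<close> in the chart, this is the matrix in the coset of \<open>g\<close> that has the form \<open>v l\<close> with \<open>l\<close>
  lower triangular.
\<close>

definition chart_frame :: "nat \<Rightarrow> (nat \<Rightarrow> nat) \<Rightarrow> complex mat \<Rightarrow> complex mat" where
  "chart_frame n v g = g * column_elim n (perm_matrix n (Hilbert_Choice.inv v) * g)"

text \<open>
  The matrix \<open>m = v l v\<inverse>\<close> has a factorisation into an upper and a lower triangular matrix; the upper
  one is removed. Starting from \<open>m\<close>, which is triangular in the order given by \<open>v\<close>, instead
  of from \<open>g\<close> itself ensures that the cosets of points of the opposite cell stay fixed.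
\<close>

definition chart_retraction :: "nat \<Rightarrow> (nat \<Rightarrow> nat) \<Rightarrow> complex mat \<Rightarrow> complex mat" where
  "chart_retraction n v g =
     row_elim n (chart_frame n v g * perm_matrix n (Hilbert_Choice.inv v)) * chart_frame n v g"

lemma inj_on_inv_perm: "v permutes {..<n :: nat} \<Longrightarrow> inj_on (\<lambda>i. int (Hilbert_Choice.inv v i)) S"
  using permutes_inj[OF permutes_inv] by (auto simp: inj_on_def dest: injD)

lemma conjugate_perm_matrix_entry:
  assumes "v permutes {..<n}" "l \<in> carrier_mat n n" "i < n" "j < n"
  shows "(perm_matrix n v * l * perm_matrix n (Hilbert_Choice.inv v)) $$ (i, j) =
     l $$ (Hilbert_Choice.inv v i, Hilbert_Choice.inv v j)"
proof -
  let ?v = "Hilbert_Choice.inv v"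
  have v: "?v permutes {..<n}" by (rule permutes_inv[OF assms(1)])
  have "(perm_matrix n v * l * perm_matrix n ?v) $$ (i, j) = (perm_matrix n v * l) $$ (i, ?v j)"
    by (intro mult_perm_matrix_entry mult_carrier_square perm_matrix_carrier assms v)
  also have "\<dots> = (perm_matrix n (Hilbert_Choice.inv ?v) * l) $$ (i, ?v j)"
    by (simp add: permutes_inv_inv[OF assms(1)])
  also have "\<dots> = l $$ (?v i, ?v j)"
    using permutes_less[OF v assms(4)] by (intro perm_matrix_inv_mult_entry assms v)
  finally show ?thesis .
qed

lemma chart_frame:
  assumes v: "v permutes {..<n}" and g: "g \<in> chart n v"
  obtains l where "column_elim n (perm_matrix n (Hilbert_Choice.inv v) * g) \<in> borel_upper n" "l \<in> borel_lower n"
    "chart_frame n v g = perm_matrix n v * l"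
proof -
  let ?P = "perm_matrix n v" and ?P' = "perm_matrix n (Hilbert_Choice.inv v)"
  let ?h = "?P' * g"
  have gc: "g \<in> carrier_mat n n" using g by (simp add: chart_def carrier_GL_iff)
  have hc: "?h \<in> carrier_mat n n" by (intro mult_carrier_square perm_matrix_carrier gc)
  have "det (leading_block (Suc j) ?h) \<noteq> 0" if j: "j < n" for j
  proof -
    have "leading_block (Suc j) ?h = mat (Suc j) (Suc j) (\<lambda>(s, t). g $$ (v s, t))"
      unfolding leading_block_def
      using j by (intro eq_matI) (auto simp: perm_matrix_inv_mult_entry[OF gc v])
    then show ?thesis using g j by (auto simp: chart_def minor_def)
  qed
  note c = column_elim_GL[OF hc this]
  have "?P * (?h * column_elim n ?h) = (?P * ?P') * (g * column_elim n ?h)"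
    by (simp add: mat_assoc[of _ n] mult_carrier_square[of _ n] perm_matrix_carrier column_elim_carrier gc)
  also have "\<dots> = chart_frame n v g"
    unfolding perm_matrix_mult_inv(2)[OF v] chart_frame_def
    by (simp add: one_mult_square[of _ n] mult_carrier_square[of _ n] column_elim_carrier gc)
  finally show thesis using that[OF c] by simp
qed

lemma chart_retraction_in_opp_cell:
  assumes v: "v permutes {..<n}" and g: "g \<in> chart n v"
  obtains a c where "a \<in> borel_upper n" "c \<in> borel_upper n" "chart_retraction n v g = a * g * c"
    "chart_retraction n v g \<in> opp_cell n v"
proof -
  let ?P = "perm_matrix n v" and ?P' = "perm_matrix n (Hilbert_Choice.inv v)"
  let ?c = "column_elim n (?P' * g)" and ?f = "chart_frame n v g"
  obtain l where l: "?c \<in> borel_upper n" "l \<in> borel_lower n" "?f = ?P * l"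
    using chart_frame[OF v g] by blast
  have gG: "g \<in> carrier (GL n)" using g by (simp add: chart_def)
  let ?m = "?f * ?P'" and ?\<tau> = "\<lambda>i. int (Hilbert_Choice.inv v i)"
  have fc: "?f \<in> carrier_mat n n"
    unfolding l(3) by (intro mult_carrier_square perm_matrix_carrier borel_carrier(2)[OF l(2)])
  have mG: "?m \<in> carrier (GL n)"
    unfolding l(3) by (intro GL_mult_closed perm_matrix_GL v permutes_inv[OF v] borel_lower_GL l(2))
  have "triangular_wrt ?\<tau> n ?m"
    unfolding triangular_wrt_def l(3)
    using conjugate_perm_matrix_entry[OF v borel_carrier(2)[OF l(2)]] l(2) permutes_less[OF permutes_inv[OF v]]
    by (simp add: borel_lower_iff triangular_wrt_def)
  note a = row_elim_GL[OF mG this inj_on_inv_perm[OF v]]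
  let ?a = "row_elim n ?m"
  have "chart_retraction n v g = ?a * g * ?c"
    unfolding chart_retraction_def unfolding chart_frame_def
    by (rule mat_assoc[OF row_elim_carrier GL_carrier_mat[OF gG] column_elim_carrier, symmetric])
  moreover have "chart_retraction n v g \<in> opp_cell n v"
  proof -
    have "?a * ?m * ?P * 1\<^sub>m n = ?a * (?f * (?P' * ?P))"
      by (simp add: mat_assoc[of _ n] one_mult_square[of _ n] mult_carrier_square[of _ n] perm_matrix_carrier fc row_elim_carrier)
    also have "\<dots> = chart_retraction n v g"
      unfolding perm_matrix_mult_inv(1)[OF v] chart_retraction_def by (simp add: one_mult_square[OF fc])
    finally show ?thesis using a(2) one_in_borel_upper unfolding opp_cell_def by (metis (mono_tags, lifting) mem_Collect_eq)
  qed
  ultimately show thesis using that[OF a(1) l(1)] by blast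
qed

text \<open>
  In a column \<open>j\<close> with a nonzero entry above the diagonal, take the topmost nonzero entry, in row
  \<open>i\<close>. Then \<open>b * m\<close> is nonzero at \<open>(i, j)\<close> as well, so \<open>\<tau> i \<le> \<tau> j \<le> \<tau> i\<close>.
\<close>

lemma lower_triangular_of_factorization:
  assumes b: "b \<in> borel_lower n" and m: "m \<in> carrier_mat n n" "triangular_wrt \<tau> n m"
    and bm: "triangular_wrt (\<lambda>i. - \<tau> i) n (b * m)" and \<tau>: "inj_on \<tau> {..<n}"
  shows "triangular_wrt int n m"
proof (rule ccontr)
  assume "\<not> triangular_wrt int n m"
  then obtain i0 j where j: "i0 < n" "j < n" "i0 < j" "m $$ (i0, j) \<noteq> 0"
    unfolding triangular_wrt_def by (auto simp: not_le)
  define i where "i = (LEAST i. m $$ (i, j) \<noteq> 0)"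
  have i: "m $$ (i, j) \<noteq> 0" "i \<le> i0"
    unfolding i_def using j(4) by (rule LeastI, rule Least_le)
  have min: "m $$ (k, j) = 0" if "k < i" for k using that not_less_Least unfolding i_def by blast
  have ij: "i < n" "i < j" using i(2) j by auto
  have bG: "b \<in> carrier (GL n)" "triangular_wrt int n b" using b by (auto simp: borel_lower_iff)
  have "(b * m) $$ (i, j) = (\<Sum>k<n. b $$ (i, k) * m $$ (k, j))"
    by (rule mat_mult_entry[OF GL_carrier_mat[OF bG(1)] m(1) ij(1) j(2)])
  also have "\<dots> = (\<Sum>k\<in>{i}. b $$ (i, k) * m $$ (k, j))"
  proof (rule sum.mono_neutral_right)
    show "\<forall>k\<in>{..<n} - {i}. b $$ (i, k) * m $$ (k, j) = 0"
    proof
      fix k assume k: "k \<in> {..<n} - {i}"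
      show "b $$ (i, k) * m $$ (k, j) = 0"
        using min[of k] triangular_wrtD[OF bG(2) ij(1), of k] k by (cases "k < i") auto
    qed
  qed (use ij in auto)
  finally have "(b * m) $$ (i, j) \<noteq> 0"
    using i(1) triangular_wrt_diag_nonzero[OF bG(2) inj_int bG(1) ij(1)] by simp
  then have "\<tau> i \<le> \<tau> j" using bm ij(1) j(2) unfolding triangular_wrt_def by force
  moreover have "\<tau> j \<le> \<tau> i" using m(2) ij(1) j(2) i(1) unfolding triangular_wrt_def by blast
  ultimately have "i = j" using \<tau> ij(1) j(2) by (auto simp: inj_on_def)
  then show False using ij(2) by simp
qed

text \<open>
  For \<open>g\<close> in the opposite cell, the matrix \<open>m = v l v\<inverse>\<close> is lower triangular by
  \<open>lower_triangular_of_factorization\<close>. After scaling columns, \<open>l\<close> and \<open>m\<close> are unipotent,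
  and neither elimination changes anything.
\<close>

lemma chart_retraction_fixes_representative:
  assumes v: "v permutes {..<n}" and g: "g \<in> opp_cell n v"
  obtains c where "c \<in> borel_upper n" "chart_retraction n v (g * c) = g * c"
proof -
  let ?P = "perm_matrix n v" and ?P' = "perm_matrix n (Hilbert_Choice.inv v)"
  let ?c = "column_elim n (?P' * g)" and ?f = "chart_frame n v g" and ?\<tau> = "\<lambda>i. int (Hilbert_Choice.inv v i)"
  have inv_less: "Hilbert_Choice.inv v i < n" if "i < n" for i by (rule permutes_less[OF permutes_inv[OF v] that])
  obtain b0 c0 where bc: "g = b0 * ?P * c0" "b0 \<in> borel_lower n" "c0 \<in> borel_upper n"
    using g unfolding opp_cell_def by blast
  obtain l where l: "?c \<in> borel_upper n" "l \<in> borel_lower n" "?f = ?P * l"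
    using chart_frame[OF v] opp_cell_subset_chart[OF v] g by blast
  have lG: "l \<in> carrier (GL n)" "triangular_wrt int n l" using l(2) by (auto simp: borel_lower_iff)
  have lc: "l \<in> carrier_mat n n" by (rule GL_carrier_mat[OF lG(1)])
  have gG: "g \<in> carrier (GL n)" using g opp_cell_GL[OF v] by blast
  have gc: "g \<in> carrier_mat n n" by (rule GL_carrier_mat[OF gG])
  note carr = mult_carrier_square[of _ n] perm_matrix_carrier column_elim_carrier gc lc
    borel_carrier(2)[OF bc(2)] borel_carrier(1)[OF bc(3)]
  let ?m = "?P * l * ?P'"
  have mtri: "triangular_wrt ?\<tau> n ?m"
    unfolding triangular_wrt_def
    using conjugate_perm_matrix_entry[OF v lc] lG(2) inv_less by (simp add: triangular_wrt_def)
  \<comment> \<open>without the factor \<open>b0\<close>, the matrix \<open>m\<close> becomes a conjugate of an upper triangular one\<close>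
  obtain b1 where b1: "b1 \<in> borel_lower n" "b1 * b0 = 1\<^sub>m n" using borel_lower_inverse[OF bc(2)] by blast
  have "b1 * ?m = b1 * (g * ?c * ?P')" using l(3) by (simp add: chart_frame_def)
  also have "\<dots> = (b1 * b0) * (?P * (c0 * ?c) * ?P')"
    unfolding bc(1) by (simp add: mat_assoc[of _ n] carr borel_carrier(2)[OF b1(1)])
  also have "\<dots> = ?P * (c0 * ?c) * ?P'" unfolding b1(2) by (simp add: one_mult_square[of _ n] carr)
  finally have b1m: "b1 * ?m = ?P * (c0 * ?c) * ?P'" .
  have "triangular_wrt (\<lambda>i. - int i) n (c0 * ?c)"
    using borel_upper_mult[OF bc(3) l(1)] by (simp add: borel_upper_iff)
  then have "triangular_wrt (\<lambda>i. - ?\<tau> i) n (b1 * ?m)"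
    unfolding b1m triangular_wrt_def
    using conjugate_perm_matrix_entry[OF v mult_carrier_square[OF borel_carrier(1)[OF bc(3)] column_elim_carrier]] inv_less
    by (simp add: triangular_wrt_def)
  then have mlow: "triangular_wrt int n ?m"
    by (intro lower_triangular_of_factorization[OF b1(1) _ mtri _ inj_on_inv_perm[OF v]]) (simp_all add: carr)
  have diag: "l $$ (i, i) \<noteq> 0" if "i < n" for i by (rule triangular_wrt_diag_nonzero[OF lG(2) inj_int lG(1) that])
  \<comment> \<open>the diagonal matrix \<open>d\<close> scales the columns so that \<open>l\<close> and \<open>m\<close> become unipotent\<close>
  define d where "d = mat n n (\<lambda>(i, j). if i = j then 1 / l $$ (j, j) else 0)"
  have d: "d \<in> carrier_mat n n" "triangular_wrt (\<lambda>i. - int i) n d" "\<And>i. i < n \<Longrightarrow> d $$ (i, i) \<noteq> 0"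
    unfolding d_def using diag by (auto simp: triangular_wrt_def split: if_splits)
  then have dB: "d \<in> borel_upper n"
    using triangular_wrt_GL[OF d(1,2) inj_neg_int] by (simp add: borel_upper_iff)
  have ld: "(l * d) $$ (i, j) = l $$ (i, j) / l $$ (j, j)" if "i < n" "j < n" for i j
  proof -
    have "(l * d) $$ (i, j) = (\<Sum>k<n. l $$ (i, k) * d $$ (k, j))" by (rule mat_mult_entry[OF lc d(1) that])
    also have "\<dots> = (\<Sum>k\<in>{j}. l $$ (i, k) * d $$ (k, j))"
      using that by (intro sum.mono_neutral_right) (auto simp: d_def)
    finally show ?thesis using that by (simp add: d_def)
  qed
  have ldc: "l * d \<in> carrier_mat n n" by (rule mult_carrier_square[OF lc d(1)])
  have unip: "lower_unipotent n (l * d)"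
    using lG(2) diag ldc by (simp add: lower_unipotent_def triangular_wrt_def ld)
  let ?m' = "?P * (l * d) * ?P'"
  have mc: "?m' \<in> carrier_mat n n" by (simp add: carr ldc)
  have unip': "lower_unipotent n ?m'"
    unfolding lower_unipotent_def triangular_wrt_def
  proof (intro conjI allI impI mc)
    fix i j assume ij: "i < n" "j < n" "?m' $$ (i, j) \<noteq> 0"
    then have "?m $$ (i, j) \<noteq> 0"
      using conjugate_perm_matrix_entry[OF v ldc ij(1,2)] conjugate_perm_matrix_entry[OF v lc ij(1,2)]
        ld[OF inv_less[OF ij(1)] inv_less[OF ij(2)]] by auto
    then show "int j \<le> int i" using mlow ij(1,2) unfolding triangular_wrt_def by blast
  next
    fix i assume "i < n"
    then show "?m' $$ (i, i) = 1"
      using conjugate_perm_matrix_entry[OF v ldc] ld inv_less diag by simp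
  qed
  let ?g = "g * (?c * d)"
  have g': "?g = ?P * (l * d)"
    using l(3) unfolding chart_frame_def by (simp add: mat_assoc[of _ n, symmetric] carr d(1))
  have h': "?P' * ?g = l * d"
  proof -
    have "?P' * ?g = (?P' * ?P) * (l * d)"
      unfolding g' by (simp add: mat_assoc[of _ n] carr d(1))
    then show ?thesis unfolding perm_matrix_mult_inv(1)[OF v] by (simp add: one_mult_square[OF ldc])
  qed
  have "?g \<in> carrier_mat n n" by (simp add: carr d(1))
  then have "chart_frame n v ?g = ?g"
    unfolding chart_frame_def h' column_elim_unipotent[OF unip] by (rule one_mult_square)
  then have "chart_retraction n v ?g = ?g"
    unfolding chart_retraction_def using row_elim_unipotent[OF unip'] one_mult_square(1)[OF \<open>?g \<in> carrier_mat n n\<close>] g' by simp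
  then show thesis using that borel_upper_mult[OF l(1) dB] by blast
qed

lemma continuous_map_chart_retraction:
  assumes v: "v permutes {..<n}"
  shows "continuous_map (subtopology (zariski_GL n) (chart n v)) (zariski_GL n) (chart_retraction n v)"
proof -
  let ?R = "polynomial_functions n"
  let ?I = "\<lambda>g. mat n n (\<lambda>(i, j). g $$ (i, j)) :: complex mat"
  have I: "?I g = g" if "g \<in> chart n v" for g
    using that mat_entries_id[of g n] by (simp add: chart_def carrier_GL_iff)
  have fr: "matrix_over ?R n (\<lambda>g. chart_frame n v (?I g))"
    unfolding chart_frame_def
    by (intro matrix_over_mult matrix_over_column_elim function_ring_polynomial_functions matrix_over_const
        perm_matrix_carrier matrix_over_id)
  have "matrix_over ?R n (\<lambda>g. chart_retraction n v (?I g))"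
    unfolding chart_retraction_def
    by (intro matrix_over_mult matrix_over_row_elim function_ring_polynomial_functions matrix_over_const
        perm_matrix_carrier fr)
  moreover have "chart_retraction n v (?I g) \<in> carrier (GL n)" if "g \<in> chart n v" for g
    using chart_retraction_in_opp_cell[OF v that] opp_cell_GL[OF v] I[OF that] by (metis subsetD)
  ultimately have "continuous_map (subtopology (zariski_GL n) (chart n v)) (zariski_GL n) (\<lambda>g. chart_retraction n v (?I g))"
    by (intro continuous_map_matrix_over) (auto simp: chart_def)
  then show ?thesis by (rule continuous_map_eq) (use I in auto)
qed

lemma irreducible_in_cell:
  assumes w: "w permutes {..<n}"
  shows "irreducible_in (zariski_GL n) (cell n w)"
proof (rule irreducible_in_zariski_GL_curves[OF cell_GL[OF w]])
  show "cell n w \<noteq> {}" using perm_matrix_in_cell by blast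
  fix g h assume "g \<in> cell n w" "h \<in> cell n w"
  then obtain b c b' c' where bc: "g = b * perm_matrix n w * c" "b \<in> borel_upper n" "c \<in> borel_upper n"
    "h = b' * perm_matrix n w * c'" "b' \<in> borel_upper n" "c' \<in> borel_upper n"
    unfolding cell_def by blast
  let ?\<gamma> = "\<lambda>t. segment n b b' t * perm_matrix n w * segment n c c' t"
  have \<gamma>: "matrix_over (range poly) n ?\<gamma>"
    by (intro matrix_over_mult function_ring_poly matrix_over_segment matrix_over_const perm_matrix_carrier)
  have ends: "?\<gamma> 0 = g" "?\<gamma> 1 = h"
    using bc by (simp_all add: segment_endpoints borel_carrier)
  have tri: "triangular_wrt (\<lambda>i. - int i) n (segment n x y t)" if "x \<in> borel_upper n" "y \<in> borel_upper n" for x y t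
    unfolding triangular_wrt_def
  proof (intro allI impI, rule ccontr)
    fix i j assume ij: "i < n" "j < n" "segment n x y t $$ (i, j) \<noteq> 0" "\<not> - int j \<le> - int i"
    then have "- int i < - int j" by simp
    then have "x $$ (i, j) = 0" "y $$ (i, j) = 0"
      using that triangular_wrtD[OF _ ij(1,2)] by (auto simp: borel_upper_iff)
    then show False using ij by (simp add: segment_def)
  qed
  have "?\<gamma> t \<in> cell n w" if G: "?\<gamma> t \<in> carrier (GL n)" for t
  proof -
    have "segment n b b' t * perm_matrix n w \<in> carrier (GL n)" "segment n c c' t \<in> carrier (GL n)"
      using GL_mult_cancel[OF mult_carrier_square[OF segment_carrier perm_matrix_carrier] segment_carrier G] by auto
    moreover from this(1) have "segment n b b' t \<in> carrier (GL n)"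
      using GL_mult_cancel(1)[OF segment_carrier perm_matrix_carrier] by blast
    ultimately show ?thesis
      using tri[OF bc(2,5), of t] tri[OF bc(3,6), of t] unfolding cell_def by (auto simp: borel_upper_iff)
  qed
  then have "{t. ?\<gamma> t \<notin> cell n w} \<subseteq> {t. ?\<gamma> t \<notin> carrier (GL n)}" by blast
  moreover have "g \<in> carrier (GL n)" using \<open>g \<in> cell n w\<close> cell_GL[OF w] by blast
  then have "finite {t. ?\<gamma> t \<notin> carrier (GL n)}"
    using cofinite_curve[OF \<gamma>, of "carrier (GL n)" 0] ends(1) openin_topspace[of "zariski_GL n"]
    by (simp add: topspace_zariski_GL)
  ultimately have "finite {t. ?\<gamma> t \<notin> cell n w}" by (rule finite_subset)
  then show "\<exists>\<gamma>. matrix_over (range poly) n \<gamma> \<and> \<gamma> 0 = g \<and> \<gamma> 1 = h \<and> finite {t. \<gamma> t \<notin> cell n w}"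
    using \<gamma> ends by blast
qed

section \<open>The dimension of the general linear group\<close>

text \<open>
  The exponents are listed from the last function down to the first. This suits the induction along
  a chain of irreducible sets, which splits off the last function.
\<close>

fun list_monomial :: "(nat \<Rightarrow> 'a \<Rightarrow> complex) \<Rightarrow> nat list \<Rightarrow> 'a \<Rightarrow> complex" where
  "list_monomial f [] x = 1"
| "list_monomial f (a # xs) x = f (length xs) x ^ a * list_monomial f xs x"

definition exponents :: "nat \<Rightarrow> nat \<Rightarrow> nat list set" where
  "exponents k M = {xs. set xs \<subseteq> {..M} \<and> length xs = k}"

lemma finite_exponents: "finite (exponents k M)"
  unfolding exponents_def by (rule finite_lists_length_eq) simp

lemma card_exponents: "card (exponents k M) = Suc M ^ k"
  unfolding exponents_def by (subst card_lists_length_eq) simp_all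

lemma exponents_0: "exponents 0 M = {[]}"
  by (auto simp: exponents_def)

lemma sum_exponents_Suc:
  "(\<Sum>xs\<in>exponents (Suc k) M. h xs) = (\<Sum>a\<in>{..M}. \<Sum>xs\<in>exponents k M. h (a # xs) :: complex)"
proof -
  have "exponents (Suc k) M = (\<lambda>(a, xs). a # xs) ` ({..M} \<times> exponents k M)"
  proof (intro equalityI subsetI)
    fix xs assume "xs \<in> exponents (Suc k) M"
    then show "xs \<in> (\<lambda>(a, xs). a # xs) ` ({..M} \<times> exponents k M)"
      by (cases xs) (auto simp: exponents_def)
  qed (auto simp: exponents_def)
  moreover have "inj_on (\<lambda>(a, xs). a # xs) ({..M} \<times> exponents k M)" by (auto simp: inj_on_def)
  ultimately have "(\<Sum>xs\<in>exponents (Suc k) M. h xs) = (\<Sum>(a, xs)\<in>{..M} \<times> exponents k M. h (a # xs))"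
    by (simp add: sum.reindex case_prod_unfold)
  then show ?thesis by (simp add: sum.cartesian_product)
qed

lemma list_monomial_polynomial:
  "(\<And>i. i < length xs \<Longrightarrow> f i \<in> polynomial_functions n) \<Longrightarrow> list_monomial f xs \<in> polynomial_functions n"
proof (induction xs)
  case Nil
  then show ?case using polynomial_functions.const[of 1 n] by simp
next
  case (Cons a xs)
  have "(\<lambda>x. f (length xs) x ^ a) \<in> polynomial_functions n"
  proof (induction a)
    case 0
    then show ?case using polynomial_functions.const[of 1 n] by simp
  next
    case (Suc a)
    then show ?case using polynomial_functions.mult[OF Cons.prems[of "length xs"] Suc] by simp
  qed
  then show ?case using polynomial_functions.mult[OF _ Cons.IH] Cons.prems by simp
qed

text \<open>
  If \<open>f i\<close> vanishes on \<open>Z i\<close> but not on \<open>Z (Suc i)\<close>, then \<open>f 0, \<dots>, f (k - 1)\<close> are algebraically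
  independent on \<open>Z k\<close>: divide a relation by the largest power of the last function dividing it,
  which is allowed as \<open>Z k\<close> is irreducible, and restrict the quotient to the next smaller set, where the
  last function vanishes.
\<close>

lemma chain_functions_independent:
  assumes Z: "\<And>i. i \<le> k \<Longrightarrow> irreducible_in (zariski_GL n) (Z i)" "\<And>i. i < k \<Longrightarrow> Z i \<subseteq> Z (Suc i)"
    and f: "\<And>i. i < k \<Longrightarrow> f i \<in> polynomial_functions n" "\<And>i x. i < k \<Longrightarrow> x \<in> Z i \<Longrightarrow> f i x = 0"
      "\<And>i. i < k \<Longrightarrow> \<exists>x\<in>Z (Suc i). f i x \<noteq> 0"
    and zero: "\<And>x. x \<in> Z k \<Longrightarrow> (\<Sum>xs\<in>exponents k M. c xs * list_monomial f xs x) = 0"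
  shows "\<forall>xs\<in>exponents k M. c xs = 0"
  using assms
proof (induction k arbitrary: c)
  case 0
  then obtain x where "x \<in> Z 0" by (metis irreducible_in_def all_not_in_conv le_refl)
  then show ?case using "0.prems"(6) by (simp add: exponents_0)
next
  case (Suc k)
  define S where "S a x = (\<Sum>xs\<in>exponents k M. c (a # xs) * list_monomial f xs x)" for a x
  have S_poly: "S a \<in> polynomial_functions n" for a
    unfolding S_def
    using Suc.prems(3) by (intro function_ring_sum[OF function_ring_polynomial_functions]
        function_ring_mult[OF function_ring_polynomial_functions] function_ring_const[OF function_ring_polynomial_functions]
        list_monomial_polynomial) (auto simp: exponents_def)
  have f_poly: "(\<lambda>x. f k x ^ a) \<in> polynomial_functions n" for a
    using function_ring_prod[OF function_ring_polynomial_functions, of "{..<a}" "\<lambda>_. f k"] Suc.prems(3)[of k] by simp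
  have IH: "\<forall>xs\<in>exponents k M. c' xs = 0"
    if "\<And>x. x \<in> Z k \<Longrightarrow> (\<Sum>xs\<in>exponents k M. c' xs * list_monomial f xs x) = 0" for c'
    by (rule Suc.IH) (use Suc.prems that in auto)
  show ?case
  proof (rule ccontr)
    assume "\<not> ?case"
    then obtain ys where ys: "ys \<in> exponents (Suc k) M" "c ys \<noteq> 0" by blast
    then have "\<exists>a. a \<le> M \<and> (\<exists>xs\<in>exponents k M. c (a # xs) \<noteq> 0)"
      by (cases ys) (auto simp: exponents_def)
    define a0 where "a0 = (LEAST a. a \<le> M \<and> (\<exists>xs\<in>exponents k M. c (a # xs) \<noteq> 0))"
    have a0: "a0 \<le> M" "\<exists>xs\<in>exponents k M. c (a0 # xs) \<noteq> 0"
      using LeastI_ex[OF \<open>\<exists>a. a \<le> M \<and> (\<exists>xs\<in>exponents k M. c (a # xs) \<noteq> 0)\<close>] unfolding a0_def by auto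
    have below: "S a x = 0" if "a < a0" for a x
      using not_less_Least[OF that[unfolded a0_def]] that a0(1) unfolding S_def by (intro sum.neutral) auto
    \<comment> \<open>the relation divided by the power \<open>a0\<close> of the last function\<close>
    define Q where "Q x = (\<Sum>a\<in>{a0..M}. f k x ^ (a - a0) * S a x)" for x
    have Q_poly: "Q \<in> polynomial_functions n"
      unfolding Q_def by (intro function_ring_sum[OF function_ring_polynomial_functions]
          function_ring_mult[OF function_ring_polynomial_functions] f_poly S_poly)
    have "f k x ^ a0 * Q x = 0" if x: "x \<in> Z (Suc k)" for x
    proof -
      have "0 = (\<Sum>a\<in>{..M}. \<Sum>xs\<in>exponents k M. c (a # xs) * list_monomial f (a # xs) x)"
        using Suc.prems(6)[OF x] by (simp only: sum_exponents_Suc)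
      also have "\<dots> = (\<Sum>a\<in>{..M}. f k x ^ a * S a x)"
        unfolding S_def sum_distrib_left by (intro sum.cong) (auto simp: exponents_def)
      also have "\<dots> = (\<Sum>a\<in>{a0..M}. f k x ^ a * S a x)"
        using below by (intro sum.mono_neutral_right) (auto simp: not_le)
      also have "\<dots> = f k x ^ a0 * Q x"
        unfolding Q_def sum_distrib_left
        by (intro sum.cong) (auto simp: mult.assoc[symmetric] power_add[symmetric])
      finally show ?thesis by simp
    qed
    moreover have "Z (Suc k) \<subseteq> carrier (GL n)"
      using Suc.prems(1)[of "Suc k"] by (simp add: irreducible_in_def topspace_zariski_GL)
    ultimately have "Z (Suc k) \<subseteq> {g \<in> carrier (GL n). f k g = 0} \<union> {g \<in> carrier (GL n). Q g = 0}" by auto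
    then have "Z (Suc k) \<subseteq> {g \<in> carrier (GL n). f k g = 0} \<or> Z (Suc k) \<subseteq> {g \<in> carrier (GL n). Q g = 0}"
      using Suc.prems(3)[of k] Q_poly
      by (intro irreducible_inD[OF Suc.prems(1)[of "Suc k"]] closedin_zariski_GL_zero) auto
    then have Q0: "Q x = 0" if "x \<in> Z (Suc k)" for x using Suc.prems(5)[of k] that by auto
    have "(\<Sum>xs\<in>exponents k M. c (a0 # xs) * list_monomial f xs x) = 0" if x: "x \<in> Z k" for x
    proof -
      have "Q x = (\<Sum>a\<in>{a0}. f k x ^ (a - a0) * S a x)"
        unfolding Q_def using Suc.prems(4)[of k x] x a0(1) by (intro sum.mono_neutral_right) auto
      then show ?thesis using Q0 Suc.prems(2)[of k] x by (auto simp: S_def)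
    qed
    then have "\<forall>xs\<in>exponents k M. c (a0 # xs) = 0" by (rule IH)
    then show False using a0(2) by blast
  qed
qed

text \<open>
  Gaussian elimination: an equation with a nonzero coefficient eliminates one unknown.
\<close>

lemma underdetermined_system:
  fixes a :: "'x \<Rightarrow> 'y \<Rightarrow> complex"
  assumes "finite Y" "finite X" "card Y < card X"
  shows "\<exists>c. (\<exists>x\<in>X. c x \<noteq> 0) \<and> (\<forall>y\<in>Y. (\<Sum>x\<in>X. c x * a x y) = 0)"
  using assms
proof (induction Y arbitrary: X a rule: finite_induct)
  case empty
  then have "X \<noteq> {}" by auto
  then show ?case by (intro exI[of _ "\<lambda>_. 1"]) auto
next
  case (insert y Y)
  show ?case
  proof (cases "\<forall>x\<in>X. a x y = 0")
    case True
    have "card Y < card X" using insert.prems insert.hyps by simp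
    then obtain c where "(\<exists>x\<in>X. c x \<noteq> 0)" "(\<forall>y\<in>Y. (\<Sum>x\<in>X. c x * a x y) = 0)"
      using insert.IH[OF insert.prems(1)] by blast
    then show ?thesis using True by (intro exI[of _ c]) auto
  next
    case False
    then obtain x0 where x0: "x0 \<in> X" "a x0 y \<noteq> 0" by blast
    let ?X = "X - {x0}"
    have "card Y < card ?X" using insert.prems insert.hyps x0(1) by simp
    then obtain c where c: "\<exists>x\<in>?X. c x \<noteq> 0"
      "\<forall>z\<in>Y. (\<Sum>x\<in>?X. c x * (a x z - a x y / a x0 y * a x0 z)) = 0"
      using insert.IH[of ?X "\<lambda>x z. a x z - a x y / a x0 y * a x0 z"] insert.prems(1) by auto
    define s where "s = (\<Sum>x\<in>?X. c x * a x y) / a x0 y"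
    define c' where "c' = c(x0 := - s)"
    have sum: "(\<Sum>x\<in>X. c' x * a x z) = (\<Sum>x\<in>?X. c x * a x z) - s * a x0 z" for z
    proof -
      have "(\<Sum>x\<in>X. c' x * a x z) = c' x0 * a x0 z + (\<Sum>x\<in>?X. c' x * a x z)"
        by (rule sum.remove[OF insert.prems(1) x0(1)])
      also have "(\<Sum>x\<in>?X. c' x * a x z) = (\<Sum>x\<in>?X. c x * a x z)"
        by (intro sum.cong) (auto simp: c'_def)
      finally show ?thesis by (simp add: c'_def)
    qed
    have "(\<Sum>x\<in>X. c' x * a x z) = 0" if z: "z \<in> insert y Y" for z
    proof (cases "z = y")
      case True
      then show ?thesis unfolding sum s_def using x0(2) by simp
    next
      case False
      then have "(\<Sum>x\<in>?X. c x * (a x z - a x y / a x0 y * a x0 z)) = 0" using z c(2) by blast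
      then have "(\<Sum>x\<in>?X. c x * a x z) - (\<Sum>x\<in>?X. c x * (a x y / a x0 y * a x0 z)) = 0"
        by (simp add: right_diff_distrib sum_subtractf)
      moreover have "(\<Sum>x\<in>?X. c x * (a x y / a x0 y * a x0 z)) = s * a x0 z"
        unfolding s_def sum_divide_distrib sum_distrib_right by (intro sum.cong) auto
      ultimately show ?thesis unfolding sum by simp
    qed
    moreover have "\<exists>x\<in>X. c' x \<noteq> 0" using c(1) by (auto simp: c'_def)
    ultimately show ?thesis by blast
  qed
qed

definition coordinate :: "nat \<Rightarrow> nat \<Rightarrow> complex mat \<Rightarrow> complex" where
  "coordinate n k g = g $$ (k div n, k mod n)"

text \<open>
  Bounding each exponent separately, instead of the total degree, makes the number of monomials a
  plain power.
\<close>

inductive_set degree_le :: "nat \<Rightarrow> nat \<Rightarrow> (complex mat \<Rightarrow> complex) set" for n D where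
  monomial: "xs \<in> exponents (n * n) D \<Longrightarrow> (\<lambda>g. c * list_monomial (coordinate n) xs g) \<in> degree_le n D"
| add: "p \<in> degree_le n D \<Longrightarrow> q \<in> degree_le n D \<Longrightarrow> (\<lambda>g. p g + q g) \<in> degree_le n D"

lemma degree_le_mono:
  assumes "p \<in> degree_le n D" "D \<le> E"
  shows "p \<in> degree_le n E"
  using assms(1)
proof induction
  case (monomial xs c)
  have "xs \<in> exponents (n * n) E" using monomial assms(2) by (auto simp: exponents_def)
  then show ?case by (rule degree_le.monomial)
qed (rule degree_le.add)

lemma list_monomial_add:
  "length xs = length ys \<Longrightarrow>
   list_monomial f (map2 (+) xs ys) x = list_monomial f xs x * list_monomial f ys x"
  by (induction xs ys rule: list_induct2) (auto simp: power_add)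

lemma exponents_add:
  assumes "xs \<in> exponents k D" "ys \<in> exponents k E"
  shows "map2 (+) xs ys \<in> exponents k (D + E)"
proof -
  have "a + b \<le> D + E" if "(a, b) \<in> set (zip xs ys)" for a b
    using set_zip_leftD[OF that] set_zip_rightD[OF that] assms by (auto simp: exponents_def intro!: add_mono)
  then show ?thesis using assms by (auto simp: exponents_def)
qed

lemma degree_le_mult:
  assumes "p \<in> degree_le n D" "q \<in> degree_le n E"
  shows "(\<lambda>g. p g * q g) \<in> degree_le n (D + E)"
  using assms(1)
proof induction
  case (monomial xs c)
  show ?case using assms(2)
  proof induction
    case (monomial ys d)
    have "length xs = length ys" using \<open>xs \<in> _\<close> monomial by (simp add: exponents_def)
    then have "(\<lambda>g. c * list_monomial (coordinate n) xs g * (d * list_monomial (coordinate n) ys g)) =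
      (\<lambda>g. (c * d) * list_monomial (coordinate n) (map2 (+) xs ys) g)"
      by (simp add: list_monomial_add mult_ac)
    then show ?case using degree_le.monomial[OF exponents_add[OF \<open>xs \<in> _\<close> monomial], of "c * d"] by simp
  next
    case (add p q)
    then show ?case using degree_le.add[OF add.IH] by (simp add: distrib_left)
  qed
next
  case (add p q)
  then show ?case using degree_le.add[OF add.IH] by (simp add: distrib_right)
qed

lemma list_monomial_zeros: "list_monomial f (replicate m 0 @ xs) x = list_monomial f xs x"
  by (induction m) auto

lemma degree_le_const: "(\<lambda>_. c) \<in> degree_le n 0"
proof -
  have "replicate (n * n) 0 \<in> exponents (n * n) 0" by (auto simp: exponents_def)
  from degree_le.monomial[OF this, of c] show ?thesis
    using list_monomial_zeros[of "coordinate n" "n * n" "[]"] by simp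
qed

lemma degree_le_coordinate:
  assumes "k < n * n"
  shows "coordinate n k \<in> degree_le n 1"
proof -
  let ?xs = "replicate (n * n - 1 - k) 0 @ 1 # replicate k 0"
  have "?xs \<in> exponents (n * n) 1" using assms by (auto simp: exponents_def)
  from degree_le.monomial[OF this, of 1] have "(\<lambda>g. list_monomial (coordinate n) ?xs g) \<in> degree_le n 1" by simp
  moreover have "list_monomial (coordinate n) ?xs g = coordinate n k g" for g
    using list_monomial_zeros[of "coordinate n" k "[]" g] by (simp add: list_monomial_zeros)
  ultimately show ?thesis by simp
qed

lemma polynomial_functions_degree_le:
  assumes "p \<in> polynomial_functions n"
  shows "\<exists>D. p \<in> degree_le n D"
  using assms
proof induction
  case (const c)
  then show ?case using degree_le_const by blast
next
  case (entry i j)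
  have "i * n + j < n * n"
  proof -
    have "i * n + j < Suc i * n" using entry by simp
    also have "\<dots> \<le> n * n" using entry by (intro mult_le_mono1) simp
    finally show ?thesis .
  qed
  moreover have "coordinate n (i * n + j) = (\<lambda>g. g $$ (i, j))" using entry by (simp add: coordinate_def fun_eq_iff)
  ultimately show ?case using degree_le_coordinate by metis
next
  case (add p q)
  then obtain D E where "p \<in> degree_le n D" "q \<in> degree_le n E" by blast
  then have "p \<in> degree_le n (D + E)" "q \<in> degree_le n (D + E)" by (auto intro: degree_le_mono)
  then show ?case by (blast intro: degree_le.add)
next
  case (mult p q)
  then show ?case by (blast intro: degree_le_mult)
qed

lemma degree_le_list_monomial:
  assumes "\<And>i. i < length xs \<Longrightarrow> f i \<in> degree_le n D" "set xs \<subseteq> {..M}"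
  shows "list_monomial f xs \<in> degree_le n (length xs * (M * D))"
  using assms
proof (induction xs)
  case Nil
  then show ?case using degree_le_const[of 1 n] by simp
next
  case (Cons a xs)
  have "(\<lambda>x. f (length xs) x ^ b) \<in> degree_le n (b * D)" for b
  proof (induction b)
    case 0
    then show ?case using degree_le_const[of 1 n] by simp
  next
    case (Suc b)
    then show ?case using degree_le_mult[OF Cons.prems(1)[of "length xs"] Suc] by (simp add: add.commute)
  qed
  then have "(\<lambda>x. f (length xs) x ^ a) \<in> degree_le n (M * D)"
    by (rule degree_le_mono) (use Cons.prems(2) in auto)
  then have "(\<lambda>x. f (length xs) x ^ a * list_monomial f xs x) \<in> degree_le n (M * D + length xs * (M * D))"
    using Cons by (intro degree_le_mult) auto
  then show ?case by simp
qed

lemma degree_le_coefficients: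
  assumes "p \<in> degree_le n D"
  shows "\<exists>a. \<forall>g. p g = (\<Sum>ys\<in>exponents (n * n) D. a ys * list_monomial (coordinate n) ys g)"
  using assms
proof induction
  case (monomial xs c)
  have "c * list_monomial (coordinate n) xs g =
      (\<Sum>ys\<in>exponents (n * n) D. (if ys = xs then c else 0) * list_monomial (coordinate n) ys g)" for g
  proof -
    have "(\<Sum>ys\<in>exponents (n * n) D. (if ys = xs then c else 0) * list_monomial (coordinate n) ys g) =
      (\<Sum>ys\<in>{xs}. (if ys = xs then c else 0) * list_monomial (coordinate n) ys g)"
      using monomial finite_exponents by (intro sum.mono_neutral_right) auto
    then show ?thesis by simp
  qed
  then show ?case by (intro exI[of _ "\<lambda>ys. if ys = xs then c else 0"] allI)
next
  case (add p q)
  then obtain a b where "\<forall>g. p g = (\<Sum>ys\<in>exponents (n * n) D. a ys * list_monomial (coordinate n) ys g)"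
    "\<forall>g. q g = (\<Sum>ys\<in>exponents (n * n) D. b ys * list_monomial (coordinate n) ys g)" by blast
  then show ?case by (intro exI[of _ "\<lambda>ys. a ys + b ys"]) (simp add: distrib_right sum.distrib)
qed

text \<open>
  A chain of length \<open>k\<close> gives \<open>k\<close> algebraically independent polynomials in \<open>n\<^sup>2\<close> coordinates. Their
  \<open>(M + 1) ^ k\<close> monomials with exponents at most \<open>M\<close> are linearly independent, but are combinations of
  \<open>(C + 1) ^ (n * n)\<close> monomials in the coordinates, where \<open>C\<close> grows linearly in \<open>M\<close>.
\<close>

lemma has_chain_zariski_GL_le:
  assumes "has_chain (zariski_GL n) k Y"
  shows "k \<le> n * n"
proof (rule ccontr)
  assume k: "\<not> k \<le> n * n"
  obtain Z where Z: "\<forall>i\<le>k. closedin (zariski_GL n) (Z i)" "\<forall>i\<le>k. irreducible_in (zariski_GL n) (Z i)"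
    "\<forall>i<k. Z i \<subset> Z (Suc i)" "Z k \<subseteq> Y"
    using assms by (rule has_chainE)
  have "\<exists>p. p \<in> polynomial_functions n \<and> (\<forall>x\<in>Z i. p x = 0) \<and> (\<exists>x\<in>Z (Suc i). p x \<noteq> 0)" if i: "i < k" for i
  proof -
    obtain g where g: "g \<in> Z (Suc i)" "g \<notin> Z i" using Z(3) i by blast
    have "Z (Suc i) \<subseteq> topspace (zariski_GL n)" using Z(1) i closedin_subset by (metis Suc_leI)
    then have "g \<in> carrier (GL n)" using g by (auto simp: topspace_zariski_GL)
    moreover have "closedin (zariski_GL n) (Z i)" using Z(1) i by simp
    ultimately obtain p where "p \<in> polynomial_functions n" "p g \<noteq> 0" "\<And>h. h \<in> Z i \<Longrightarrow> p h = 0"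
      using g(2) by (metis zariski_GL_separation)
    then show ?thesis using g(1) by (intro exI[of _ p]) auto
  qed
  then obtain f where f: "\<And>i. i < k \<Longrightarrow> f i \<in> polynomial_functions n" "\<And>i x. i < k \<Longrightarrow> x \<in> Z i \<Longrightarrow> f i x = 0"
    "\<And>i. i < k \<Longrightarrow> \<exists>x\<in>Z (Suc i). f i x \<noteq> 0"
    by metis
  have "\<exists>D. f i \<in> degree_le n D" if "i < k" for i using polynomial_functions_degree_le f(1) that by blast
  then obtain d where d: "\<And>i. i < k \<Longrightarrow> f i \<in> degree_le n (d i)" by metis
  define D where "D = (\<Sum>i<k. d i)"
  have "d i \<le> D" if "i < k" for i unfolding D_def using that by (intro member_le_sum) auto
  then have fD: "f i \<in> degree_le n D" if "i < k" for i using d degree_le_mono that by blast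
  \<comment> \<open>\<open>(M + 1) ^ k\<close> outgrows the number of monomials with exponents at most \<open>k * M * D\<close>\<close>
  define A where "A = Suc (k * D)"
  define M where "M = A ^ (n * n)"
  define C where "C = k * (M * D)"
  have "Suc C \<le> A * Suc M" unfolding C_def A_def by (simp add: algebra_simps)
  then have "Suc C ^ (n * n) \<le> A ^ (n * n) * Suc M ^ (n * n)"
    by (metis power_mono power_mult_distrib zero_le)
  also have "\<dots> < Suc M * Suc M ^ (n * n)" unfolding M_def[symmetric] by simp
  also have "\<dots> = Suc M ^ Suc (n * n)" by simp
  also have "\<dots> \<le> Suc M ^ k" using k by (intro power_increasing) auto
  finally have card: "card (exponents (n * n) C) < card (exponents k M)" by (simp add: card_exponents)
  have "list_monomial f xs \<in> degree_le n C" if "xs \<in> exponents k M" for xs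
    using degree_le_list_monomial[of xs f n D M] fD that unfolding C_def by (auto simp: exponents_def)
  then have "\<forall>xs\<in>exponents k M. \<exists>a. \<forall>g. list_monomial f xs g =
      (\<Sum>ys\<in>exponents (n * n) C. a ys * list_monomial (coordinate n) ys g)"
    using degree_le_coefficients by blast
  then obtain a where a: "\<And>xs g. xs \<in> exponents k M \<Longrightarrow> list_monomial f xs g =
      (\<Sum>ys\<in>exponents (n * n) C. a xs ys * list_monomial (coordinate n) ys g)"
    by metis
  obtain c where c: "\<exists>xs\<in>exponents k M. c xs \<noteq> 0"
    "\<forall>ys\<in>exponents (n * n) C. (\<Sum>xs\<in>exponents k M. c xs * a xs ys) = 0"
    using underdetermined_system[OF finite_exponents finite_exponents card, of a] by blast
  have "(\<Sum>xs\<in>exponents k M. c xs * list_monomial f xs g) = 0" for g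
  proof -
    have "(\<Sum>xs\<in>exponents k M. c xs * list_monomial f xs g) =
      (\<Sum>xs\<in>exponents k M. \<Sum>ys\<in>exponents (n * n) C. c xs * a xs ys * list_monomial (coordinate n) ys g)"
      by (intro sum.cong refl) (simp add: a sum_distrib_left mult.assoc)
    also have "\<dots> = (\<Sum>ys\<in>exponents (n * n) C. (\<Sum>xs\<in>exponents k M. c xs * a xs ys) * list_monomial (coordinate n) ys g)"
      by (subst sum.swap) (simp add: sum_distrib_right)
    also have "\<dots> = 0" using c(2) by simp
    finally show ?thesis .
  qed
  then have "\<forall>xs\<in>exponents k M. c xs = 0"
    by (intro chain_functions_independent[where k = k and n = n and Z = Z and f = f and M = M and c = c] f) (use Z in auto)
  then show False using c(1) by blast
qed

section \<open>Chains inside a Borel coset\<close>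

text \<open>
  Inside the coset of \<open>g\<close>, only the entries in \<open>E\<close> of the second factor may differ from the unit matrix.
  Enlarging \<open>E\<close> position by position gives a chain that ends with the whole coset of the Borel group.
\<close>

definition coset_flat :: "nat \<Rightarrow> complex mat \<Rightarrow> (nat \<times> nat) set \<Rightarrow> complex mat set" where
  "coset_flat n g E = {g * h | h. h \<in> carrier (GL n) \<and> (\<forall>i<n. \<forall>j<n. (i, j) \<notin> E \<longrightarrow> h $$ (i, j) = 1\<^sub>m n $$ (i, j))}"

lemma coset_flat_mono: "E \<subseteq> E' \<Longrightarrow> coset_flat n g E \<subseteq> coset_flat n g E'"
  unfolding coset_flat_def by blast

lemma GL_left_cancel:
  assumes "g \<in> carrier (GL n)" "a \<in> carrier_mat n n" "b \<in> carrier_mat n n" "g * a = g * b"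
  shows "a = b"
proof -
  obtain g' where g': "g' \<in> carrier (GL n)" "g' * g = 1\<^sub>m n" using GL_inverse[OF assms(1)] by blast
  have "g' * (g * a) = g' * (g * b)" by (simp add: assms(4))
  then show ?thesis
    using g' assms(1-3)
    by (simp add: mat_assoc[of _ n, symmetric] GL_carrier_mat one_mult_square[of _ n])
qed

lemma closedin_coset_flat:
  assumes g: "g \<in> carrier (GL n)"
  shows "closedin (zariski_GL n) (coset_flat n g E)"
proof -
  obtain g' where g': "g' \<in> carrier (GL n)" "g * g' = 1\<^sub>m n" "g' * g = 1\<^sub>m n" using GL_inverse[OF g] by blast
  define K where "K = {h \<in> carrier (GL n). \<forall>i<n. \<forall>j<n. (i, j) \<notin> E \<longrightarrow> h $$ (i, j) = 1\<^sub>m n $$ (i, j)}"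
  have "openin (zariski_GL n) (carrier (GL n) - K)"
    unfolding openin_zariski_GL_iff
  proof (intro conjI ballI)
    fix h assume "h \<in> carrier (GL n) - K"
    then obtain i j where ij: "i < n" "j < n" "(i, j) \<notin> E" "h $$ (i, j) \<noteq> 1\<^sub>m n $$ (i, j)"
      unfolding K_def by blast
    have "(\<lambda>h. h $$ (i, j) + - (1\<^sub>m n $$ (i, j))) \<in> polynomial_functions n"
      using ij by (intro polynomial_functions.intros)
    then show "\<exists>p\<in>polynomial_functions n. p h \<noteq> 0 \<and> {h \<in> carrier (GL n). p h \<noteq> 0} \<subseteq> carrier (GL n) - K"
      using ij unfolding K_def by (intro bexI[of _ "\<lambda>h. h $$ (i, j) + - (1\<^sub>m n $$ (i, j))"]) auto
  qed auto
  moreover have "K \<subseteq> carrier (GL n)" unfolding K_def by blast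
  ultimately have K: "closedin (zariski_GL n) K" by (simp add: closedin_def topspace_zariski_GL)
  have "closedin (zariski_GL n) {x \<in> topspace (zariski_GL n). g' * x * 1\<^sub>m n \<in> K}"
    using closedin_continuous_map_preimage[OF continuous_map_translations[OF g'(1) one_in_GL] K] .
  moreover have "{x \<in> topspace (zariski_GL n). g' * x * 1\<^sub>m n \<in> K} = coset_flat n g E"
  proof (intro equalityI subsetI)
    fix x assume "x \<in> {x \<in> topspace (zariski_GL n). g' * x * 1\<^sub>m n \<in> K}"
    then have x: "x \<in> carrier (GL n)" "g' * x * 1\<^sub>m n \<in> K" by (simp_all add: topspace_zariski_GL)
    have "g' * x * 1\<^sub>m n = g' * x"
      by (rule one_mult_square(2)[OF GL_carrier_mat[OF GL_mult_closed[OF g'(1) x(1)]]])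
    with x have x: "x \<in> carrier (GL n)" "g' * x \<in> K" by simp_all
    have "x = g * (g' * x)"
      using g g' x(1) by (simp add: mat_assoc[of _ n, symmetric] GL_carrier_mat one_mult_square[of _ n])
    then show "x \<in> coset_flat n g E" using x(2) unfolding coset_flat_def K_def by blast
  next
    fix x assume "x \<in> coset_flat n g E"
    then obtain h where h: "x = g * h" "h \<in> K" "h \<in> carrier (GL n)" unfolding coset_flat_def K_def by blast
    have "g' * x * 1\<^sub>m n = h"
      unfolding h(1) using g g' h(3)
      by (simp add: mat_assoc[of _ n, symmetric] GL_carrier_mat one_mult_square[of _ n] mult_carrier_square[of _ n])
    then show "x \<in> {x \<in> topspace (zariski_GL n). g' * x * 1\<^sub>m n \<in> K}"
      using h GL_mult_closed[OF g h(3)] by (simp add: topspace_zariski_GL)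
  qed
  ultimately show ?thesis by simp
qed

text \<open>
  The segment between two points stays in the set as long as it is invertible.
\<close>

lemma irreducible_in_coset_flat:
  assumes g: "g \<in> carrier (GL n)"
  shows "irreducible_in (zariski_GL n) (coset_flat n g E)"
proof (rule irreducible_in_zariski_GL_curves)
  show "coset_flat n g E \<subseteq> carrier (GL n)" using GL_mult_closed[OF g] by (auto simp: coset_flat_def)
  have "g * 1\<^sub>m n \<in> coset_flat n g E" unfolding coset_flat_def using one_in_GL by blast
  then show "coset_flat n g E \<noteq> {}" by blast
  fix x y assume "x \<in> coset_flat n g E" "y \<in> coset_flat n g E"
  then obtain h k where hk: "x = g * h" "y = g * k" "h \<in> carrier (GL n)" "k \<in> carrier (GL n)"
    "\<forall>i<n. \<forall>j<n. (i, j) \<notin> E \<longrightarrow> h $$ (i, j) = 1\<^sub>m n $$ (i, j)"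
    "\<forall>i<n. \<forall>j<n. (i, j) \<notin> E \<longrightarrow> k $$ (i, j) = 1\<^sub>m n $$ (i, j)"
    unfolding coset_flat_def by blast
  let ?\<gamma> = "\<lambda>t. g * segment n h k t"
  have \<gamma>: "matrix_over (range poly) n ?\<gamma>"
    by (intro matrix_over_mult function_ring_poly matrix_over_segment matrix_over_const GL_carrier_mat g)
  have ends: "?\<gamma> 0 = x" "?\<gamma> 1 = y"
    using hk segment_endpoints GL_carrier_mat by auto
  have "?\<gamma> t \<in> coset_flat n g E" if "?\<gamma> t \<in> carrier (GL n)" for t
  proof -
    have "segment n h k t \<in> carrier (GL n)"
      using GL_mult_cancel(2)[OF GL_carrier_mat[OF g] segment_carrier that] .
    moreover have "\<forall>i<n. \<forall>j<n. (i, j) \<notin> E \<longrightarrow> segment n h k t $$ (i, j) = 1\<^sub>m n $$ (i, j)"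
      using hk(5,6) by (simp add: segment_def)
    ultimately show ?thesis unfolding coset_flat_def by blast
  qed
  then have "{t. ?\<gamma> t \<notin> coset_flat n g E} \<subseteq> {t. ?\<gamma> t \<notin> carrier (GL n)}" by blast
  moreover have "x \<in> carrier (GL n)" using GL_mult_closed[OF g hk(3)] hk(1) by simp
  then have "finite {t. ?\<gamma> t \<notin> carrier (GL n)}"
    using cofinite_curve[OF \<gamma>, of "carrier (GL n)" 0] ends(1) openin_topspace[of "zariski_GL n"]
    by (simp add: topspace_zariski_GL)
  ultimately have "finite {t. ?\<gamma> t \<notin> coset_flat n g E}" by (rule finite_subset)
  then show "\<exists>\<gamma>. matrix_over (range poly) n \<gamma> \<and> \<gamma> 0 = x \<and> \<gamma> 1 = y \<and> finite {t. \<gamma> t \<notin> coset_flat n g E}"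
    using \<gamma> ends by blast
qed

lemma coset_flat_insert:
  assumes g: "g \<in> carrier (GL n)" and ij: "i \<le> j" "j < n" "(i, j) \<notin> E"
  shows "coset_flat n g E \<subset> coset_flat n g (insert (i, j) E)"
proof
  show "coset_flat n g E \<subseteq> coset_flat n g (insert (i, j) E)" by (rule coset_flat_mono) blast
  define h :: "complex mat" where
    "h = mat n n (\<lambda>(k, l). (if k = l then 1 else 0) + (if k = i \<and> l = j then 1 else 0))"
  have "h \<in> carrier (GL n)"
    by (rule triangular_wrt_GL[OF _ _ inj_neg_int]) (use ij in \<open>auto simp: h_def triangular_wrt_def split: if_splits\<close>)
  then have "g * h \<in> coset_flat n g (insert (i, j) E)"
    unfolding coset_flat_def by (intro CollectI exI[of _ h]) (auto simp: h_def)
  moreover have "g * h \<notin> coset_flat n g E"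
  proof
    assume "g * h \<in> coset_flat n g E"
    then obtain k where k: "g * h = g * k" "k \<in> carrier (GL n)" "k $$ (i, j) = 1\<^sub>m n $$ (i, j)"
      using ij unfolding coset_flat_def by auto
    have "h = k" using GL_left_cancel[OF g _ _ k(1)] k(2) by (simp add: GL_carrier_mat h_def)
    then show False using k(3) ij by (auto simp: h_def split: if_splits)
  qed
  ultimately show "coset_flat n g E \<noteq> coset_flat n g (insert (i, j) E)" by metis
qed

lemma has_chain_coset_flat:
  assumes g: "g \<in> carrier (GL n)" and E: "E \<subseteq> {(i, j). i \<le> j \<and> j < n}"
  shows "has_chain (zariski_GL n) (card E) (coset_flat n g E)"
proof -
  have "finite E" by (rule finite_subset[OF E], rule finite_subset[of _ "{..<n} \<times> {..<n}"]) auto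
  then show ?thesis using E
  proof induction
    case empty
    show ?case using has_chain_0[OF closedin_coset_flat[OF g] irreducible_in_coset_flat[OF g]] by simp
  next
    case (insert e E)
    obtain i j where e: "e = (i, j)" "i \<le> j" "j < n" using insert.prems by auto
    have "coset_flat n g E \<subset> coset_flat n g (insert e E)"
      unfolding e(1) using coset_flat_insert[OF g e(2,3)] insert.hyps(2) e(1) by simp
    then have "has_chain (zariski_GL n) (Suc (card E)) (coset_flat n g (insert e E))"
      using insert.prems by (intro has_chain_Suc[OF insert.IH closedin_coset_flat[OF g] irreducible_in_coset_flat[OF g]]) simp_all
    then show ?case using insert.hyps by simp
  qed
qed

section \<open>The projection to the flag variety\<close>

definition flag :: "nat \<Rightarrow> complex mat \<Rightarrow> complex mat set" where
  "flag n g = g <#\<^bsub>GL n\<^esub> borel_upper n"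

lemma flag_eq: "flag n g = {g * b | b. b \<in> borel_upper n}"
  unfolding flag_def l_coset_def by (auto simp: mult_GL)

lemma coset_flat_borel:
  assumes "g \<in> carrier (GL n)"
  shows "coset_flat n g {(i, j). i \<le> j \<and> j < n} = flag n g"
proof -
  have "(\<forall>i<n. \<forall>j<n. (i, j) \<notin> {(i, j). i \<le> j \<and> j < n} \<longrightarrow> h $$ (i, j) = 1\<^sub>m n $$ (i, j)) \<longleftrightarrow>
    triangular_wrt (\<lambda>i. - int i) n h" for h
    by (auto simp: triangular_wrt_def)
  then show ?thesis unfolding coset_flat_def flag_eq borel_upper_iff by auto
qed

lemma flag_mult_borel:
  assumes "g \<in> carrier (GL n)" "c \<in> borel_upper n"
  shows "flag n (g * c) = flag n g"
proof -
  obtain d where d: "d \<in> borel_upper n" "c * d = 1\<^sub>m n" "d * c = 1\<^sub>m n" using borel_upper_inverse[OF assms(2)] by blast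
  have gc: "g \<in> carrier_mat n n" using assms(1) by (rule GL_carrier_mat)
  have "g * c * b = g * (c * b)" if "b \<in> borel_upper n" for b
    by (rule mat_assoc[OF gc borel_carrier(1)[OF assms(2)] borel_carrier(1)[OF that]])
  moreover have "g * b = g * c * (d * b)" if b: "b \<in> borel_upper n" for b
  proof -
    have "g * c * (d * b) = g * ((c * d) * b)"
      using b assms(2) d(1) gc by (simp add: mat_assoc[of _ n] mult_carrier_square[of _ n] borel_carrier)
    then show ?thesis unfolding d(2) using borel_carrier(1)[OF b] by simp
  qed
  ultimately show ?thesis
    unfolding flag_eq using borel_upper_mult[OF assms(2)] borel_upper_mult[OF d(1)] by blast
qed

lemma flag_eq_imp:
  assumes "g \<in> carrier (GL n)" "h \<in> carrier (GL n)" "flag n g = flag n h"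
  obtains c where "c \<in> borel_upper n" "h = g * c"
proof -
  have "h * 1\<^sub>m n \<in> flag n h" unfolding flag_eq using one_in_borel_upper by blast
  then have "h \<in> flag n g" using assms(2,3) one_mult_square(2)[OF GL_carrier_mat[OF assms(2)]] by simp
  then show thesis using that unfolding flag_eq by blast
qed

lemma flag_points_eq: "flag_points n = flag n ` carrier (GL n)"
  unfolding flag_points_def LCOSETS_def flag_def by auto

lemma continuous_map_flag: "continuous_map (zariski_GL n) (flag_variety n) (flag n)"
  unfolding continuous_map_def topspace_zariski_GL topspace_flag_variety
  by (auto simp: openin_flag_variety flag_points_eq flag_def[symmetric])

text \<open>
  The saturation of an open set is a union of right translates of it.
\<close>

lemma open_map_flag: "open_map (zariski_GL n) (flag_variety n) (flag n)"
  unfolding open_map_def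
proof (intro allI impI)
  fix U assume U: "openin (zariski_GL n) U"
  have UG: "U \<subseteq> carrier (GL n)" using openin_subset[OF U] by (simp add: topspace_zariski_GL)
  have "{g \<in> carrier (GL n). flag n g \<in> flag n ` U} =
      (\<Union>c\<in>borel_upper n. {g \<in> topspace (zariski_GL n). 1\<^sub>m n * g * c \<in> U})"
  proof (intro equalityI subsetI)
    fix g assume "g \<in> {g \<in> carrier (GL n). flag n g \<in> flag n ` U}"
    then obtain u where u: "g \<in> carrier (GL n)" "u \<in> U" "flag n g = flag n u" by auto
    then obtain c where "c \<in> borel_upper n" "u = g * c" using flag_eq_imp UG by blast
    then show "g \<in> (\<Union>c\<in>borel_upper n. {g \<in> topspace (zariski_GL n). 1\<^sub>m n * g * c \<in> U})"
      using u by (auto simp: topspace_zariski_GL one_mult_square[OF GL_carrier_mat])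
  next
    fix g assume "g \<in> (\<Union>c\<in>borel_upper n. {g \<in> topspace (zariski_GL n). 1\<^sub>m n * g * c \<in> U})"
    then obtain c where c: "c \<in> borel_upper n" "g \<in> carrier (GL n)" "g * c \<in> U"
      by (auto simp: topspace_zariski_GL one_mult_square[OF GL_carrier_mat])
    then show "g \<in> {g \<in> carrier (GL n). flag n g \<in> flag n ` U}"
      using flag_mult_borel[OF c(2,1)] by (metis (mono_tags, lifting) imageI mem_Collect_eq)
  qed
  moreover have "openin (zariski_GL n) {g \<in> topspace (zariski_GL n). 1\<^sub>m n * g * c \<in> U}" if "c \<in> borel_upper n" for c
    using openin_continuous_map_preimage[OF continuous_map_translations[OF one_in_GL borel_upper_GL[OF that]] U] .
  then have "openin (zariski_GL n) (\<Union>c\<in>borel_upper n. {g \<in> topspace (zariski_GL n). 1\<^sub>m n * g * c \<in> U})"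
    by (intro openin_Union) auto
  ultimately show "openin (flag_variety n) (flag n ` U)"
    unfolding openin_flag_variety flag_def[symmetric] using UG by (auto simp: flag_points_eq)
qed

text \<open>
  Such sets correspond to sets of cosets. Images under \<open>flag\<close> commute with intersections and closures for
  them.
\<close>

definition borel_saturated :: "nat \<Rightarrow> complex mat set \<Rightarrow> bool" where
  "borel_saturated n A \<longleftrightarrow> A \<subseteq> carrier (GL n) \<and> (\<forall>g\<in>A. \<forall>c\<in>borel_upper n. g * c \<in> A)"

lemma flag_in_image_iff:
  assumes "borel_saturated n A" "g \<in> carrier (GL n)"
  shows "flag n g \<in> flag n ` A \<longleftrightarrow> g \<in> A"
proof
  assume "flag n g \<in> flag n ` A"
  then obtain a where a: "a \<in> A" "flag n g = flag n a" by auto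
  then have "a \<in> carrier (GL n)" using assms(1) by (auto simp: borel_saturated_def)
  then obtain c where "c \<in> borel_upper n" "g = a * c" using flag_eq_imp[of a n g] assms(2) a(2) by metis
  then show "g \<in> A" using assms(1) a(1) by (simp add: borel_saturated_def)
qed auto

lemma flag_image_Int:
  assumes "borel_saturated n A" "borel_saturated n B"
  shows "flag n ` A \<inter> flag n ` B = flag n ` (A \<inter> B)"
proof (intro equalityI subsetI)
  fix x assume "x \<in> flag n ` A \<inter> flag n ` B"
  then obtain a where a: "x = flag n a" "a \<in> A" "flag n a \<in> flag n ` B" by auto
  then have "a \<in> B" using flag_in_image_iff[OF assms(2), of a] assms(1) by (auto simp: borel_saturated_def)
  then show "x \<in> flag n ` (A \<inter> B)" using a by auto
qed auto

lemma borel_saturated_Int: "borel_saturated n A \<Longrightarrow> borel_saturated n B \<Longrightarrow> borel_saturated n (A \<inter> B)"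
  by (auto simp: borel_saturated_def)

lemma closedin_flag_image:
  assumes "closedin (zariski_GL n) A" "borel_saturated n A"
  shows "closedin (flag_variety n) (flag n ` A)"
proof -
  have "openin (flag_variety n) (flag n ` (carrier (GL n) - A))"
    using open_map_flag assms(1) unfolding open_map_def closedin_def topspace_zariski_GL by blast
  moreover have "flag n ` (carrier (GL n) - A) = flag_points n - flag n ` A"
    using flag_in_image_iff[OF assms(2)] by (auto simp: flag_points_eq)
  moreover have "flag n ` A \<subseteq> flag_points n" using assms(2) by (auto simp: flag_points_eq borel_saturated_def)
  ultimately show ?thesis by (simp add: closedin_def topspace_flag_variety)
qed

lemma borel_saturated_closure:
  assumes "borel_saturated n A"
  shows "borel_saturated n (zariski_GL n closure_of A)"
  unfolding borel_saturated_def
proof (intro conjI ballI)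
  show sub: "zariski_GL n closure_of A \<subseteq> carrier (GL n)"
    using closure_of_subset_topspace[of "zariski_GL n" A] by (simp add: topspace_zariski_GL)
  fix g c assume g: "g \<in> zariski_GL n closure_of A" and c: "c \<in> borel_upper n"
  have "1\<^sub>m n * a * c \<in> A" if "a \<in> A" for a
    using that assms c one_mult_square(1)[OF GL_carrier_mat, of a n] by (auto simp: borel_saturated_def)
  from closure_translation[OF one_in_GL borel_upper_GL[OF c] this g]
  show "g * c \<in> zariski_GL n closure_of A" using one_mult_square(1)[OF GL_carrier_mat, of g n] sub g by auto
qed

lemma flag_closure:
  assumes "borel_saturated n A"
  shows "flag_variety n closure_of (flag n ` A) = flag n ` (zariski_GL n closure_of A)"
proof
  have "A \<subseteq> zariski_GL n closure_of A"
    using assms by (intro closure_of_subset) (auto simp: borel_saturated_def topspace_zariski_GL)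
  then show "flag_variety n closure_of (flag n ` A) \<subseteq> flag n ` (zariski_GL n closure_of A)"
    by (intro closure_of_minimal closedin_flag_image borel_saturated_closure assms) auto
  show "flag n ` (zariski_GL n closure_of A) \<subseteq> flag_variety n closure_of (flag n ` A)"
    by (rule continuous_map_image_closure_subset[OF continuous_map_flag])
qed

lemma borel_saturated_opp_cell:
  assumes "v permutes {..<n}"
  shows "borel_saturated n (opp_cell n v)"
  unfolding borel_saturated_def
proof (intro conjI ballI)
  show "opp_cell n v \<subseteq> carrier (GL n)" by (rule opp_cell_GL[OF assms])
  fix g c assume "g \<in> opp_cell n v" "c \<in> borel_upper n"
  then show "g * c \<in> opp_cell n v"
    using opp_cell_mult[OF _ one_in_borel_lower, of g n v c] opp_cell_GL[OF assms] one_mult_square(1)[OF GL_carrier_mat, of g n]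
    by auto
qed

lemma borel_saturated_cell:
  assumes "v permutes {..<n}"
  shows "borel_saturated n (cell n v)"
  unfolding borel_saturated_def
proof (intro conjI ballI)
  show "cell n v \<subseteq> carrier (GL n)" by (rule cell_GL[OF assms])
  fix g c assume "g \<in> cell n v" "c \<in> borel_upper n"
  then show "g * c \<in> cell n v"
    using cell_mult[OF _ one_in_borel_upper, of g n v c] cell_GL[OF assms] one_mult_square(1)[OF GL_carrier_mat, of g n]
    by auto
qed

lemma borel_saturated_chart: "v permutes {..<n} \<Longrightarrow> borel_saturated n (chart n v)"
  using chart_mult unfolding borel_saturated_def by (auto simp: chart_def)

lemma schubert_cell_flag:
  assumes "w permutes {..<n}"
  shows "schubert_cell n w = flag n ` cell n w"
proof -
  have G: "b * perm_matrix n w \<in> carrier (GL n)" if "b \<in> borel_upper n" for b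
    using that by (simp add: GL_mult_closed borel_upper_GL perm_matrix_GL[OF assms])
  have "flag n (b * perm_matrix n w) = flag n (b * perm_matrix n w * 1\<^sub>m n)" if "b \<in> borel_upper n" for b
    using flag_mult_borel[OF G[OF that] one_in_borel_upper] by simp
  then show ?thesis
    unfolding schubert_cell_def cell_def flag_def[symmetric] mult_GL
    using flag_mult_borel[OF G] one_in_borel_upper by (auto simp: image_iff; blast)
qed

lemma opposite_schubert_cell_flag:
  assumes "v permutes {..<n}"
  shows "opposite_schubert_cell n v = flag n ` opp_cell n v"
proof -
  have G: "b * perm_matrix n v \<in> carrier (GL n)" if "b \<in> borel_lower n" for b
    using that by (simp add: GL_mult_closed borel_lower_GL perm_matrix_GL[OF assms])
  have "flag n (b * perm_matrix n v) = flag n (b * perm_matrix n v * 1\<^sub>m n)" if "b \<in> borel_lower n" for b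
    using flag_mult_borel[OF G[OF that] one_in_borel_upper] by simp
  then show ?thesis
    unfolding opposite_schubert_cell_def opp_cell_def flag_def[symmetric] mult_GL
    using flag_mult_borel[OF G] one_in_borel_upper by (auto simp: image_iff; blast)
qed

section \<open>Kazhdan--Lusztig and Richardson varieties\<close>

text \<open>
  The lifts are the preimages of the two varieties in the general linear group.
\<close>

definition kl_lift :: "nat \<Rightarrow> (nat \<Rightarrow> nat) \<Rightarrow> (nat \<Rightarrow> nat) \<Rightarrow> complex mat set" where
  "kl_lift n v w = cell_closure n w \<inter> opp_cell n v"

definition richardson_lift :: "nat \<Rightarrow> (nat \<Rightarrow> nat) \<Rightarrow> (nat \<Rightarrow> nat) \<Rightarrow> complex mat set" where
  "richardson_lift n v w = cell_closure n w \<inter> zariski_GL n closure_of opp_cell n v"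

lemma kazhdan_lusztig_variety_flag:
  assumes "v permutes {..<n}" "w permutes {..<n}"
  shows "kazhdan_lusztig_variety n v w = flag n ` kl_lift n v w"
  unfolding kazhdan_lusztig_variety_def schubert_variety_def kl_lift_def
    schubert_cell_flag[OF assms(2)] opposite_schubert_cell_flag[OF assms(1)]
    flag_closure[OF borel_saturated_cell[OF assms(2)]]
  by (intro flag_image_Int borel_saturated_closure borel_saturated_cell borel_saturated_opp_cell assms)

lemma richardson_variety_flag:
  assumes "v permutes {..<n}" "w permutes {..<n}"
  shows "richardson_variety n v w = flag n ` richardson_lift n v w"
  unfolding richardson_variety_def schubert_variety_def opposite_schubert_variety_def richardson_lift_def
    schubert_cell_flag[OF assms(2)] opposite_schubert_cell_flag[OF assms(1)]
    flag_closure[OF borel_saturated_cell[OF assms(2)]] flag_closure[OF borel_saturated_opp_cell[OF assms(1)]]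
  by (intro flag_image_Int borel_saturated_closure borel_saturated_cell borel_saturated_opp_cell assms)

lemma borel_saturated_lifts:
  assumes "v permutes {..<n}" "w permutes {..<n}"
  shows "borel_saturated n (kl_lift n v w)" "borel_saturated n (richardson_lift n v w)"
  unfolding kl_lift_def richardson_lift_def
  by (intro borel_saturated_Int borel_saturated_closure borel_saturated_cell borel_saturated_opp_cell assms)+

lemma closedin_richardson:
  assumes "v permutes {..<n}" "w permutes {..<n}"
  shows "closedin (flag_variety n) (flag n ` richardson_lift n v w)"
  by (rule closedin_flag_image[OF _ borel_saturated_lifts(2)[OF assms]]) (simp add: richardson_lift_def closedin_Int)

lemma kl_lift_subset_richardson_lift:
  assumes "v permutes {..<n}"
  shows "kl_lift n v w \<subseteq> richardson_lift n v w"
  using closure_of_subset[of "opp_cell n v" "zariski_GL n"] opp_cell_GL[OF assms]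
  by (auto simp: kl_lift_def richardson_lift_def topspace_zariski_GL)

lemma openin_kl_richardson:
  assumes "v permutes {..<n}" "w permutes {..<n}"
  shows "openin (subtopology (flag_variety n) (flag n ` richardson_lift n v w)) (flag n ` kl_lift n v w)"
proof -
  have "openin (flag_variety n) (flag n ` chart n v)"
    using open_map_flag openin_chart[OF assms(1)] unfolding open_map_def by blast
  moreover have "flag n ` kl_lift n v w = flag n ` richardson_lift n v w \<inter> flag n ` chart n v"
    unfolding flag_image_Int[OF borel_saturated_lifts(2)[OF assms] borel_saturated_chart[OF assms(1)]]
    using closure_opp_cell_Int_chart[OF assms(1)] by (simp add: kl_lift_def richardson_lift_def Int_assoc)
  ultimately show ?thesis by (simp add: openin_subtopology_Int2)
qed

lemma richardson_subset_closure_kl: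
  assumes "v permutes {..<n}" "w permutes {..<n}"
  shows "flag n ` richardson_lift n v w \<subseteq> flag_variety n closure_of (flag n ` kl_lift n v w)"
  unfolding flag_closure[OF borel_saturated_lifts(1)[OF assms]]
  using richardson_density[OF assms(1), of w] by (auto simp: kl_lift_def richardson_lift_def)

lemma flag_image_subset_topspace: "A \<subseteq> carrier (GL n) \<Longrightarrow> flag n ` A \<subseteq> topspace (flag_variety n)"
  by (auto simp: topspace_flag_variety flag_points_eq)

lemma lifts_GL:
  "kl_lift n v w \<subseteq> carrier (GL n)" "richardson_lift n v w \<subseteq> carrier (GL n)"
  using cell_closure_GL by (auto simp: kl_lift_def richardson_lift_def)

lemma perm_matrix_in_cell_closure:
  assumes "v permutes {..<n}" "w permutes {..<n}" "rank_le n v w"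
  shows "perm_matrix n v \<in> cell_closure n w"
  using cell_closure_mono[OF assms] cell_subset_closure[OF assms(1)] perm_matrix_in_cell[of n v] by blast

text \<open>
  The retraction moves a point within its orbit under upper triangular matrices, which
  preserve the closure of the cell of \<open>w\<close>.
\<close>

lemma flag_chart_retraction:
  assumes v: "v permutes {..<n}"
  shows "flag n ` kl_lift n v w = (flag n \<circ> chart_retraction n v) ` (cell_closure n w \<inter> chart n v)"
proof (intro equalityI subsetI)
  fix x assume "x \<in> flag n ` kl_lift n v w"
  then obtain g where g: "x = flag n g" "g \<in> cell_closure n w" "g \<in> opp_cell n v" by (auto simp: kl_lift_def)
  have gG: "g \<in> carrier (GL n)" using g(2) cell_closure_GL by blast
  obtain c where c: "c \<in> borel_upper n" "chart_retraction n v (g * c) = g * c"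
    using chart_retraction_fixes_representative[OF v g(3)] by blast
  have "1\<^sub>m n * g * c \<in> cell_closure n w" by (rule cell_closure_mult[OF g(2) one_in_borel_upper c(1)])
  then have "g * c \<in> cell_closure n w" by (simp add: one_mult_square[OF GL_carrier_mat[OF gG]])
  moreover have "g * c \<in> chart n v"
    using chart_mult[OF v _ c(1)] opp_cell_subset_chart[OF v] g(3) by blast
  moreover have "x = (flag n \<circ> chart_retraction n v) (g * c)"
    using c(2) g(1) flag_mult_borel[OF gG c(1)] by simp
  ultimately show "x \<in> (flag n \<circ> chart_retraction n v) ` (cell_closure n w \<inter> chart n v)" by blast
next
  fix x assume "x \<in> (flag n \<circ> chart_retraction n v) ` (cell_closure n w \<inter> chart n v)"
  then obtain g where g: "x = flag n (chart_retraction n v g)" "g \<in> cell_closure n w" "g \<in> chart n v" by auto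
  obtain a c where "a \<in> borel_upper n" "c \<in> borel_upper n" "chart_retraction n v g = a * g * c"
    "chart_retraction n v g \<in> opp_cell n v"
    using chart_retraction_in_opp_cell[OF v g(3)] by blast
  then show "x \<in> flag n ` kl_lift n v w"
    using g cell_closure_mult[OF g(2)] by (auto simp: kl_lift_def)
qed

lemma irreducible_in_cell_closure:
  assumes "w permutes {..<n}"
  shows "irreducible_in (zariski_GL n) (cell_closure n w)"
  by (rule irreducible_in_between_closure[OF irreducible_in_cell[OF assms] cell_subset_closure[OF assms]]) simp

lemma cell_closure_meets_chart:
  assumes "v permutes {..<n}" "w permutes {..<n}" "rank_le n v w"
  shows "perm_matrix n v \<in> cell_closure n w \<inter> chart n v"
  using perm_matrix_in_cell_closure[OF assms] opp_cell_subset_chart[OF assms(1)] perm_matrix_in_opp_cell by blast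

lemma irreducible_in_kl:
  assumes "v permutes {..<n}" "w permutes {..<n}" "rank_le n v w"
  shows "irreducible_in (flag_variety n) (flag n ` kl_lift n v w)"
proof -
  have "irreducible_in (zariski_GL n) (cell_closure n w \<inter> chart n v)"
    using cell_closure_meets_chart[OF assms]
    by (intro irreducible_in_Int_open irreducible_in_cell_closure openin_chart assms) auto
  moreover have "chart n v \<subseteq> topspace (zariski_GL n)" by (auto simp: chart_def topspace_zariski_GL)
  ultimately have "irreducible_in (subtopology (zariski_GL n) (chart n v)) (cell_closure n w \<inter> chart n v)"
    by (simp add: irreducible_in_subtopology)
  moreover have "continuous_map (subtopology (zariski_GL n) (chart n v)) (flag_variety n) (flag n \<circ> chart_retraction n v)"
    by (rule continuous_map_compose[OF continuous_map_chart_retraction[OF assms(1)] continuous_map_flag])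
  ultimately show ?thesis
    unfolding flag_chart_retraction[OF assms(1)] by (rule irreducible_in_continuous_image)
qed

lemma irreducible_in_richardson:
  assumes "v permutes {..<n}" "w permutes {..<n}" "rank_le n v w"
  shows "irreducible_in (flag_variety n) (flag n ` richardson_lift n v w)"
  by (rule irreducible_in_between_closure[OF irreducible_in_kl[OF assms] image_mono[OF kl_lift_subset_richardson_lift[OF assms(1)]]
        richardson_subset_closure_kl[OF assms(1,2)]])

section \<open>Chains of Kazhdan--Lusztig and Richardson varieties\<close>

lemma flag_image_psubset:
  assumes "borel_saturated n A" "B \<subseteq> carrier (GL n)" "A \<subseteq> B" "g \<in> B" "g \<notin> A"
  shows "flag n ` A \<subset> flag n ` B"
proof -
  have "flag n g \<notin> flag n ` A" using flag_in_image_iff[OF assms(1), of g] assms by blast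
  then show ?thesis using assms(3,4) by blast
qed

text \<open>
  Sweeping out by upper triangular matrices recovers the chart part of a Schubert
  variety from its Kazhdan--Lusztig variety. If the two Kazhdan--Lusztig varieties agreed, so would the parts of
  the Schubert varieties in the chart, which are dense by irreducibility.
\<close>

lemma kl_psubset:
  assumes v: "v permutes {..<n}" and u: "u permutes {..<n}" and w: "w permutes {..<n}"
    and le: "rank_le n v w" "rank_le n u w" "\<not> rank_le n w u"
  shows "flag n ` kl_lift n v u \<subset> flag n ` kl_lift n v w"
proof -
  have sub: "kl_lift n v u \<subseteq> kl_lift n v w"
    using cell_closure_mono[OF u w le(2)] by (auto simp: kl_lift_def)
  have "\<not> kl_lift n v w \<subseteq> kl_lift n v u"
  proof
    assume eq: "kl_lift n v w \<subseteq> kl_lift n v u"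
    have "cell_closure n w \<inter> chart n v \<subseteq> cell_closure n u"
    proof
      fix g assume g: "g \<in> cell_closure n w \<inter> chart n v"
      then have gG: "g \<in> carrier (GL n)" by (auto simp: chart_def)
      obtain a c where ac: "a \<in> borel_upper n" "c \<in> borel_upper n" "chart_retraction n v g = a * g * c"
        "chart_retraction n v g \<in> opp_cell n v"
        using chart_retraction_in_opp_cell[OF v] g by blast
      then have "a * g * c \<in> kl_lift n v w" using cell_closure_mult[of g n w a c] g by (simp add: kl_lift_def)
      then have in_u: "a * g * c \<in> cell_closure n u" using eq by (auto simp: kl_lift_def)
      obtain a' where a': "a' \<in> borel_upper n" "a' * a = 1\<^sub>m n" using borel_upper_inverse[OF ac(1)] by blast
      obtain c' where c': "c' \<in> borel_upper n" "c * c' = 1\<^sub>m n" using borel_upper_inverse[OF ac(2)] by blast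
      have "a' * (a * g * c) * c' = (a' * a) * g * (c * c')"
        using ac(1,2) a'(1) c'(1) GL_carrier_mat[OF gG]
        by (simp add: mat_assoc[of _ n] mult_carrier_square[of _ n] borel_carrier)
      also have "\<dots> = g" unfolding a'(2) c'(2) by (simp add: one_mult_square[OF GL_carrier_mat[OF gG]])
      finally show "g \<in> cell_closure n u" using cell_closure_mult[OF in_u a'(1) c'(1)] by simp
    qed
    then have "zariski_GL n closure_of (cell_closure n w \<inter> chart n v) \<subseteq> cell_closure n u"
      by (intro closure_of_minimal) auto
    moreover have "cell_closure n w \<subseteq> zariski_GL n closure_of (cell_closure n w \<inter> chart n v)"
      using cell_closure_meets_chart[OF v w le(1)]
      by (intro irreducible_in_dense_open irreducible_in_cell_closure openin_chart v w) auto
    ultimately have "perm_matrix n w \<in> cell_closure n u"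
      using cell_subset_closure[OF w] perm_matrix_in_cell[of n w] by blast
    then show False using perm_matrix_closure_cell_rank_le[OF w u] le(3) by blast
  qed
  then obtain g where "g \<in> kl_lift n v w" "g \<notin> kl_lift n v u" by blast
  then show ?thesis
    by (intro flag_image_psubset[OF borel_saturated_lifts(1)[OF v u] lifts_GL(1) sub])
qed

lemma has_chain_kl:
  assumes v: "v permutes {..<n}" and w: "w permutes {..<n}" and vw: "rank_le n v w"
  shows "\<exists>m. has_chain (subtopology (flag_variety n) (flag n ` kl_lift n v w)) m (flag n ` kl_lift n v w)
    \<and> perm_length n w \<le> perm_length n v + m"
proof -
  let ?N = "flag n ` kl_lift n v w"
  have NF: "?N \<subseteq> topspace (flag_variety n)" by (rule flag_image_subset_topspace[OF lifts_GL(1)])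
  obtain m x where x: "rank_chain n v w m x" and m: "perm_length n w \<le> perm_length n v + m"
    using rank_chain_exists[OF v w vw] by (elim exE conjE)
  have perm: "x i permutes {..<n}" if "i \<le> m" for i by (rule rank_chain_permutes[OF x v that])
  have ends: "x 0 = v" "x m = w" using x by (simp_all add: rank_chain_def)
  have ge: "rank_le n v (x i)" if "i \<le> m" for i using rank_chain_mono[OF x, of 0 i] that ends by simp
  have le: "rank_le n (x i) w" if "i \<le> m" for i using rank_chain_mono[OF x, of i m] that ends by simp
  have "closedin (subtopology (flag_variety n) ?N) (flag n ` kl_lift n v (x i)) \<and>
      irreducible_in (subtopology (flag_variety n) ?N) (flag n ` kl_lift n v (x i))" if i: "i \<le> m" for i
  proof
    have sub: "cell_closure n (x i) \<subseteq> cell_closure n w" by (rule cell_closure_mono[OF perm[OF i] w le[OF i]])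
    then have subN: "flag n ` kl_lift n v (x i) \<subseteq> ?N" by (auto simp: kl_lift_def)
    have sat: "borel_saturated n (cell_closure n (x i))"
      by (intro borel_saturated_closure borel_saturated_cell perm i)
    then have "closedin (flag_variety n) (flag n ` cell_closure n (x i))" by (intro closedin_flag_image) simp_all
    then have "closedin (subtopology (flag_variety n) ?N) (?N \<inter> flag n ` cell_closure n (x i))"
      by (rule closedin_subtopology_Int_closed)
    moreover have "?N \<inter> flag n ` cell_closure n (x i) = flag n ` kl_lift n v (x i)"
      unfolding flag_image_Int[OF borel_saturated_lifts(1)[OF v w] sat]
      using sub by (intro arg_cong[where f = "image (flag n)"]) (auto simp: kl_lift_def)
    ultimately show "closedin (subtopology (flag_variety n) ?N) (flag n ` kl_lift n v (x i))" by simp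
    show "irreducible_in (subtopology (flag_variety n) ?N) (flag n ` kl_lift n v (x i))"
      unfolding irreducible_in_subtopology[OF NF]
      using irreducible_in_kl[OF v perm[OF i] ge[OF i]] subN by simp
  qed
  note Y = this
  have step: "flag n ` kl_lift n v (x i) \<subset> flag n ` kl_lift n v (x (Suc i))" if "i < m" for i
    using that by (intro kl_psubset v perm ge rank_chain_step[OF x]) auto
  have "has_chain (subtopology (flag_variety n) ?N) 0 (flag n ` kl_lift n v (x 0))"
    using Y[of 0] by (intro has_chain_0) auto
  from has_chain_extend[where Y = "\<lambda>i. flag n ` kl_lift n v (x i)" and m = m, OF this Y step]
  show ?thesis using m ends by auto
qed

lemma richardson_psubset_upper:
  assumes v: "v permutes {..<n}" and u: "u permutes {..<n}" and w: "w permutes {..<n}"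
    and le: "rank_le n v w" "rank_le n u w" "\<not> rank_le n w u"
  shows "flag n ` richardson_lift n v u \<subset> flag n ` richardson_lift n v w"
proof (rule flag_image_psubset[OF borel_saturated_lifts(2)[OF v u] lifts_GL(2)])
  show "richardson_lift n v u \<subseteq> richardson_lift n v w"
    using cell_closure_mono[OF u w le(2)] by (auto simp: richardson_lift_def)
  have "perm_matrix n w \<in> cell_closure n w \<inter> opp_cell n w"
    using cell_subset_closure[OF w] perm_matrix_in_cell[of n w] perm_matrix_in_opp_cell[of n w] by blast
  then have "perm_matrix n w \<in> zariski_GL n closure_of (cell_closure n w \<inter> opp_cell n v)"
    using density_rank_le[OF v w le(1)] by blast
  also have "\<dots> \<subseteq> richardson_lift n v w"
    unfolding richardson_lift_def using closure_of_mono[of "cell_closure n w \<inter> opp_cell n v" _ "zariski_GL n"]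
    by (metis Int_subset_iff closure_of_closure_of inf_le1 inf_le2)
  finally show "perm_matrix n w \<in> richardson_lift n v w" .
  show "perm_matrix n w \<notin> richardson_lift n v u"
    using perm_matrix_closure_cell_rank_le[OF w u] le(3) by (auto simp: richardson_lift_def)
qed

lemma richardson_psubset_lower:
  assumes v: "v permutes {..<n}" and u: "u permutes {..<n}" and w: "w permutes {..<n}"
    and le: "rank_le n v u" "rank_le n v w" "\<not> rank_le n u v"
  shows "flag n ` richardson_lift n u w \<subset> flag n ` richardson_lift n v w"
proof (rule flag_image_psubset[OF borel_saturated_lifts(2)[OF u w] lifts_GL(2)])
  have "richardson_lift n u w \<subseteq> zariski_GL n closure_of (cell_closure n w \<inter> opp_cell n u)"
    unfolding richardson_lift_def by (rule richardson_density[OF u])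
  also have "\<dots> \<subseteq> zariski_GL n closure_of (cell_closure n w \<inter> opp_cell n v)"
    by (rule closure_of_minimal[OF density_rank_le[OF v u le(1)]]) simp
  also have "\<dots> \<subseteq> richardson_lift n v w"
    unfolding richardson_lift_def using closure_of_mono[of "cell_closure n w \<inter> opp_cell n v" _ "zariski_GL n"]
    by (metis Int_subset_iff closure_of_closure_of inf_le1 inf_le2)
  finally show "richardson_lift n u w \<subseteq> richardson_lift n v w" .
  show "perm_matrix n v \<in> richardson_lift n v w"
    using perm_matrix_in_cell_closure[OF v w le(2)] perm_matrix_in_opp_cell[of n v]
      closure_of_subset[of "opp_cell n v" "zariski_GL n"] opp_cell_GL[OF v]
    by (auto simp: richardson_lift_def topspace_zariski_GL)
  show "perm_matrix n v \<notin> richardson_lift n u w"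
    using closure_opp_cell_rank_le[OF u v _ perm_matrix_in_opp_cell] le(3) by (auto simp: richardson_lift_def)
qed

text \<open>
  Preimages of irreducible closed sets under the projection are irreducible and closed. The smallest of
  them contains a coset of the Borel group, which contributes its own chain.
\<close>

lemma has_chain_flag_variety_lift:
  assumes "has_chain (flag_variety n) k Y"
  shows "has_chain (zariski_GL n) (card {(i, j). i \<le> j \<and> j < n} + k) (carrier (GL n))"
proof -
  let ?m = "card {(i, j). i \<le> j \<and> j < n}"
  obtain Z where Z: "\<forall>i\<le>k. closedin (flag_variety n) (Z i)" "\<forall>i\<le>k. irreducible_in (flag_variety n) (Z i)"
    "\<forall>i<k. Z i \<subset> Z (Suc i)" "Z k \<subseteq> Y"
    using assms by (rule has_chainE)
  let ?P = "\<lambda>i. {g \<in> topspace (zariski_GL n). flag n g \<in> Z i}"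
  have fibre: "irreducible_in (zariski_GL n) {g \<in> topspace (zariski_GL n). flag n g = y}" if y: "y \<in> flag_points n" for y
  proof -
    obtain g where g: "g \<in> carrier (GL n)" "y = flag n g" using y by (auto simp: flag_points_eq)
    have "{h \<in> topspace (zariski_GL n). flag n h = y} = flag n g"
    proof (intro equalityI subsetI)
      fix h assume "h \<in> {h \<in> topspace (zariski_GL n). flag n h = y}"
      then have "h \<in> carrier (GL n)" "flag n g = flag n h" using g(2) by (simp_all add: topspace_zariski_GL)
      then obtain c where "c \<in> borel_upper n" "h = g * c" using flag_eq_imp[OF g(1)] by blast
      then show "h \<in> flag n g" unfolding flag_eq by blast
    next
      fix h assume "h \<in> flag n g"
      then obtain c where "c \<in> borel_upper n" "h = g * c" unfolding flag_eq by blast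
      then show "h \<in> {h \<in> topspace (zariski_GL n). flag n h = y}"
        using g flag_mult_borel[OF g(1)] GL_mult_closed[OF g(1) borel_upper_GL] by (simp add: topspace_zariski_GL)
    qed
    then show ?thesis using irreducible_in_coset_flat[OF g(1)] coset_flat_borel[OF g(1)] by metis
  qed
  have sub: "Z i \<subseteq> flag_points n" if "i \<le> k" for i
    using Z(1) that closedin_subset topspace_flag_variety by metis
  have P: "closedin (zariski_GL n) (?P i) \<and> irreducible_in (zariski_GL n) (?P i)" if i: "i \<le> k" for i
  proof
    show "closedin (zariski_GL n) (?P i)"
      using closedin_continuous_map_preimage[OF continuous_map_flag] Z(1) i by blast
    show "irreducible_in (zariski_GL n) (?P i)"
      using Z(2) i sub[OF i] fibre
      by (intro irreducible_in_open_map_preimage[OF continuous_map_flag open_map_flag]) auto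
  qed
  have step: "?P i \<subset> ?P (Suc i)" if i: "i < k" for i
  proof -
    obtain y where y: "y \<in> Z (Suc i)" "y \<notin> Z i" using Z(3) i by blast
    then obtain g where "g \<in> carrier (GL n)" "y = flag n g" using sub[of "Suc i"] i by (auto simp: flag_points_eq)
    then have "g \<in> ?P (Suc i)" "g \<notin> ?P i" using y by (auto simp: topspace_zariski_GL)
    moreover have "?P i \<subseteq> ?P (Suc i)" using Z(3) i by auto
    ultimately show ?thesis by blast
  qed
  obtain g where g: "g \<in> ?P 0" using P[of 0] unfolding irreducible_in_def by blast
  then have gG: "g \<in> carrier (GL n)" "flag n g \<in> Z 0" by (auto simp: topspace_zariski_GL)
  have "coset_flat n g {(i, j). i \<le> j \<and> j < n} \<subseteq> ?P 0"
    unfolding coset_flat_borel[OF gG(1)] flag_eq[of n g]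
    using gG flag_mult_borel[OF gG(1)] GL_mult_closed[OF gG(1) borel_upper_GL] by (auto simp: topspace_zariski_GL)
  then have "has_chain (zariski_GL n) ?m (?P 0)"
    by (rule has_chain_mono[OF has_chain_coset_flat[OF gG(1) order_refl]])
  from has_chain_extend[where Y = ?P and m = k, OF this P step]
  have "has_chain (zariski_GL n) (?m + k) (?P k)" .
  then show ?thesis by (rule has_chain_mono) (auto simp: topspace_zariski_GL)
qed

text \<open>
  The positions on or above the diagonal used for the coset and those above it that count the
  inversions of the longest permutation make up \<open>n\<^sup>2\<close> positions.
\<close>

lemma has_chain_flag_variety_le:
  assumes "has_chain (flag_variety n) k Y"
  shows "k \<le> perm_length n (longest_perm n)"
proof -
  let ?U = "{(i, j). i \<le> j \<and> j < n}" and ?S = "{(i, j). i < j \<and> j < n} :: (nat \<times> nat) set"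
  have "card ?U + k \<le> n * n"
    by (rule has_chain_zariski_GL_le[OF has_chain_flag_variety_lift[OF assms]])
  moreover have "card ?U + card ?S = n * n"
  proof -
    have fin: "finite ?U" "finite ?S"
      by (rule finite_subset[of _ "{..<n} \<times> {..<n}"]; auto)+
    have "{..<n} \<times> {..<n} = ?U \<union> prod.swap ` ?S" by (auto simp: image_iff not_le)
    moreover have "?U \<inter> prod.swap ` ?S = {}" by auto
    moreover have "card (prod.swap ` ?S) = card ?S" by (intro card_image inj_on_subset[OF swap_inj_on]) auto
    ultimately have "card ({..<n} \<times> {..<n}) = card ?U + card ?S"
      using fin card_Un_disjoint[of ?U "prod.swap ` ?S"] by simp
    then show ?thesis by simp
  qed
  ultimately show ?thesis unfolding perm_length_longest by linarith
qed

text \<open>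
  The given chain is continued by the Richardson varieties in which first \<open>v\<close> is lowered to the
  identity and then \<open>w\<close> is raised to the longest permutation.
\<close>

lemma has_chain_richardson_le:
  assumes v: "v permutes {..<n}" and w: "w permutes {..<n}" and vw: "rank_le n v w"
    and chain: "has_chain (subtopology (flag_variety n) (flag n ` richardson_lift n v w)) k (flag n ` richardson_lift n v w)"
  shows "k + perm_length n v \<le> perm_length n w"
proof -
  let ?R = "\<lambda>v w. flag n ` richardson_lift n v w"
  have 1: "has_chain (flag_variety n) k (?R v w)"
    by (rule has_chain_closed_subtopology[OF closedin_richardson[OF v w] chain])
  have id: "id permutes {..<n}" by (rule permutes_id)
  obtain p e where e: "rank_chain n id v p e" and p: "perm_length n v \<le> p"
    using rank_chain_exists[OF id v rank_le_id[OF v]] perm_length_id[of n] by auto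
  have ends: "e 0 = id" "e p = v" using e by (simp_all add: rank_chain_def)
  have eperm: "e i permutes {..<n}" if "i \<le> p" for i by (rule rank_chain_permutes[OF e id that])
  have ew: "rank_le n (e i) w" if "i \<le> p" for i
    using rank_le_trans[OF _ vw] rank_chain_mono[OF e that] ends by simp
  have 2: "has_chain (flag_variety n) (k + p) (?R (e (p - p)) w)"
  proof (rule has_chain_extend[where Y = "\<lambda>i. ?R (e (p - i)) w"])
    show "has_chain (flag_variety n) k (?R (e (p - 0)) w)" using 1 ends by simp
    show "closedin (flag_variety n) (?R (e (p - i)) w) \<and> irreducible_in (flag_variety n) (?R (e (p - i)) w)" for i
      by (intro conjI closedin_richardson irreducible_in_richardson eperm w ew) simp_all
    fix i assume i: "i < p"
    then have "Suc (p - Suc i) = p - i" by simp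
    then show "?R (e (p - i)) w \<subset> ?R (e (p - Suc i)) w"
      using i rank_chain_step[OF e, of "p - Suc i"]
      by (intro richardson_psubset_lower eperm w ew) auto
  qed
  obtain r x where x: "rank_chain n w (longest_perm n) r x"
    and r: "perm_length n (longest_perm n) \<le> perm_length n w + r"
    using rank_chain_exists[OF w longest_perm_permutes rank_le_longest[OF w]] by (elim exE conjE)
  have xends: "x 0 = w" using x by (simp add: rank_chain_def)
  have xperm: "x i permutes {..<n}" if "i \<le> r" for i by (rule rank_chain_permutes[OF x w that])
  have "has_chain (flag_variety n) (k + p + r) (?R id (x r))"
  proof (rule has_chain_extend[where Y = "\<lambda>i. ?R id (x i)"])
    show "has_chain (flag_variety n) (k + p) (?R id (x 0))" using 2 ends xends by simp
    show "closedin (flag_variety n) (?R id (x i)) \<and> irreducible_in (flag_variety n) (?R id (x i))" if "i \<le> r" for i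
      by (intro conjI closedin_richardson irreducible_in_richardson id xperm rank_le_id that)
    show "?R id (x i) \<subset> ?R id (x (Suc i))" if "i < r" for i
      using that by (intro richardson_psubset_upper id xperm rank_le_id rank_chain_step[OF x]) auto
  qed
  then have "k + p + r \<le> perm_length n (longest_perm n)" by (rule has_chain_flag_variety_le)
  then show ?thesis using p r by linarith
qed

section \<open>Comparison of the complexities\<close>

lemma krull_dim_kl_richardson:
  assumes v: "v permutes {..<n}" and w: "w permutes {..<n}" and vw: "rank_le n v w"
  shows "krull_dim (subtopology (flag_variety n) (flag n ` kl_lift n v w)) =
    krull_dim (subtopology (flag_variety n) (flag n ` richardson_lift n v w))"
proof (rule antisym)
  let ?N = "flag n ` kl_lift n v w" and ?R = "flag n ` richardson_lift n v w"
  have NR: "?N \<subseteq> ?R" "?R \<subseteq> topspace (flag_variety n)"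
    by (rule image_mono[OF kl_lift_subset_richardson_lift[OF v]], rule flag_image_subset_topspace[OF lifts_GL(2)])
  have top: "topspace (subtopology (flag_variety n) ?N) = ?N" "topspace (subtopology (flag_variety n) ?R) = ?R"
    using NR by auto
  show "krull_dim (subtopology (flag_variety n) ?N) \<le> krull_dim (subtopology (flag_variety n) ?R)"
    by (rule krull_dim_subspace_mono[OF NR])
  obtain m where m: "has_chain (subtopology (flag_variety n) ?N) m ?N" "perm_length n w \<le> perm_length n v + m"
    using has_chain_kl[OF v w vw] by blast
  have "krull_dim (subtopology (flag_variety n) ?R) \<le> enat m"
    unfolding krull_dim_has_chain top
  proof (rule Sup_least)
    fix d assume "d \<in> {enat k |k. has_chain (subtopology (flag_variety n) ?R) k ?R}"
    then obtain k where "d = enat k" "has_chain (subtopology (flag_variety n) ?R) k ?R" by blast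
    then show "d \<le> enat m" using has_chain_richardson_le[OF v w vw, of k] m(2) by simp
  qed
  also have "enat m \<le> krull_dim (subtopology (flag_variety n) ?N)"
    unfolding krull_dim_has_chain top using m(1) by (intro Sup_upper) blast
  finally show "krull_dim (subtopology (flag_variety n) ?R) \<le> krull_dim (subtopology (flag_variety n) ?N)" .
qed

lemma torus_borel:
  assumes "t \<in> carrier (torus n)"
  shows "t \<in> borel_upper n" "t \<in> borel_lower n"
proof -
  have t: "t \<in> carrier (GL n)" "diagonal_mat t" using assms by (auto simp: torus_def)
  then have "t $$ (i, j) = 0" if "i < n" "j < n" "i \<noteq> j" for i j
    using that GL_carrier_mat[OF t(1)] unfolding diagonal_mat_def by auto
  then have "triangular_wrt \<tau> n t" for \<tau> unfolding triangular_wrt_def by (metis order_refl)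
  then show "t \<in> borel_upper n" "t \<in> borel_lower n" using t(1) by (simp_all add: borel_upper_iff borel_lower_iff)
qed

lemma left_translation_flag:
  assumes "t \<in> carrier (GL n)" "g \<in> carrier (GL n)"
  shows "left_translation n t (flag n g) = flag n (t * g)"
proof -
  have "t * (g * b) = t * g * b" if "b \<in> borel_upper n" for b
    by (rule mat_assoc[OF GL_carrier_mat[OF assms(1)] GL_carrier_mat[OF assms(2)] borel_carrier(1)[OF that], symmetric])
  then show ?thesis
    unfolding left_translation_def flag_eq l_coset_def mult_GL
    by (intro equalityI subsetI) (clarsimp, metis)+
qed

lemma orbit_subset_kl:
  assumes "v permutes {..<n}" "x \<in> flag n ` kl_lift n v w"
  shows "orbit (torus n) (left_translation n) x \<subseteq> flag n ` kl_lift n v w"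
proof
  fix y assume "y \<in> orbit (torus n) (left_translation n) x"
  then obtain t where t: "t \<in> carrier (torus n)" "y = left_translation n t x" by (auto simp: orbit_def)
  obtain g where g: "x = flag n g" "g \<in> cell_closure n w" "g \<in> opp_cell n v" using assms(2) by (auto simp: kl_lift_def)
  have gG: "g \<in> carrier (GL n)" using g(2) cell_closure_GL by blast
  have tg: "t * g \<in> carrier (GL n)" by (rule GL_mult_closed[OF borel_upper_GL[OF torus_borel(1)[OF t(1)]] gG])
  have "t * g * 1\<^sub>m n \<in> cell_closure n w" "t * g * 1\<^sub>m n \<in> opp_cell n v"
    by (rule cell_closure_mult[OF g(2) torus_borel(1)[OF t(1)] one_in_borel_upper],
        rule opp_cell_mult[OF g(3) torus_borel(2)[OF t(1)] one_in_borel_upper])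
  then have "t * g \<in> kl_lift n v w" by (simp add: kl_lift_def one_mult_square[OF GL_carrier_mat[OF tg]])
  moreover have "y = flag n (t * g)"
    unfolding t(2) g(1) by (rule left_translation_flag[OF borel_upper_GL[OF torus_borel(1)[OF t(1)]] gG])
  ultimately show "y \<in> flag n ` kl_lift n v w" by blast
qed

theorem corollary4p16:
  fixes n :: nat and v w :: "nat \<Rightarrow> nat"
  assumes "v permutes {..<n}" and "w permutes {..<n}" and "bruhat_le n v w"
  shows "torus_complexity n (kazhdan_lusztig_variety n v w) =
         torus_complexity n (richardson_variety n v w)"
proof -
  have vw: "rank_le n v w" by (rule bruhat_le_imp_rank_le[OF assms(3,1)])
  let ?N = "flag n ` kl_lift n v w" and ?R = "flag n ` richardson_lift n v w"
  have "is_general_orbit_dim (torus n) (left_translation n) (subtopology (flag_variety n) ?N) d \<longleftrightarrow>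
      is_general_orbit_dim (torus n) (left_translation n) (subtopology (flag_variety n) ?R) d" for d
    using image_mono[OF kl_lift_subset_richardson_lift[OF assms(1)]] flag_image_subset_topspace[OF lifts_GL(2)]
    by (intro is_general_orbit_dim_open_dense openin_kl_richardson richardson_subset_closure_kl orbit_subset_kl assms(1,2))
  then have "is_general_orbit_dim (torus n) (left_translation n) (subtopology (flag_variety n) ?N) =
      is_general_orbit_dim (torus n) (left_translation n) (subtopology (flag_variety n) ?R)"
    by (rule ext)
  then show ?thesis
    unfolding torus_complexity_def complexity_def kazhdan_lusztig_variety_flag[OF assms(1,2)]
      richardson_variety_flag[OF assms(1,2)] krull_dim_kl_richardson[OF assms(1,2) vw]
    by simp
qed

end
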